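(* Let $\alpha\in(\frac12,1]$, $q\in\mathcal{P}^{\log}(\mathbb{R}^3)$ with $q^-\ge2$, $3<\nu\le2q^-$, and $p\in\mathcal{P}((0,1))$ with $p^->2$. Suppose $$\frac{2\alpha}{p^-}+\frac12\max\left(\frac6{q^-}\left(1-\frac{\nu}{2q^+}\right),\frac3\nu\right)<\alpha-\frac12.$$ If $f\in L^1\big(0,1;L^{q(\cdot)}(\mathbb{R}^3)\cap L^\nu(\mathbb{R}^3)\big)$ is a divergence-free exterior force and $u_0\in L^{q(\cdot)}(\mathbb{R}^3)\cap L^\nu(\mathbb{R}^3)$ is a divergence-free initial datum, then there exist a time $T\in(0,1]$ and a unique mild solution of the fractional Navier–Stokes equations with data $u_0,f$ in the space $L^{p(\cdot)}\big(0,T;L^{q(\cdot)}(\mathbb{R}^3)\cap L^\nu(\mathbb{R}^3)\big)$.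
   Context: Variable Lebesgue spaces. For $\Omega=\mathbb{R}^3$ or an interval, $\mathcal{P}(\Omega)$ is the set of measurable $p:\Omega\to[1,\infty]$; $p^-,p^+$ are the essential infimum and supremum; $\frac a\infty:=0$. With $\omega_p(s)=s^p$ for $p<\infty$, $\omega_\infty(s)=0$ for $s\le1$ and $\omega_\infty(s)=\infty$ for $s>1$, put $\varrho_{p(\cdot)}(f)=\int_\Omega\omega_{p(x)}(|f(x)|)dx$; $L^{p(\cdot)}(\Omega)$ is the space of measurable $f$ with $\varrho_{p(\cdot)}(\lambda f)<\infty$ for some $\lambda>0$, with norm $\inf\{\lambda>0:\varrho_{p(\cdot)}(f/\lambda)\le1\}$ (similarly for vector fields). An intersection $X\cap Y$ carries the norm $\max\{\|\cdot\|_X,\|\cdot\|_Y\}$. $L^{p(\cdot)}(0,T;X)$ has norm $\big\|\,\|u(t,\cdot)\|_X\big\|_{L^{p(\cdot)}((0,T))}$. $\mathcal{P}^{\log}(\mathbb{R}^3)$ is the set of $q\in\mathcal{P}(\mathbb{R}^3)$ such that $g=1/q$ satisfies, for some $c>0$, $g_\infty\in\mathbb{R}$ and all $x,y$, $|g(x)-g(y)|\le\frac{c}{\log(e+1/|x-y|)}$ and $|g(x)-g_\infty|\le\frac{c}{\log(e+|x|)}$. Fractional Navier–Stokes equations on $\mathbb{R}^3$: $\partial_tu=-(-\Delta)^\alpha u-(u\cdot\nabla)u+\nabla P+f$, $\operatorname{div}u=0$, $u(0,\cdot)=u_0$, $\operatorname{div}u_0=0$, with unknown velocity $u$ and pressure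 $P$; $(-\Delta)^\alpha$ has symbol $|\xi|^{2\alpha}$. A mild solution on $(0,T)$ is a solution $u$ of $$u(t,x)=g_{\alpha,t}*u_0(x)+\int_0^tg_{\alpha,t-s}*f(s,x)\,ds-\int_0^tK_{\alpha,t-s}*(u\otimes u)(s,x)\,ds,$$ where $g_{\alpha,t}$ is the convolution kernel of $e^{-t(-\Delta)^\alpha}$ (symbol $e^{-t|\xi|^{2\alpha}}$) and $K_{\alpha,t}$ is the kernel of $e^{-t(-\Delta)^\alpha}\mathbb{P}\operatorname{div}$, $\mathbb{P}$ the Leray projector; i.e. the $j$-th component of $K_{\alpha,t}*(u\otimes u)$ is $\sum_{h,k=1}^3K^{j;h,k}_{\alpha,t}*(u_hu_k)$, where $K^{j;h,k}_{\alpha,t}$ has symbol $i\xi_k\big(\delta_{jh}-\frac{\xi_j\xi_h}{|\xi|^2}\big)e^{-t|\xi|^{2\alpha}}$. *)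

theory Defs
  imports "HOL-Analysis.Analysis" "HOL-Probability.Essential_Supremum"
begin

section \<open>Variable exponents\<close>

definition var_exponents :: "'a::euclidean_space set \<Rightarrow> ('a \<Rightarrow> ereal) set" where
  "var_exponents S = {p \<in> borel_measurable (lebesgue_on S). \<forall>x\<in>S. 1 \<le> p x}"

definition exponent_inf :: "'a::euclidean_space set \<Rightarrow> ('a \<Rightarrow> ereal) \<Rightarrow> ereal" where
  "exponent_inf S p = Liminf (ae_filter (lebesgue_on S)) p"

definition exponent_sup :: "'a::euclidean_space set \<Rightarrow> ('a \<Rightarrow> ereal) \<Rightarrow> ereal" where
  "exponent_sup S p = esssup (lebesgue_on S) p"

text \<open>The class of exponents whose reciprocal (with the convention that the reciprocal of
  infinity is 0, which holds in \<^typ>\<open>ereal\<close>) is globally log-Hoelder continuous.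
  For \<open>x = y\<close> the first inequality is trivially true, as it should be.\<close>

definition log_Hoelder_exponents :: "(real^3 \<Rightarrow> ereal) set" where
  "log_Hoelder_exponents = {q \<in> var_exponents UNIV.
     let g = (\<lambda>x. real_of_ereal (1 / q x)) in
     \<exists>c>0. \<exists>g_inf::real.
       (\<forall>x y. \<bar>g x - g y\<bar> \<le> c / ln (exp 1 + 1 / norm (x - y))) \<and>
       (\<forall>x. \<bar>g x - g_inf\<bar> \<le> c / ln (exp 1 + norm x))}"


section \<open>Variable Lebesgue spaces\<close>

definition omega :: "ereal \<Rightarrow> real \<Rightarrow> ennreal" where
  "omega p s = (if p = \<infinity> then (if s \<le> 1 then 0 else \<infinity>)
                else ennreal (s powr real_of_ereal p))"

definition modular ::
  "('a::euclidean_space \<Rightarrow> ereal) \<Rightarrow> 'a set \<Rightarrow> ('a \<Rightarrow> 'b::real_normed_vector) \<Rightarrow> ennreal" where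
  "modular p S f = (\<integral>\<^sup>+ x. omega (p x) (norm (f x)) \<partial>lebesgue_on S)"

text \<open>Functions are not identified when they agree almost everywhere. The classical spaces are
  the case of a constant exponent.\<close>

definition var_Lebesgue ::
  "('a::euclidean_space \<Rightarrow> ereal) \<Rightarrow> 'a set \<Rightarrow> ('a \<Rightarrow> 'b::real_normed_vector) set" where
  "var_Lebesgue p S = {f \<in> borel_measurable (lebesgue_on S).
     \<exists>l>0. modular p S (\<lambda>x. l *\<^sub>R f x) < \<infinity>}"

definition var_norm ::
  "('a::euclidean_space \<Rightarrow> ereal) \<Rightarrow> 'a set \<Rightarrow> ('a \<Rightarrow> 'b::real_normed_vector) \<Rightarrow> real" where
  "var_norm p S f = Inf {l. 0 < l \<and> modular p S (\<lambda>x. f x /\<^sub>R l) \<le> 1}"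

definition X_space :: "(real^3 \<Rightarrow> ereal) \<Rightarrow> real \<Rightarrow> (real^3 \<Rightarrow> real^3) set" where
  "X_space q \<nu> = var_Lebesgue q UNIV \<inter> var_Lebesgue (\<lambda>_. ereal \<nu>) UNIV"

definition X_norm :: "(real^3 \<Rightarrow> ereal) \<Rightarrow> real \<Rightarrow> (real^3 \<Rightarrow> real^3) \<Rightarrow> real" where
  "X_norm q \<nu> v = max (var_norm q UNIV v) (var_norm (\<lambda>_. ereal \<nu>) UNIV v)"

text \<open>The space \<open>L\<^sup>p(0,T;X)\<close> with \<open>X\<close> as above. Its elements are functions of \<open>(t,x)\<close>, so
  measurability is joint Lebesgue measurability. Almost all slices of such a function are
  measurable; on the exceptional null set of times the value of the norm is irrelevant.\<close>

definition time_X_space ::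
  "(real \<Rightarrow> ereal) \<Rightarrow> real \<Rightarrow> (real^3 \<Rightarrow> ereal) \<Rightarrow> real \<Rightarrow> (real \<Rightarrow> real^3 \<Rightarrow> real^3) set" where
  "time_X_space p T q \<nu> = {u.
     (\<lambda>(t, x). u t x) \<in> borel_measurable (lebesgue_on ({0<..<T} \<times> UNIV)) \<and>
     (AE t in lebesgue_on {0<..<T}. u t \<in> X_space q \<nu>) \<and>
     (\<lambda>t. X_norm q \<nu> (u t)) \<in> var_Lebesgue p {0<..<T}}"


section \<open>Divergence-free fields\<close>

text \<open>Infinite differentiability on the whole space: \<open>D [i\<^sub>1, \<dots>, i\<^sub>k]\<close> is the iterated partial
  derivative of \<open>\<phi>\<close> in the directions \<open>i\<^sub>k, \<dots>, i\<^sub>1\<close>, and every iterated partial derivative is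
  required to be differentiable.\<close>

definition smooth :: "(real^3 \<Rightarrow> real) \<Rightarrow> bool" where
  "smooth \<phi> \<longleftrightarrow> (\<exists>D :: 3 list \<Rightarrow> real^3 \<Rightarrow> real. D [] = \<phi> \<and>
     (\<forall>l x. (D l has_derivative (\<lambda>h. \<Sum>i\<in>UNIV. h $ i * D (i # l) x)) (at x)))"

definition test_function :: "(real^3 \<Rightarrow> real) \<Rightarrow> bool" where
  "test_function \<phi> \<longleftrightarrow> smooth \<phi> \<and> compact (closure {x. \<phi> x \<noteq> 0})"

definition gradient :: "(real^3 \<Rightarrow> real) \<Rightarrow> real^3 \<Rightarrow> real^3" where
  "gradient \<phi> x = (\<chi> i. frechet_derivative \<phi> (at x) (axis i 1))"

text \<open>Divergence zero in the sense of distributions (for locally integrable fields).\<close>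

definition divergence_free :: "(real^3 \<Rightarrow> real^3) \<Rightarrow> bool" where
  "divergence_free v \<longleftrightarrow>
     (\<forall>\<phi>. test_function \<phi> \<longrightarrow> (LINT x|lebesgue. v x \<bullet> gradient \<phi> x) = 0)"


section \<open>Mild solutions\<close>

text \<open>The convolution kernel with symbol \<open>m\<close>, for the Fourier transform normalised so that
  \<open>\<partial>\<^sub>k\<close> has symbol \<open>\<i> \<xi>\<^sub>k\<close>. The real part is taken only to obtain a
  real-valued kernel: the symbols used below are integrable and satisfy
  \<open>m (- \<xi>) = cnj (m \<xi>)\<close>, so their kernels are real.\<close>

definition kernel_of_symbol :: "(real^3 \<Rightarrow> complex) \<Rightarrow> real^3 \<Rightarrow> real" where
  "kernel_of_symbol m x =
     Re ((LINT \<xi>|lebesgue. cis (x \<bullet> \<xi>) * m \<xi>) / (2 * of_real pi) ^ 3)"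

definition heat_kernel :: "real \<Rightarrow> real \<Rightarrow> real^3 \<Rightarrow> real" where
  "heat_kernel \<alpha> t = kernel_of_symbol (\<lambda>\<xi>. of_real (exp (- t * norm \<xi> powr (2 * \<alpha>))))"

definition oseen_kernel :: "real \<Rightarrow> real \<Rightarrow> 3 \<Rightarrow> 3 \<Rightarrow> 3 \<Rightarrow> real^3 \<Rightarrow> real" where
  "oseen_kernel \<alpha> t j h k = kernel_of_symbol (\<lambda>\<xi>.
     \<i> * of_real (\<xi> $ k * ((if j = h then 1 else 0) - \<xi> $ j * \<xi> $ h / (norm \<xi>)\<^sup>2)
                    * exp (- t * norm \<xi> powr (2 * \<alpha>))))"

definition convol :: "(real^3 \<Rightarrow> real) \<Rightarrow> (real^3 \<Rightarrow> 'b::euclidean_space) \<Rightarrow> real^3 \<Rightarrow> 'b" where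
  "convol k v x = (LINT y|lebesgue. k (x - y) *\<^sub>R v y)"

definition oseen_convol ::
  "real \<Rightarrow> real \<Rightarrow> (real^3 \<Rightarrow> real^3) \<Rightarrow> real^3 \<Rightarrow> real^3" where
  "oseen_convol \<alpha> t v x =
     (\<chi> j. \<Sum>h\<in>UNIV. \<Sum>k\<in>UNIV. convol (oseen_kernel \<alpha> t j h k) (\<lambda>y. v y $ h * v y $ k) x)"

text \<open>The integral equation, required for almost every \<open>(t,x)\<close>. The first three conjuncts say
  that the integrals in it converge absolutely; without them a divergent integral would
  silently be read as 0.\<close>

definition mild_solution ::
  "real \<Rightarrow> real \<Rightarrow> (real^3 \<Rightarrow> real^3) \<Rightarrow> (real \<Rightarrow> real^3 \<Rightarrow> real^3) \<Rightarrow>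
   (real \<Rightarrow> real^3 \<Rightarrow> real^3) \<Rightarrow> bool" where
  "mild_solution \<alpha> T u0 f u \<longleftrightarrow> (AE (t, x) in lebesgue_on ({0<..<T} \<times> UNIV).
     integrable lebesgue (\<lambda>y. heat_kernel \<alpha> t (x - y) *\<^sub>R u0 y) \<and>
     set_integrable lebesgue ({0<..<t} \<times> UNIV)
       (\<lambda>(s, y). heat_kernel \<alpha> (t - s) (x - y) *\<^sub>R f s y) \<and>
     (\<forall>j h k. set_integrable lebesgue ({0<..<t} \<times> UNIV)
       (\<lambda>(s, y). oseen_kernel \<alpha> (t - s) j h k (x - y) * (u s y $ h * u s y $ k))) \<and>
     u t x = convol (heat_kernel \<alpha> t) u0 x
           + (LINT s:{0<..<t}|lebesgue. convol (heat_kernel \<alpha> (t - s)) (f s) x)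
           - (LINT s:{0<..<t}|lebesgue. oseen_convol \<alpha> (t - s) (u s) x))"

end

(*
  Only the consequence 2 alpha / p^- + 3 / (2 nu) < alpha - 1/2 of the inequality between the
  exponents is needed. Let phi_R(z) = R / (R + |z|)^4, which has mass independent of R. With
  R = t^(1 / (2 alpha)), the kernel K_t is bounded pointwise by phi_R / R, and Cauchy-Schwarz gives
    |K_t * (u v)| <= C t^(-gamma) |u|_nu (phi_R * |v|^2)^(1/2),  gamma = (1 + 3 / nu) / (2 alpha).
  Log-Hoelder continuity makes convolution with phi_R bounded on the space with exponent q / 2 >= 1,
  uniformly in R. Hence the bilinear term costs only t^(-gamma) in X, the intersection of L^q and L^nu. The hypothesis
  says gamma < 1 - 2/r for some r with 2 < r <= p^-, so the bilinear term maps L^r(0,T;X) into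
  L^infinity(0,T;X) and contracts there for small T. Picard iteration gives existence; conversely
  every solution is bounded in time, and an exponential weight in time gives uniqueness.

  The kernel bounds are obtained for Gaussian symbols first and transferred to
  exp (- t |xi|^(2 alpha)) by writing the latter as a limit of positive combinations of Gaussians.
*)
theory Submission
  imports Defs "HOL-Probability.Characteristic_Functions" "HOL-Computational_Algebra.Polynomial" "HOL-Real_Asymp.Real_Asymp"
begin

text \<open>Variable Lebesgue spaces are not translation invariant and Young's convolution
  inequality fails in them, so the kernels cannot enter through their own L^p norms. Instead a
  radially decreasing pointwise majorant is convolved, and its exponent 4 comes from the Oseen
  symbol: homogeneous of degree 1 but not smooth at the origin, it has a kernel that in general
  decays only like |z|^(-4). The heat kernel fits the same profile because 2 alpha >= 1. In a
  product u v the derivative in the Oseen kernel costs t^(-1/(2 alpha)), and the factor measured in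
  L^nu becomes uniformly bounded after smoothing at the price t^(-3/(2 alpha nu)); this is gamma.
  The other factor keeps the norm that is being estimated, so the bilinear estimate closes in L^q
  and in L^nu by the same argument. Cauchy-Schwarz produces squares, which live in exponent q/2; the
  lower bound 2 for q makes this an admissible exponent. A competing solution is only known to be in
  L^p in time, with no smallness, and therefore has to be shown bounded before it can be
  compared.\<close>

section \<open>The modular inequality\<close>

text \<open>The power \<open>v\<^sup>1\<^sup>/\<^sup>g\<close>, with \<open>g\<close> the reciprocal of the exponent; \<open>g = 0\<close> is the exponent \<open>\<infinity>\<close>.\<close>

definition vpow :: "real \<Rightarrow> ennreal \<Rightarrow> ennreal" where
  "vpow g v = (if g = 0 then (if v \<le> 1 then 0 else \<infinity>)
     else if v = \<infinity> then \<infinity> else ennreal (enn2real v powr (1 / g)))"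

lemma vpow_0 [simp]: "vpow g 0 = 0"
  by (simp add: vpow_def)

lemma vpow_top [simp]: "vpow g top = top"
  by (simp add: vpow_def top_unique)

lemma vpow_ennreal: "g \<noteq> 0 \<Longrightarrow> 0 \<le> r \<Longrightarrow> vpow g (ennreal r) = ennreal (r powr (1 / g))"
  by (simp add: vpow_def)

lemma vpow_mono:
  assumes "0 \<le> g" "v \<le> w"
  shows "vpow g v \<le> vpow g w"
proof (cases "w = \<infinity>")
  case False
  then have "v \<noteq> \<infinity>" using assms(2) by (auto simp: top_unique)
  moreover have "enn2real v \<le> enn2real w"
    using False assms(2) by (simp add: enn2real_mono top.not_eq_extremum)
  ultimately show ?thesis
    using assms False by (auto simp: vpow_def powr_mono2 intro: order_trans)
qed simp

lemma borel_measurable_vpow [measurable]: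
  assumes [measurable]: "G \<in> borel_measurable M" "V \<in> borel_measurable M"
  shows "(\<lambda>x. vpow (G x) (V x)) \<in> borel_measurable M"
  unfolding vpow_def by measurable

text \<open>A power with exponent at least 1 does not decrease numbers above 1. The exception is the
  exponent infinity at the value 1, where \<open>vpow 0 1 = 0\<close>.\<close>

lemma le_vpow:
  assumes "0 \<le> g" "g \<le> 1" "1 \<le> v"
  shows "v \<le> vpow g v \<or> g = 0 \<and> v = 1"
proof (cases "g = 0 \<or> v = \<infinity>")
  case True then show ?thesis using assms by (auto simp: vpow_def)
next
  case False
  then obtain r where r: "v = ennreal r" "r \<ge> 1"
    using assms(3) by (cases v) (auto simp: ennreal_ge_1)
  have "r powr 1 \<le> r powr (1 / g)"
    using r assms False by (intro powr_mono) auto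
  then show ?thesis using False r by (auto simp: vpow_ennreal)
qed

lemma le_1_plus_vpow:
  assumes "0 \<le> g" "g \<le> 1"
  shows "v \<le> 1 + vpow g v"
proof (cases "v \<le> 1")
  case False
  then have "v \<le> vpow g v" using le_vpow[OF assms, of v] by force
  then show ?thesis by (rule add_increasing[rotated]) simp
qed (simp add: add_increasing2)

lemma vpow_le:
  assumes "0 \<le> g" "g \<le> 1" "v \<le> 1"
  shows "vpow g v \<le> v"
proof (cases "g = 0")
  case False
  obtain r where r: "v = ennreal r" "0 \<le> r" "r \<le> 1"
    using assms(3) by (cases v) (auto simp: top_unique ennreal_le_1)
  have "r powr (1 / g) \<le> r powr 1"
    using r assms False by (intro powr_mono') auto
  then show ?thesis using False r by (auto simp: vpow_ennreal)
qed (use assms in \<open>simp add: vpow_def\<close>)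

text \<open>The exponent 1/g is at least 1, so a factor c <= 1 only gets smaller under the power.
  This converts a modular bounded by M >= 1 into a norm bound: dividing the function by M divides
  the modular by at least M.\<close>

lemma vpow_shrink:
  assumes g: "0 \<le> g" "g \<le> 1" and c: "0 \<le> c" "c \<le> 1"
  shows "vpow g (ennreal c * v) \<le> ennreal c * vpow g v"
proof (cases "c = 0 \<or> v = \<infinity>")
  case False
  then obtain r where r: "v = ennreal r" "0 \<le> r" by (cases v) auto
  have cr: "ennreal c * v = ennreal (c * r)" using r c by (simp add: ennreal_mult)
  show ?thesis
  proof (cases "g = 0")
    case True
    show ?thesis
    proof (cases "v \<le> 1")
      case True
      then have "ennreal c * v \<le> 1" using c by (simp add: cr r mult_le_one)
      with \<open>g = 0\<close> show ?thesis by (simp add: vpow_def)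
    qed (use \<open>g = 0\<close> False c in \<open>simp add: vpow_def ennreal_mult_top\<close>)
  next
    case False
    have "c powr (1 / g) \<le> c powr 1"
      using c g False by (intro powr_mono') auto
    then have "(c * r) powr (1 / g) \<le> c * r powr (1 / g)"
      using c r by (simp add: powr_mult mult_right_mono)
    then show ?thesis using cr r c False
      by (simp add: vpow_ennreal ennreal_mult[symmetric])
  qed
qed (use c g in \<open>auto simp: ennreal_mult_top\<close>)

text \<open>Trades the exponent q of a function for q/2 of its square, which is how the
  Cauchy-Schwarz estimate moves between the two spaces. For the exponent infinity both sides only
  test v <= 1.\<close>

lemma vpow_square:
  assumes "0 \<le> g"
  shows "vpow g v = vpow (2 * g) (v * v)"
proof (cases v)
  case (real r)
  have 1: "(v * v \<le> 1) = (v \<le> 1)"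
    using real by (simp add: ennreal_mult[symmetric] ) (metis abs_of_nonneg abs_square_le_1 power2_eq_square)
  have 2: "r powr (1 / g) = (r * r) powr (1 / (2 * g))" if "g \<noteq> 0"
    using real assms that by (cases "r = 0") (auto simp: powr_def ln_mult field_simps)
  show ?thesis using 1 2 real by (auto simp: vpow_def ennreal_mult[symmetric] enn2real_mult)
qed auto

text \<open>The supporting line of the convex function v^(1/g) at the point a, multiplied by g and
  arranged without subtraction because the values are extended nonnegative reals.\<close>

lemma vpow_Young:
  assumes g: "0 < g" "g \<le> 1" and a: "0 < a"
  shows "ennreal (a powr (1 / g - 1)) * v \<le> ennreal g * vpow g v + ennreal ((1 - g) * a powr (1 / g))"
proof (cases "v = \<infinity>")
  case True
  then show ?thesis using g by (simp add: ennreal_mult_top)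
next
  case False
  then obtain r where r: "v = ennreal r" "0 \<le> r" by (cases v) auto
  have "a powr (1 / g - 1) * r \<le> g * r powr (1 / g) + (1 - g) * a powr (1 / g)"
  proof (cases "r = 0")
    case False
    have "(r powr (1 / g)) powr g * (a powr (1 / g)) powr (1 - g) \<le> g * r powr (1 / g) + (1 - g) * a powr (1 / g)"
      using g a r False by (intro Youngs_inequality_0) auto
    moreover have "(r powr (1 / g)) powr g = r" using g r by (simp add: powr_powr)
    moreover have "(a powr (1 / g)) powr (1 - g) = a powr (1 / g - 1)"
      using g by (simp add: powr_powr field_simps)
    ultimately show ?thesis by (simp add: mult.commute)
  qed (use g in auto)
  then show ?thesis using r g a
    by (simp add: vpow_ennreal ennreal_mult[symmetric] ennreal_plus[symmetric] del: ennreal_plus)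
qed

text \<open>Mass at most 1 suffices because \<open>vpow g 0 = 0\<close>. The supporting line is
  taken at the mean b, whose finiteness has to be shown first; the right-hand side may be assumed
  finite. The exponent infinity is separate: there a finite right-hand side forces w <= 1 almost
  everywhere that \<rho> is positive.\<close>

lemma vpow_Jensen:
  assumes [measurable]: "\<rho> \<in> borel_measurable M" "w \<in> borel_measurable M"
    and \<rho>: "(\<integral>\<^sup>+x. \<rho> x \<partial>M) \<le> 1" and g: "0 \<le> g" "g \<le> 1"
  shows "vpow g (\<integral>\<^sup>+x. \<rho> x * w x \<partial>M) \<le> (\<integral>\<^sup>+x. \<rho> x * vpow g (w x) \<partial>M)"
proof (cases "(\<integral>\<^sup>+x. \<rho> x * vpow g (w x) \<partial>M) = \<infinity>")
  case False
  define I where "I = (\<integral>\<^sup>+x. \<rho> x * vpow g (w x) \<partial>M)"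
  define a where "a = (\<integral>\<^sup>+x. \<rho> x * w x \<partial>M)"
  have "a \<le> (\<integral>\<^sup>+x. \<rho> x + \<rho> x * vpow g (w x) \<partial>M)"
    unfolding a_def
    by (intro nn_integral_mono) (metis distrib_left g le_1_plus_vpow mult.right_neutral mult_left_mono zero_le)
  also have "\<dots> = (\<integral>\<^sup>+x. \<rho> x \<partial>M) + I" unfolding I_def by (rule nn_integral_add) auto
  also have "\<dots> < \<infinity>" using \<rho> False
    by (simp add: I_def top.not_eq_extremum order_le_less_trans)
  finally obtain b where b: "a = ennreal b" "0 \<le> b" by (cases a) auto
  show ?thesis
  proof (cases "g = 0")
    case True
    have "AE x in M. \<rho> x * vpow g (w x) \<noteq> \<infinity>"
      using False by (intro nn_integral_PInf_AE) auto
    then have "AE x in M. \<rho> x * w x \<le> \<rho> x"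
    proof (eventually_elim, goal_cases)
      case (1 x)
      then have "\<rho> x = 0 \<or> w x \<le> 1" using True
        by (auto simp: vpow_def ennreal_top_mult ennreal_mult_top split: if_splits)
      then show ?case using mult_left_mono[of "w x" 1 "\<rho> x"] by auto
    qed
    then have "a \<le> (\<integral>\<^sup>+x. \<rho> x \<partial>M)" unfolding a_def by (rule nn_integral_mono_AE)
    then have "a \<le> 1" using \<rho> by simp
    then show ?thesis using True by (simp add: vpow_def a_def)
  next
    case g0: False
    show ?thesis
    proof (cases "b = 0")
      case True then show ?thesis using b by (simp add: a_def)
    next
      case b0: False
      define c where "c = b powr (1 / g)"
      have "ennreal (b powr (1 / g - 1)) * a = (\<integral>\<^sup>+x. \<rho> x * (ennreal (b powr (1 / g - 1)) * w x) \<partial>M)"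
        unfolding a_def by (subst nn_integral_cmult[symmetric]) (auto simp: ac_simps)
      also have "\<dots> \<le> (\<integral>\<^sup>+x. \<rho> x * (ennreal g * vpow g (w x) + ennreal ((1 - g) * c)) \<partial>M)"
        unfolding c_def using g g0 b b0 by (intro nn_integral_mono mult_left_mono vpow_Young) auto
      also have "\<dots> = (\<integral>\<^sup>+x. ennreal g * (\<rho> x * vpow g (w x)) + ennreal ((1 - g) * c) * \<rho> x \<partial>M)"
        by (simp add: algebra_simps)
      also have "\<dots> = ennreal g * I + ennreal ((1 - g) * c) * (\<integral>\<^sup>+x. \<rho> x \<partial>M)"
        unfolding I_def by (simp add: nn_integral_add nn_integral_cmult)
      also have "\<dots> \<le> ennreal g * I + ennreal ((1 - g) * c) * 1"
        using \<rho> by (intro add_left_mono mult_left_mono) auto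
      finally have *: "ennreal (b powr (1 / g - 1)) * a \<le> ennreal g * I + ennreal ((1 - g) * c)" by simp
      obtain i where i: "I = ennreal i" "0 \<le> i" using False by (cases I) (auto simp: I_def)
      have "b powr (1 / g - 1) * b = c"
        using b b0 by (simp add: c_def powr_diff)
      then have "ennreal (b powr (1 / g - 1)) * a = ennreal c"
        by (simp add: b ennreal_mult[symmetric])
      then have "c \<le> g * i + (1 - g) * c"
        using * i g by (simp add: c_def ennreal_mult[symmetric] ennreal_plus[symmetric] del: ennreal_plus)
      then have "g * c \<le> g * i" by (simp add: algebra_simps)
      then have "c \<le> i" using g g0 by simp
      then show ?thesis using b g0 i by (simp add: a_def[symmetric] I_def[symmetric] vpow_ennreal c_def)
    qed
  qed
qed simp

section \<open>Norm bounds through the modular, and Minkowski's integral inequality\<close>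

text \<open>The norm bound \<open>\<parallel>V\<parallel> \<le> l\<close> in the variable Lebesgue space with exponent \<open>1/G\<close>, stated through the modular
  so that no measurability of a norm and no infimum is involved.\<close>

definition ebnd :: "('a::euclidean_space \<Rightarrow> real) \<Rightarrow> real \<Rightarrow> ('a \<Rightarrow> ennreal) \<Rightarrow> bool" where
  "ebnd G l V \<longleftrightarrow> (\<integral>\<^sup>+x. vpow (G x) (V x / ennreal l) \<partial>lborel) \<le> 1"

lemma ebnd_mono:
  assumes "ebnd G l W" "AE x in lborel. V x \<le> W x" "\<And>x. 0 \<le> G x" "0 < l" "l \<le> m"
  shows "ebnd G m V"
proof -
  have "(\<integral>\<^sup>+x. vpow (G x) (V x / ennreal m) \<partial>lborel) \<le> (\<integral>\<^sup>+x. vpow (G x) (W x / ennreal l) \<partial>lborel)"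
    using assms(2)
  proof (intro nn_integral_mono_AE, eventually_elim)
    case (elim x)
    have "V x / ennreal m \<le> W x / ennreal l"
      unfolding divide_ennreal_def
      using elim assms(4,5) by (intro mult_mono) (auto simp: inverse_ennreal ennreal_leI)
    then show ?case using assms(3) by (rule vpow_mono[rotated])
  qed
  then show ?thesis using assms(1) by (simp add: ebnd_def)
qed

lemma ebnd_scale:
  assumes "ebnd G l V" "0 < l" "0 < c"
  shows "ebnd G (c * l) (\<lambda>x. ennreal c * V x)"
proof -
  have "ennreal c * v / ennreal (c * l) = v / ennreal l" for v
    using assms by (cases v)
      (auto simp: divide_ennreal ennreal_mult[symmetric] ennreal_mult_top ennreal_top_divide)
  then show ?thesis using assms by (simp add: ebnd_def)
qed

lemma ebnd_finite:
  assumes "ebnd G l V" and [measurable]: "G \<in> borel_measurable borel" "V \<in> borel_measurable borel"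
  shows "AE x in lborel. V x < \<infinity>"
proof -
  have "AE x in lborel. vpow (G x) (V x / ennreal l) \<noteq> \<infinity>"
    using assms(1) by (intro nn_integral_PInf_AE) (auto simp: ebnd_def top_unique)
  then show ?thesis
    by eventually_elim (auto simp: less_top[symmetric] ennreal_top_divide)
qed

text \<open>A constant is not integrable over the whole space, so \<epsilon> is subtracted before
  integrating: V - \<epsilon> is at most \<epsilon> times the power of V/\<epsilon>, and the
  integral of the latter is at most 1. Subtraction in \<open>ennreal\<close> is truncated at 0;
  Fatou's lemma lets \<epsilon> tend to 0.\<close>

lemma ebnd_zero:
  assumes "\<And>n. ebnd G (\<epsilon> n) V" "\<epsilon> \<longlonglongrightarrow> 0" "\<And>n. 0 < \<epsilon> n"
    and G: "\<And>x. 0 \<le> G x" "\<And>x. G x \<le> 1"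
    and [measurable]: "G \<in> borel_measurable borel" "V \<in> borel_measurable borel"
  shows "AE x in lborel. V x = 0"
proof -
  have fin: "(\<integral>\<^sup>+x. (V x - ennreal (\<epsilon> n)) \<partial>lborel) \<le> ennreal (\<epsilon> n)" for n
  proof -
    have "V x - ennreal (\<epsilon> n) \<le> ennreal (\<epsilon> n) * vpow (G x) (V x / ennreal (\<epsilon> n))" for x
    proof -
      have "ennreal (\<epsilon> n) * (V x / ennreal (\<epsilon> n)) \<le> ennreal (\<epsilon> n) * (1 + vpow (G x) (V x / ennreal (\<epsilon> n)))"
        by (intro mult_left_mono le_1_plus_vpow G) auto
      moreover have "ennreal (\<epsilon> n) * (V x / ennreal (\<epsilon> n)) = V x"
        using assms(3)[of n] by (cases "V x") (auto simp: divide_ennreal ennreal_mult[symmetric] ennreal_mult_top ennreal_top_divide)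
      ultimately show ?thesis
        by (metis distrib_left ennreal_minus_le_iff mult.right_neutral ennreal_less_top less_irrefl)
    qed
    then have "(\<integral>\<^sup>+x. (V x - ennreal (\<epsilon> n)) \<partial>lborel) \<le> (\<integral>\<^sup>+x. ennreal (\<epsilon> n) * vpow (G x) (V x / ennreal (\<epsilon> n)) \<partial>lborel)"
      by (intro nn_integral_mono) auto
    also have "\<dots> = ennreal (\<epsilon> n) * (\<integral>\<^sup>+x. vpow (G x) (V x / ennreal (\<epsilon> n)) \<partial>lborel)"
      by (rule nn_integral_cmult) measurable
    also have "\<dots> \<le> ennreal (\<epsilon> n) * 1"
      using assms(1)[of n] unfolding ebnd_def by (rule mult_left_mono) simp
    finally show ?thesis by simp
  qed
  have "(\<integral>\<^sup>+x. V x \<partial>lborel) \<le> (\<integral>\<^sup>+x. liminf (\<lambda>n. V x - ennreal (\<epsilon> n)) \<partial>lborel)"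
  proof (intro nn_integral_mono)
    fix x
    have "(\<lambda>n. V x - ennreal (\<epsilon> n)) \<longlonglongrightarrow> V x - ennreal 0"
      by (rule tendsto_diff_ennreal_general[OF tendsto_const tendsto_ennrealI[OF assms(2)]]) simp
    then show "V x \<le> liminf (\<lambda>n. V x - ennreal (\<epsilon> n))" by (simp add: lim_imp_Liminf)
  qed
  also have "\<dots> \<le> liminf (\<lambda>n. \<integral>\<^sup>+x. (V x - ennreal (\<epsilon> n)) \<partial>lborel)"
    by (rule nn_integral_liminf) auto
  also have "\<dots> \<le> liminf (\<lambda>n. ennreal (\<epsilon> n))"
    by (intro Liminf_mono always_eventually allI fin)
  also have "\<dots> = 0"
    using tendsto_ennrealI[OF assms(2)] by (simp add: lim_imp_Liminf)
  finally show ?thesis by (simp add: nn_integral_0_iff_AE)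
qed

text \<open>Constant 1 and no duality: the weight \<rho>(s) = N(s)/L has mass at most 1 and W(s)/L =
  \<rho>(s) W(s)/N(s), so Jensen's inequality at each x followed by Tonelli bounds the modular by a
  mean of modulars. The alternative W(s) = 0 covers parameters at which no positive bound is
  available.\<close>

lemma ebnd_Minkowski:
  fixes W :: "'s \<Rightarrow> 'a::euclidean_space \<Rightarrow> ennreal" and N :: "'s \<Rightarrow> real"
  assumes "sigma_finite_measure M"
    and W [measurable]: "(\<lambda>(s, x). W s x) \<in> borel_measurable (M \<Otimes>\<^sub>M borel)"
    and [measurable]: "N \<in> borel_measurable M" "G \<in> borel_measurable borel"
    and G: "\<And>x. 0 \<le> G x" "\<And>x. G x \<le> 1"
    and AE: "AE s in M. (\<forall>x. W s x = 0) \<or> 0 < N s \<and> ebnd G (N s) (W s)"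
    and L: "(\<integral>\<^sup>+s. ennreal (N s) \<partial>M) \<le> ennreal L" "0 < L"
  shows "ebnd G L (\<lambda>x. \<integral>\<^sup>+s. W s x \<partial>M)"
proof -
  interpret sigma_finite_measure M by fact
  interpret pair_sigma_finite M lborel by standard
  define \<rho> where "\<rho> s = ennreal (N s) / ennreal L" for s
  define w where "w s x = W s x / ennreal (N s)" for s x
  have [measurable]: "\<rho> \<in> borel_measurable M" unfolding \<rho>_def by measurable
  have [measurable]: "(\<lambda>(s, x). w s x) \<in> borel_measurable (M \<Otimes>\<^sub>M borel)" unfolding w_def by measurable
  have \<rho>1: "(\<integral>\<^sup>+s. \<rho> s \<partial>M) \<le> 1"
  proof -
    have "(\<integral>\<^sup>+s. \<rho> s \<partial>M) = (\<integral>\<^sup>+s. ennreal (N s) \<partial>M) / ennreal L"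
      unfolding \<rho>_def by (rule nn_integral_divide) auto
    also have "\<dots> \<le> ennreal L / ennreal L" using L by (intro divide_right_mono_ennreal)
    finally show ?thesis using L by (simp add: divide_ennreal)
  qed
  have eq: "AE s in M. \<forall>x. W s x / ennreal L = \<rho> s * w s x"
    using AE
  proof eventually_elim
    case (elim s)
    show ?case
    proof
      fix x
      show "W s x / ennreal L = \<rho> s * w s x"
        using elim L(2) by (cases "W s x")
          (auto simp: \<rho>_def w_def divide_ennreal ennreal_mult[symmetric] ennreal_mult_top ennreal_top_divide)
    qed
  qed
  have "(\<integral>\<^sup>+x. vpow (G x) ((\<integral>\<^sup>+s. W s x \<partial>M) / ennreal L) \<partial>lborel)
      \<le> (\<integral>\<^sup>+x. (\<integral>\<^sup>+s. \<rho> s * vpow (G x) (w s x) \<partial>M) \<partial>lborel)"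
  proof (intro nn_integral_mono)
    fix x
    have "(\<integral>\<^sup>+s. W s x \<partial>M) / ennreal L = (\<integral>\<^sup>+s. W s x / ennreal L \<partial>M)"
      by (rule nn_integral_divide[symmetric]) measurable
    also have "\<dots> = (\<integral>\<^sup>+s. \<rho> s * w s x \<partial>M)"
      using eq by (intro nn_integral_cong_AE) auto
    finally show "vpow (G x) ((\<integral>\<^sup>+s. W s x \<partial>M) / ennreal L) \<le> (\<integral>\<^sup>+s. \<rho> s * vpow (G x) (w s x) \<partial>M)"
      using vpow_Jensen[OF _ _ \<rho>1 G, of "\<lambda>s. w s x" x] by simp
  qed
  also have "\<dots> = (\<integral>\<^sup>+s. (\<integral>\<^sup>+x. \<rho> s * vpow (G x) (w s x) \<partial>lborel) \<partial>M)"
    by (rule Fubini') measurable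
  also have "\<dots> = (\<integral>\<^sup>+s. \<rho> s * (\<integral>\<^sup>+x. vpow (G x) (w s x) \<partial>lborel) \<partial>M)"
    by (intro nn_integral_cong nn_integral_cmult) measurable
  also have "\<dots> \<le> (\<integral>\<^sup>+s. \<rho> s * 1 \<partial>M)"
    using AE
  proof (intro nn_integral_mono_AE, eventually_elim)
    case (elim s)
    have "(\<integral>\<^sup>+x. vpow (G x) (w s x) \<partial>lborel) \<le> 1"
      using elim by (auto simp: w_def ebnd_def)
    then show ?case by (rule mult_left_mono) simp
  qed
  also have "\<dots> \<le> 1" using \<rho>1 by simp
  finally show ?thesis by (simp add: ebnd_def)
qed

section \<open>Changes of variables for Lebesgue measure\<close>

lemma nn_integral_lborel_affine:
  fixes f :: "'a::euclidean_space \<Rightarrow> ennreal"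
  assumes [measurable]: "f \<in> borel_measurable borel" and "c \<noteq> 0"
  shows "(\<integral>\<^sup>+y. f y \<partial>lborel) = ennreal (\<bar>c\<bar> ^ DIM('a)) * (\<integral>\<^sup>+y. f (t + c *\<^sub>R y) \<partial>lborel)"
  by (subst lborel_affine[OF assms(2), of t])
     (simp add: nn_integral_density nn_integral_distr nn_integral_cmult)

lemma nn_integral_lborel_diff:
  fixes f :: "'a::euclidean_space \<Rightarrow> ennreal"
  assumes [measurable]: "f \<in> borel_measurable borel"
  shows "(\<integral>\<^sup>+y. f (x - y) \<partial>lborel) = (\<integral>\<^sup>+y. f y \<partial>lborel)"
    and "(\<integral>\<^sup>+y. f (y - x) \<partial>lborel) = (\<integral>\<^sup>+y. f y \<partial>lborel)"
  using nn_integral_lborel_affine[OF assms, of "-1" x] nn_integral_lborel_affine[OF assms, of 1 "- x"]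
  by simp_all

lemma nn_integral_even_le:
  fixes f :: "real \<Rightarrow> ennreal"
  assumes [measurable]: "f \<in> borel_measurable borel" and "\<And>x. f (- x) = f x"
  shows "(\<integral>\<^sup>+x. f x \<partial>lborel) \<le> 2 * (\<integral>\<^sup>+x. f x * indicator {0..} x \<partial>lborel)"
proof -
  have "(\<integral>\<^sup>+x. f x \<partial>lborel) \<le> (\<integral>\<^sup>+x. f x * indicator {0..} x + f (0 - x) * indicator {0..} (0 - x) \<partial>lborel)"
    using assms(2) by (intro nn_integral_mono) (auto split: split_indicator)
  also have "\<dots> = (\<integral>\<^sup>+x. f x * indicator {0..} x \<partial>lborel) + (\<integral>\<^sup>+x. f (0 - x) * indicator {0..} (0 - x) \<partial>lborel)"
    by (rule nn_integral_add) auto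
  also have "(\<integral>\<^sup>+x. f (0 - x) * indicator {0..} (0 - x) \<partial>lborel) = (\<integral>\<^sup>+x. f x * indicator {0..} x \<partial>lborel)"
    by (rule nn_integral_lborel_diff) auto
  finally show ?thesis by (simp add: mult_2)
qed

section \<open>Convolution in variable Lebesgue spaces\<close>

text \<open>The exponent 4/3 is a third of 4: the product of three such factors, one per coordinate,
  dominates (1 + |x|)^(-4) on the three-dimensional space.\<close>

lemma nn_integral_decay_1:
  "(\<integral>\<^sup>+x. ennreal ((1 + \<bar>x\<bar>) powr (- 4 / 3)) \<partial>(lborel :: real measure)) < \<infinity>"
proof -
  have "(\<integral>\<^sup>+x. ennreal ((1 + \<bar>x\<bar>) powr (- 4 / 3)) * indicator {0..} x \<partial>lborel)
      = (\<integral>\<^sup>+x. ennreal ((1 + x) powr (- 4 / 3)) * indicator {0..} x \<partial>lborel)"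
    by (intro nn_integral_cong) (auto split: split_indicator)
  also have "\<dots> = ennreal (0 - (- 3 * (1 + 0) powr (- 1 / 3)))"
  proof (rule nn_integral_FTC_atLeast)
    have "((\<lambda>x::real. (1 + x) powr - (1 / 3)) \<longlongrightarrow> 0) at_top"
      by (intro tendsto_neg_powr filterlim_tendsto_add_at_top[OF tendsto_const] filterlim_ident) auto
    from tendsto_mult_left[OF this, of "-3"]
    show "((\<lambda>x::real. - 3 * (1 + x) powr (- 1 / 3)) \<longlongrightarrow> 0) at_top" by simp
    show "((\<lambda>x::real. - 3 * (1 + x) powr (- 1 / 3)) has_real_derivative (1 + x) powr (- 4 / 3)) (at x)"
      if "0 \<le> x" for x
    proof -
      have d1: "((\<lambda>x::real. 1 + x) has_real_derivative 1) (at x)" by (auto intro!: derivative_eq_intros)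
      show ?thesis
        by (rule DERIV_cong[OF DERIV_cmult[OF DERIV_fun_powr[OF d1]]]) (use that in auto)
    qed
  qed auto
  finally show ?thesis
    using nn_integral_even_le[of "\<lambda>x. ennreal ((1 + \<bar>x\<bar>) powr (- 4 / 3))"]
    by (auto simp: ennreal_mult_less_top intro: le_less_trans)
qed

lemma nn_integral_prod_axis:
  fixes f :: "real \<Rightarrow> ennreal"
  assumes [measurable]: "f \<in> borel_measurable borel"
  shows "(\<integral>\<^sup>+x. (\<Prod>i\<in>UNIV. f (x $ i)) \<partial>(lborel :: (real^3) measure)) = (\<integral>\<^sup>+x. f x \<partial>lborel) ^ 3"
proof -
  have B: "(Basis :: (real^3) set) = (\<lambda>i. axis i 1) ` UNIV" by (auto simp: Basis_vec_def)
  have "(\<Prod>b\<in>(Basis :: (real^3) set). f (x \<bullet> b)) = (\<Prod>i\<in>UNIV. f (x $ i))" for x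
    unfolding B by (subst prod.reindex) (auto simp: inj_on_def axis_eq_axis inner_axis)
  moreover have "(\<integral>\<^sup>+x. (\<Prod>b\<in>Basis. f (x \<bullet> b)) \<partial>(lborel :: (real^3) measure)) = (\<Prod>b\<in>(Basis::(real^3) set). \<integral>\<^sup>+x. f x \<partial>lborel)"
    by (rule nn_integral_lborel_prod) auto
  ultimately show ?thesis by simp
qed

lemma nn_integral_decay:
  "(\<integral>\<^sup>+x. ennreal (1 / (1 + norm x) ^ 4) \<partial>(lborel :: (real^3) measure)) < \<infinity>"
proof -
  have "1 / (1 + norm x) ^ 4 \<le> (\<Prod>i\<in>UNIV. (1 + \<bar>x $ i\<bar>) powr (- 4 / 3))" for x :: "real^3"
  proof -
    have "1 / (1 + norm x) ^ 4 = (1 + norm x) powr (- 4)"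
      by (simp add: powr_minus divide_inverse add_nonneg_eq_0_iff powr_numeral add_pos_nonneg)
    also have "\<dots> = (\<Prod>i\<in>(UNIV::3 set). (1 + norm x) powr (- 4 / 3))"
      using powr_powr[of "1 + norm x" "- 4 / 3" 3] by (simp add: powr_numeral)
    also have "\<dots> \<le> (\<Prod>i\<in>UNIV. (1 + \<bar>x $ i\<bar>) powr (- 4 / 3))"
      by (intro prod_mono conjI powr_mono2') (auto simp: component_le_norm_cart)
    finally show ?thesis .
  qed
  then have "(\<integral>\<^sup>+x. ennreal (1 / (1 + norm x) ^ 4) \<partial>(lborel :: (real^3) measure))
      \<le> (\<integral>\<^sup>+x. (\<Prod>i\<in>UNIV. ennreal ((1 + \<bar>x $ i\<bar>) powr (- 4 / 3))) \<partial>(lborel :: (real^3) measure))"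
    by (intro nn_integral_mono) (auto simp: prod_ennreal intro!: ennreal_leI)
  also have "\<dots> < \<infinity>"
    by (subst nn_integral_prod_axis) (use nn_integral_decay_1 in \<open>auto simp: power_less_top_ennreal\<close>)
  finally show ?thesis .
qed

text \<open>Log-Hoelder continuity makes \<open>J\<^bsup>\<bar>sx - sy\<bar>\<^esup>\<close> bounded as long as \<open>J \<le> d\<^sup>-\<^sup>3\<close>; beyond that threshold the weight
  \<open>min 1 d\<^sup>3\<close> pays for the loss. Here \<open>d\<close> is the distance of the points with exponents \<open>1/sx\<close> and \<open>1/sy\<close>.\<close>

lemma peak_pointwise:
  fixes h J c d sx sy :: real
  assumes s: "0 \<le> sx" "0 < sy" "sy \<le> 1" and c: "0 < c" and d: "0 < d" and J: "1 \<le> J" and h: "0 \<le> h"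
    and lh: "\<bar>sx - sy\<bar> \<le> c / ln (exp 1 + 1 / d)"
  shows "h \<le> exp (3 * c) * J powr sx * (1 + (1 / J + min 1 (d ^ 3)) * h powr (1 / sy))"
proof -
  \<comment> \<open>The threshold is capped at max(1, d^(-3)), because the log-Hoelder condition
    bounds powers L^|sx - sy| only for L of polynomial size in 1/d: ln L <= 3 ln(e + 1/d) turns the
    modulus c / ln(e + 1/d) into the factor exp(3c).\<close>
  define L where "L = min J (max 1 (1 / d ^ 3))"
  define lam where "lam = exp (3 * c) * L powr sx"
  have L1: "1 \<le> L" using J by (simp add: L_def)
  have lamJ: "lam \<le> exp (3 * c) * J powr sx"
    unfolding lam_def using L1 s by (intro mult_left_mono powr_mono2) (auto simp: L_def)
  have lam0: "0 < lam" using L1 by (simp add: lam_def)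
  have rest: "0 \<le> (1 / J + min 1 (d ^ 3)) * h powr (1 / sy)" using J d by auto
  show ?thesis
  proof (cases "h \<le> lam")
    case True
    then have "h \<le> exp (3 * c) * J powr sx * 1" using lamJ by simp
    also have "exp (3 * c) * J powr sx * 1 \<le> exp (3 * c) * J powr sx * (1 + (1 / J + min 1 (d ^ 3)) * h powr (1 / sy))"
      using rest by (intro mult_left_mono) auto
    finally show ?thesis .
  next
    case False
    have e0: "ln (exp 1 + 1 / d) > 0"
    proof -
      have "1 < exp (1::real)" by simp
      moreover have "0 < 1 / d" using d by simp
      ultimately show ?thesis by (intro ln_gt_zero) linarith
    qed
    have "L \<le> (exp 1 + 1 / d) ^ 3"
    proof -
      have "1 \<le> exp (1::real)" by simp
      then have "1 \<le> exp 1 + 1 / d" using d by (simp add: add_increasing2)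
      then have "1 \<le> (exp 1 + 1 / d) ^ 3" by simp
      moreover have "(1 / d) ^ 3 \<le> (exp 1 + 1 / d) ^ 3" using d by (intro power_mono) auto
      ultimately show ?thesis by (simp add: L_def power_divide)
    qed
    then have lnL: "ln L \<le> 3 * ln (exp 1 + 1 / d)"
      using L1 d by (metis add_pos_pos exp_gt_zero ln_le_cancel_iff ln_realpow of_nat_numeral order_less_le_trans zero_less_divide_1_iff zero_less_one zero_less_power)
    have "(sy - sx) * ln L \<le> \<bar>sx - sy\<bar> * ln L" using L1 by (intro mult_right_mono) auto
    also have "\<dots> \<le> c / ln (exp 1 + 1 / d) * (3 * ln (exp 1 + 1 / d))"
      using L1 lh lnL c e0 by (intro mult_mono) auto
    also have "\<dots> = 3 * c" using e0 by simp
    finally have "exp ((sy - sx) * ln L) \<le> exp (3 * c)" by simp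
    then have "L powr sy \<le> lam"
      using L1 by (simp add: lam_def powr_def left_diff_distrib exp_diff divide_simps split: if_splits)
    then have "(L powr sy) powr (1 / sy) \<le> lam powr (1 / sy)" using s by (intro powr_mono2) auto
    then have Ll: "L \<le> lam powr (1 / sy)" using s L1 by (simp add: powr_powr)
    have h0: "0 < h" using False lam0 by simp
    \<comment> \<open>Above the threshold one power h^(1/sy) is kept. The remaining power has
      exponent 1 - 1/sy <= 0, so h may be replaced in it by the smaller \<open>lam\<close>; since
      lam^(1/sy) >= L, it is at most lam / L.\<close>
    have "h = h powr (1 / sy) * h powr (1 - 1 / sy)" using h0 by (simp add: powr_add[symmetric])
    also have "h powr (1 - 1 / sy) \<le> lam powr (1 - 1 / sy)"
      using False lam0 s by (intro powr_mono2') auto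
    also have "lam powr (1 - 1 / sy) = lam / lam powr (1 / sy)" using lam0 by (simp add: powr_diff)
    also have "\<dots> \<le> lam / L" using Ll L1 lam0 by (intro divide_left_mono) auto
    also have "\<dots> \<le> (exp (3 * c) * J powr sx) * (1 / J + min 1 (d ^ 3))"
    proof -
      have "1 / L \<le> 1 / J + min 1 (d ^ 3)"
      proof (cases "J \<le> max 1 (1 / d ^ 3)")
        case True then show ?thesis using d by (simp add: L_def min_def)
      next
        case False
        then have "1 / L = min 1 (d ^ 3)"
          using d by (auto simp: L_def min_def max_def divide_simps split: if_splits)
        then show ?thesis using J by simp
      qed
      then show ?thesis using mult_mono[OF lamJ, of "1 / L"] L1 J lam0 by simp
    qed
    finally have "h \<le> h powr (1 / sy) * (exp (3 * c) * J powr sx * (1 / J + min 1 (d ^ 3)))"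
      by (simp add: mult_left_mono)
    then show ?thesis using rest by (simp add: algebra_simps add_increasing)
  qed
qed

text \<open>X and Y stand for the norms of two points. For sx > sy the comparison of powers of h <=
  1 fails only where h is small, with the error b^(1/(sx - sy)), b = exp(-8c). The decay condition
  gives 8c/(sx - sy) >= 4 ln(e + min X Y), so the error is at most (1 + min X Y)^(-4), the profile
  of \<open>nn_integral_decay\<close>.\<close>

lemma low_pointwise:
  fixes h c X Y sx sy :: real
  assumes s: "0 \<le> sx" "0 \<le> sy" "sx \<le> 1" and c: "0 < c" and h: "0 \<le> h" "h \<le> 1"
    and XY: "0 \<le> X" "0 \<le> Y"
    and lh: "\<bar>sx - si\<bar> \<le> c / ln (exp 1 + X)" "\<bar>sy - si\<bar> \<le> c / ln (exp 1 + Y)"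
  shows "vpow sx (ennreal (exp (- 8 * c) * h)) \<le> vpow sy (ennreal h) + ennreal (1 / (1 + X) ^ 4 + 1 / (1 + Y) ^ 4)"
proof -
  define b where "b = exp (- 8 * c)"
  have b: "0 < b" "b < 1" using c by (auto simp: b_def)
  have bh: "b * h \<le> 1" "0 \<le> b * h" using b h by (auto simp: mult_le_one)
  consider "sx = 0" | "0 < sx" "sx \<le> sy" | "0 < sx" "sy < sx" using s by linarith
  then have "vpow sx (ennreal (b * h)) \<le> vpow sy (ennreal h) + ennreal (1 / (1 + X) ^ 4 + 1 / (1 + Y) ^ 4)"
    (is ?goal)
  proof cases
    case 1 then show ?goal using bh by (simp add: vpow_def)
  next
    case 2
    have "(b * h) powr (1 / sx) \<le> h powr (1 / sx)"
      using b h 2 by (intro powr_mono2) (auto simp: mult_left_le_one_le)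
    also have "\<dots> \<le> h powr (1 / sy)"
      using 2 h by (intro powr_mono') (auto simp: frac_le)
    finally show ?goal using 2 h bh by (simp add: vpow_ennreal add_increasing2 ennreal_leI)
  next
    case 3
    define m where "m = min X Y"
    have m: "0 \<le> m" using XY by (simp add: m_def)
    have l1: "0 < ln (exp 1 + m)"
    proof -
      have "1 < exp (1::real)" by simp
      then show ?thesis using m by (intro ln_gt_zero) linarith
    qed
    have "c / ln (exp 1 + X) \<le> c / ln (exp 1 + m)" "c / ln (exp 1 + Y) \<le> c / ln (exp 1 + m)"
      using c l1 XY m by (auto intro!: divide_left_mono mult_pos_pos simp: m_def add_pos_nonneg)
    then have "sx - sy \<le> 2 * c / ln (exp 1 + m)" using lh by auto
    then have k: "8 * c / (sx - sy) \<ge> 4 * ln (exp 1 + m)"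
      using 3 l1 by (simp add: field_simps)
    have "b powr (1 / (sx - sy)) = exp (- (8 * c / (sx - sy)))"
      by (simp add: b_def powr_def)
    also have "\<dots> \<le> exp (- (4 * ln (exp 1 + m)))" using k by simp
    also have "\<dots> = 1 / (exp 1 + m) ^ 4"
      using m by (simp add: exp_minus exp_of_nat_mult[of 4, simplified] add_pos_nonneg inverse_eq_divide)
    also have "\<dots> \<le> 1 / (1 + m) ^ 4"
      using m by (intro divide_left_mono power_mono mult_pos_pos zero_less_power) (auto simp: add_pos_nonneg)
    also have "\<dots> \<le> 1 / (1 + X) ^ 4 + 1 / (1 + Y) ^ 4" using XY by (auto simp: m_def min_def)
    finally have be: "b powr (1 / (sx - sy)) \<le> 1 / (1 + X) ^ 4 + 1 / (1 + Y) ^ 4" (is "_ \<le> ?E") .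
    have fin: ?goal if "(b * h) powr (1 / sx) \<le> ?E"
    proof -
      have "vpow sx (ennreal (b * h)) \<le> ennreal ?E"
        using that 3 bh by (simp add: vpow_ennreal ennreal_leI del: ennreal_plus)
      also have "\<dots> \<le> vpow sy (ennreal h) + ennreal ?E" by (simp add: add_increasing)
      finally show ?thesis .
    qed
    show ?goal
    \<comment> \<open>At this threshold b = h^((sx - sy)/sy) and the two bounds balance: below it (b
      h)^(1/sx) is at most the error term, above it b h <= h^(sx/sy), hence (b h)^(1/sx) <=
      h^(1/sy).\<close>
    proof (cases "h < b powr (sy / (sx - sy))")
      case True
      have "b * h \<le> b powr 1 * b powr (sy / (sx - sy))" using True b by simp
      also have "\<dots> = b powr (sx / (sx - sy))"
        unfolding powr_add[symmetric] using 3 by (simp add: field_simps)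
      finally have "(b * h) powr (1 / sx) \<le> (b powr (sx / (sx - sy))) powr (1 / sx)"
        using 3 bh by (intro powr_mono2) auto
      also have "\<dots> = b powr (1 / (sx - sy))" using 3 by (simp add: powr_powr)
      also note be
      finally show ?goal by (rule fin)
    next
      case False
      moreover have "0 < b powr (sy / (sx - sy))" using b by simp
      ultimately have h0: "0 < h" by linarith
      show ?goal
      proof (cases "sy = 0")
        case True
        have "h = 1" using False True h b by simp
        have "(b * h) powr (1 / sx) = b powr (1 / (sx - sy))" using \<open>h = 1\<close> True by simp
        also note be
        finally show ?goal by (rule fin)
      next
        case sy: False
        have "(b powr (sy / (sx - sy))) powr ((sx - sy) / sy) \<le> h powr ((sx - sy) / sy)"
          using False 3 s by (intro powr_mono2) auto
        then have "b \<le> h powr ((sx - sy) / sy)" using 3 sy b by (simp add: powr_powr)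
        then have "b * h \<le> h powr ((sx - sy) / sy) * h powr 1" using h0 by (simp add: mult_right_mono)
        also have "\<dots> = h powr (sx / sy)" unfolding powr_add[symmetric] using sy by (simp add: field_simps)
        finally have "(b * h) powr (1 / sx) \<le> (h powr (sx / sy)) powr (1 / sx)"
          using 3 bh by (intro powr_mono2) auto
        also have "\<dots> = h powr (1 / sy)" using 3 by (simp add: powr_powr)
        finally show ?goal using 3 h sy bh by (simp add: vpow_ennreal add_increasing2 ennreal_leI)
      qed
    qed
  qed
  then show ?thesis by (simp add: b_def)
qed

text \<open>P is the modular density of h and J its convolution with \<phi>, so J has integral at
  most 1 and it suffices to bound the integrand by J. Where J <= 1 this follows from h <= P, as
  numbers up to 1 do not grow under the power. Where J = j > 1, \<open>peak_pointwise\<close> at the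
  level j leaves three terms, each of integral at most 1: \<phi>, \<phi> P / j, and P, the last one
  by \<phi>(z) |z|^3 <= 1. This is the origin of exp(-3c)/3.\<close>

lemma conv_peak:
  fixes \<sigma> h :: "real^3 \<Rightarrow> real" and \<phi> :: "real^3 \<Rightarrow> ennreal"
  assumes [measurable]: "\<sigma> \<in> borel_measurable borel" "h \<in> borel_measurable borel" "\<phi> \<in> borel_measurable borel"
    and \<sigma>: "\<And>x. 0 \<le> \<sigma> x" "\<And>x. \<sigma> x \<le> 1" and c: "0 < c"
    and lh: "\<And>x y. \<bar>\<sigma> x - \<sigma> y\<bar> \<le> c / ln (exp 1 + 1 / norm (x - y))"
    and \<phi>1: "(\<integral>\<^sup>+x. \<phi> x \<partial>lborel) \<le> 1" and \<phi>3: "\<And>z. \<phi> z * ennreal (norm z ^ 3) \<le> 1"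
    and h: "\<And>y. h y = 0 \<or> 1 < h y" and P1: "(\<integral>\<^sup>+y. vpow (\<sigma> y) (ennreal (h y)) \<partial>lborel) \<le> 1"
  shows "(\<integral>\<^sup>+x. vpow (\<sigma> x) (ennreal (exp (- 3 * c) / 3) * (\<integral>\<^sup>+y. \<phi> (x - y) * ennreal (h y) \<partial>lborel)) \<partial>lborel) \<le> 1"
proof -
  define P where "P y = vpow (\<sigma> y) (ennreal (h y))" for y
  define J where "J x = (\<integral>\<^sup>+y. \<phi> (x - y) * P y \<partial>lborel)" for x
  define A where "A x = (\<integral>\<^sup>+y. \<phi> (x - y) * ennreal (h y) \<partial>lborel)" for x
  have [measurable]: "P \<in> borel_measurable borel" unfolding P_def by measurable
  have [measurable]: "J \<in> borel_measurable borel" unfolding J_def by measurable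
  have "(\<integral>\<^sup>+x. J x \<partial>lborel) = (\<integral>\<^sup>+y. (\<integral>\<^sup>+x. \<phi> (x - y) * P y \<partial>lborel) \<partial>lborel)"
    unfolding J_def by (rule lborel_pair.Fubini') measurable
  also have "\<dots> = (\<integral>\<^sup>+y. (\<integral>\<^sup>+x. \<phi> x \<partial>lborel) * P y \<partial>lborel)"
    by (intro nn_integral_cong) (simp add: nn_integral_multc nn_integral_lborel_diff)
  also have "\<dots> \<le> (\<integral>\<^sup>+y. 1 * P y \<partial>lborel)"
    using \<phi>1 by (intro nn_integral_mono mult_right_mono) auto
  also have "\<dots> \<le> 1" using P1 by (simp add: P_def)
  finally have J1: "(\<integral>\<^sup>+x. J x \<partial>lborel) \<le> 1" .
  have "AE x in lborel. J x \<noteq> \<infinity>" using J1 by (intro nn_integral_PInf_AE) (auto simp: top_unique)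
  then have "AE x in lborel. vpow (\<sigma> x) (ennreal (exp (- 3 * c) / 3) * A x) \<le> J x"
  proof eventually_elim
    case (elim x)
    show ?case
    proof (cases "J x \<le> 1")
      case True
      have hP: "ennreal (h y) \<le> P y" for y
        using le_vpow[OF \<sigma>, of "ennreal (h y)" y] h[of y] by (auto simp: P_def)
      have "ennreal (exp (- 3 * c) / 3) * A x \<le> 1 * A x"
      proof -
        have "exp (- 3 * c) \<le> 1" using c by simp
        then show ?thesis by (intro mult_right_mono) (auto simp del: exp_le_one_iff)
      qed
      also have "1 * A x \<le> J x" unfolding A_def J_def using hP by (auto intro!: nn_integral_mono mult_left_mono)
      finally have *: "ennreal (exp (- 3 * c) / 3) * A x \<le> J x" .
      with True show ?thesis using vpow_le[OF \<sigma>, of "ennreal (exp (- 3 * c) / 3) * A x" x] by (meson order_trans)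
    next
      case False
      with elim obtain j where j: "J x = ennreal j" "1 < j"
        by (cases "J x") (auto simp: ennreal_le_1 not_le)
      define K where "K = exp (3 * c) * j powr \<sigma> x"
      have K0: "0 < K" using j by (simp add: K_def)
      have pt: "\<phi> (x - y) * ennreal (h y) \<le> ennreal K * (\<phi> (x - y) + ennreal (1 / j) * (\<phi> (x - y) * P y) + P y)"
        if "y \<noteq> x" for y
      proof -
        consider "h y = 0" | "1 < h y" "\<sigma> y = 0" | "1 < h y" "0 < \<sigma> y" using h[of y] \<sigma>(1)[of y] by fastforce
        then show ?thesis
        proof cases
          case 2
          then have "P y = top" by (simp add: P_def vpow_def)
          then show ?thesis using K0 by (simp add: ennreal_mult_top)
        next
          case 3
          define d where "d = norm (x - y)"
          have d: "0 < d" using that by (simp add: d_def)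
          have Py: "P y = ennreal (h y powr (1 / \<sigma> y))" using 3 by (simp add: P_def vpow_ennreal)
          have "h y \<le> K * (1 + (1 / j + min 1 (d ^ 3)) * h y powr (1 / \<sigma> y))"
            unfolding K_def by (rule peak_pointwise) (use \<sigma> 3 c d j lh in \<open>auto simp: d_def\<close>)
          then have "ennreal (h y) \<le> ennreal (K * (1 + (1 / j + min 1 (d ^ 3)) * h y powr (1 / \<sigma> y)))"
            by (rule ennreal_leI)
          also have "\<dots> = ennreal K * (1 + (ennreal (1 / j) + ennreal (min 1 (d ^ 3))) * P y)"
          proof -
            have "ennreal (K * (1 + (a + b) * p)) = ennreal K * (1 + (ennreal a + ennreal b) * ennreal p)"
              if "0 \<le> a" "0 \<le> b" "0 \<le> p" for a b p using that K0 by (simp add: ennreal_mult)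
            then show ?thesis using j d unfolding Py by simp
          qed
          finally have "\<phi> (x - y) * ennreal (h y) \<le> \<phi> (x - y) * (ennreal K * (1 + (ennreal (1 / j) + ennreal (min 1 (d ^ 3))) * P y))"
            by (rule mult_left_mono) simp
          also have "\<dots> = ennreal K * (\<phi> (x - y) + ennreal (1 / j) * (\<phi> (x - y) * P y) + (\<phi> (x - y) * ennreal (min 1 (d ^ 3))) * P y)"
            by (simp add: algebra_simps)
          also have "\<dots> \<le> ennreal K * (\<phi> (x - y) + ennreal (1 / j) * (\<phi> (x - y) * P y) + 1 * P y)"
          proof (intro mult_left_mono add_left_mono mult_right_mono)
            have "\<phi> (x - y) * ennreal (min 1 (d ^ 3)) \<le> \<phi> (x - y) * ennreal (d ^ 3)"
              by (intro mult_left_mono ennreal_leI) auto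
            also have "\<dots> \<le> 1" using \<phi>3[of "x - y"] by (simp add: d_def)
            finally show "\<phi> (x - y) * ennreal (min 1 (d ^ 3)) \<le> 1" .
          qed auto
          finally show ?thesis by simp
        qed auto
      qed
      have "A x \<le> (\<integral>\<^sup>+y. ennreal K * (\<phi> (x - y) + ennreal (1 / j) * (\<phi> (x - y) * P y) + P y) \<partial>lborel)"
        unfolding A_def using AE_lborel_singleton[of x] by (intro nn_integral_mono_AE) (auto simp: pt)
      also have "\<dots> = ennreal K * ((\<integral>\<^sup>+y. \<phi> y \<partial>lborel) + ennreal (1 / j) * J x + (\<integral>\<^sup>+y. P y \<partial>lborel))"
        unfolding J_def by (simp add: nn_integral_cmult nn_integral_add nn_integral_lborel_diff)
      also have "\<dots> \<le> ennreal K * (1 + 1 + 1)"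
      proof (intro mult_left_mono add_mono)
        show "ennreal (1 / j) * J x \<le> 1" using j by (simp add: ennreal_mult[symmetric])
      qed (use \<phi>1 P1 in \<open>auto simp: P_def\<close>)
      also have "\<dots> = ennreal (3 * K)" using K0
        by (simp add: ennreal_mult mult.commute)
      finally have "ennreal (exp (- 3 * c) / 3) * A x \<le> ennreal (exp (- 3 * c) / 3) * ennreal (3 * K)"
        by (rule mult_left_mono) simp
      also have "\<dots> = ennreal (j powr \<sigma> x)"
        using K0 by (simp add: ennreal_mult[symmetric] K_def exp_minus)
      finally have "vpow (\<sigma> x) (ennreal (exp (- 3 * c) / 3) * A x) \<le> vpow (\<sigma> x) (ennreal (j powr \<sigma> x))"
        by (rule vpow_mono[OF \<sigma>(1)])
      also have "\<dots> \<le> ennreal j"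
        using j \<sigma>(1)[of x] by (cases "\<sigma> x = 0") (auto simp: vpow_ennreal powr_powr vpow_def)
      finally show ?thesis using j by simp
    qed
  qed
  then have "(\<integral>\<^sup>+x. vpow (\<sigma> x) (ennreal (exp (- 3 * c) / 3) * A x) \<partial>lborel) \<le> (\<integral>\<^sup>+x. J x \<partial>lborel)"
    by (rule nn_integral_mono_AE)
  also note J1
  finally show ?thesis by (simp add: A_def)
qed

text \<open>Jensen's inequality puts the power with the exponent at x inside the convolution, and
  \<open>low_pointwise\<close> changes it to the exponent at y. The error is a sum of a function of
  x and a function of y, whence the two copies of the decay integral.\<close>

lemma conv_low:
  fixes \<sigma> h :: "real^3 \<Rightarrow> real" and \<phi> :: "real^3 \<Rightarrow> ennreal"
  assumes [measurable]: "\<sigma> \<in> borel_measurable borel" "h \<in> borel_measurable borel" "\<phi> \<in> borel_measurable borel"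
    and \<sigma>: "\<And>x. 0 \<le> \<sigma> x" "\<And>x. \<sigma> x \<le> 1" and c: "0 < c"
    and lh: "\<And>x. \<bar>\<sigma> x - si\<bar> \<le> c / ln (exp 1 + norm x)"
    and \<phi>1: "(\<integral>\<^sup>+x. \<phi> x \<partial>lborel) \<le> 1"
    and h: "\<And>y. 0 \<le> h y" "\<And>y. h y \<le> 1" and P1: "(\<integral>\<^sup>+y. vpow (\<sigma> y) (ennreal (h y)) \<partial>lborel) \<le> 1"
  shows "(\<integral>\<^sup>+x. vpow (\<sigma> x) (ennreal (exp (- 8 * c)) * (\<integral>\<^sup>+y. \<phi> (x - y) * ennreal (h y) \<partial>lborel)) \<partial>lborel)
    \<le> 1 + 2 * (\<integral>\<^sup>+x. ennreal (1 / (1 + norm x) ^ 4) \<partial>(lborel :: (real^3) measure))"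
proof -
  define P where "P y = vpow (\<sigma> y) (ennreal (h y))" for y
  define D where "D x = ennreal (1 / (1 + norm x) ^ 4)" for x :: "real^3"
  have [measurable]: "P \<in> borel_measurable borel" "D \<in> borel_measurable borel" unfolding P_def D_def by measurable
  have conv: "(\<integral>\<^sup>+x. (\<integral>\<^sup>+y. \<phi> (x - y) * f y \<partial>lborel) \<partial>lborel) \<le> (\<integral>\<^sup>+x. f x \<partial>lborel)"
    if [measurable]: "f \<in> borel_measurable borel" for f :: "real^3 \<Rightarrow> ennreal"
  proof -
    have "(\<integral>\<^sup>+x. (\<integral>\<^sup>+y. \<phi> (x - y) * f y \<partial>lborel) \<partial>lborel) = (\<integral>\<^sup>+y. (\<integral>\<^sup>+x. \<phi> (x - y) * f y \<partial>lborel) \<partial>lborel)"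
      by (rule lborel_pair.Fubini') measurable
    also have "\<dots> = (\<integral>\<^sup>+y. (\<integral>\<^sup>+x. \<phi> x \<partial>lborel) * f y \<partial>lborel)"
      by (intro nn_integral_cong) (simp add: nn_integral_multc nn_integral_lborel_diff)
    also have "\<dots> \<le> (\<integral>\<^sup>+y. 1 * f y \<partial>lborel)"
      using \<phi>1 by (intro nn_integral_mono mult_right_mono) auto
    finally show ?thesis by simp
  qed
  have "(\<integral>\<^sup>+x. vpow (\<sigma> x) (ennreal (exp (- 8 * c)) * (\<integral>\<^sup>+y. \<phi> (x - y) * ennreal (h y) \<partial>lborel)) \<partial>lborel)
    \<le> (\<integral>\<^sup>+x. (\<integral>\<^sup>+y. \<phi> (x - y) * P y \<partial>lborel) + D x + (\<integral>\<^sup>+y. \<phi> (x - y) * D y \<partial>lborel) \<partial>lborel)"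
  proof (intro nn_integral_mono)
    fix x
    have "ennreal (exp (- 8 * c)) * (\<integral>\<^sup>+y. \<phi> (x - y) * ennreal (h y) \<partial>lborel)
        = (\<integral>\<^sup>+y. \<phi> (x - y) * ennreal (exp (- 8 * c) * h y) \<partial>lborel)"
      by (subst nn_integral_cmult[symmetric]) (auto simp: ennreal_mult h ac_simps)
    then have "vpow (\<sigma> x) (ennreal (exp (- 8 * c)) * (\<integral>\<^sup>+y. \<phi> (x - y) * ennreal (h y) \<partial>lborel))
        \<le> (\<integral>\<^sup>+y. \<phi> (x - y) * vpow (\<sigma> x) (ennreal (exp (- 8 * c) * h y)) \<partial>lborel)"
      using vpow_Jensen[of "\<lambda>y. \<phi> (x - y)" lborel "\<lambda>y. ennreal (exp (- 8 * c) * h y)" "\<sigma> x"] \<phi>1 \<sigma>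
      by (simp add: nn_integral_lborel_diff)
    also have "\<dots> \<le> (\<integral>\<^sup>+y. \<phi> (x - y) * (P y + (D x + D y)) \<partial>lborel)"
      unfolding P_def D_def ennreal_plus[symmetric, OF zero_le_divide_1_iff[THEN iffD2] zero_le_divide_1_iff[THEN iffD2]]
      by (intro nn_integral_mono mult_left_mono)
         (use low_pointwise[of "\<sigma> x" _ c _ "norm x" _ si] \<sigma> c h lh in \<open>auto simp: ennreal_plus[symmetric] simp del: ennreal_plus\<close>)
    also have "\<dots> = (\<integral>\<^sup>+y. \<phi> (x - y) * P y \<partial>lborel) + (\<integral>\<^sup>+y. \<phi> y \<partial>lborel) * D x + (\<integral>\<^sup>+y. \<phi> (x - y) * D y \<partial>lborel)"
      by (simp add: distrib_left nn_integral_add nn_integral_multc nn_integral_lborel_diff add.assoc)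
    also have "\<dots> \<le> (\<integral>\<^sup>+y. \<phi> (x - y) * P y \<partial>lborel) + 1 * D x + (\<integral>\<^sup>+y. \<phi> (x - y) * D y \<partial>lborel)"
      using \<phi>1 by (intro add_mono mult_right_mono) auto
    finally show "vpow (\<sigma> x) (ennreal (exp (- 8 * c)) * (\<integral>\<^sup>+y. \<phi> (x - y) * ennreal (h y) \<partial>lborel))
        \<le> (\<integral>\<^sup>+y. \<phi> (x - y) * P y \<partial>lborel) + D x + (\<integral>\<^sup>+y. \<phi> (x - y) * D y \<partial>lborel)" by simp
  qed
  also have "\<dots> = (\<integral>\<^sup>+x. (\<integral>\<^sup>+y. \<phi> (x - y) * P y \<partial>lborel) \<partial>lborel) + (\<integral>\<^sup>+x. D x \<partial>lborel)
      + (\<integral>\<^sup>+x. (\<integral>\<^sup>+y. \<phi> (x - y) * D y \<partial>lborel) \<partial>lborel)"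
    by (simp add: nn_integral_add)
  also have "\<dots> \<le> (\<integral>\<^sup>+x. P x \<partial>lborel) + (\<integral>\<^sup>+x. D x \<partial>lborel) + (\<integral>\<^sup>+x. D x \<partial>lborel)"
    by (intro add_mono conv) auto
  also have "\<dots> \<le> 1 + (\<integral>\<^sup>+x. D x \<partial>lborel) + (\<integral>\<^sup>+x. D x \<partial>lborel)"
    using P1 by (intro add_mono) (auto simp: P_def)
  finally show ?thesis by (simp add: D_def mult_2 add.assoc)
qed

lemma ennreal_divide_real: "0 < l \<Longrightarrow> v / ennreal l = ennreal (1 / l) * v"
  by (simp add: divide_ennreal_def inverse_ennreal mult.commute inverse_eq_divide)

text \<open>Half a sum is at most the maximum, so monotonicity alone is enough and the exponent
  infinity is covered as well.\<close>

lemma vpow_add_half: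
  assumes "0 \<le> g"
  shows "vpow g (ennreal (1 / 2) * (v + w)) \<le> vpow g v + vpow g w"
proof -
  have "ennreal (1 / 2) * (v + w) \<le> ennreal (1 / 2) * (max v w + max v w)"
    by (intro mult_left_mono add_mono) auto
  also have "\<dots> = max v w"
  proof -
    have "ennreal (1 / 2) + ennreal (1 / 2) = 1"
      by (subst ennreal_plus[symmetric]) auto
    then have "ennreal (1 / 2) * (u + u) = u" for u
      by (metis distrib_left distrib_right mult_1)
    then show ?thesis .
  qed
  finally have "vpow g (ennreal (1 / 2) * (v + w)) \<le> vpow g (max v w)" by (rule vpow_mono[OF assms])
  also have "\<dots> \<le> vpow g v + vpow g w" by (auto simp: max_def add_increasing add_increasing2)
  finally show ?thesis .
qed

text \<open>The function is split into the part above 1, controlled by local log-Hoelder continuity (\<open>conv_peak\<close>), and the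
  part below 1, controlled by the decay condition at infinity (\<open>conv_low\<close>). This replaces the maximal function; the
  hypothesis \<open>\<phi> z * norm z ^ 3 \<le> 1\<close> is what remains of a radially decreasing majorant.\<close>

theorem conv_bounded:
  fixes \<sigma> :: "real^3 \<Rightarrow> real"
  assumes [measurable]: "\<sigma> \<in> borel_measurable borel"
    and \<sigma>: "\<And>x. 0 \<le> \<sigma> x" "\<And>x. \<sigma> x \<le> 1" and c: "0 < c"
    and lh: "\<And>x y. \<bar>\<sigma> x - \<sigma> y\<bar> \<le> c / ln (exp 1 + 1 / norm (x - y))"
      "\<And>x. \<bar>\<sigma> x - si\<bar> \<le> c / ln (exp 1 + norm x)"
  shows "\<exists>C>0. \<forall>\<phi> h. \<phi> \<in> borel_measurable borel \<longrightarrow> h \<in> borel_measurable borel \<longrightarrow>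
     (\<integral>\<^sup>+x. \<phi> x \<partial>lborel) \<le> 1 \<longrightarrow> (\<forall>z. \<phi> z * ennreal (norm z ^ 3) \<le> 1) \<longrightarrow> (\<forall>y. 0 \<le> h y) \<longrightarrow>
     ebnd \<sigma> 1 (\<lambda>y. ennreal (h y)) \<longrightarrow>
     ebnd \<sigma> C (\<lambda>x. \<integral>\<^sup>+y. \<phi> (x - y) * ennreal (h y) \<partial>lborel)"
proof -
  obtain I where I: "(\<integral>\<^sup>+x. ennreal (1 / (1 + norm x) ^ 4) \<partial>(lborel :: (real^3) measure)) = ennreal I" "0 \<le> I"
    using nn_integral_decay by (cases "\<integral>\<^sup>+x. ennreal (1 / (1 + norm x) ^ 4) \<partial>(lborel :: (real^3) measure)") auto
  \<comment> \<open>M is the sum of the modular bounds 1 + 2I and 1 of the two parts. In C the 2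
    pays for adding the parts (\<open>vpow_add_half\<close>), M normalises the modular
    (\<open>vpow_shrink\<close>), and k is the smaller of the constants in \<open>conv_peak\<close>
    and \<open>conv_low\<close>.\<close>
  define M where "M = 2 + 2 * I"
  define k where "k = min (exp (- 3 * c) / 3) (exp (- 8 * c))"
  define C where "C = 2 * M / k"
  have k: "0 < k" by (simp add: k_def)
  have M: "1 \<le> M" using I by (simp add: M_def)
  show ?thesis
  proof (rule exI[of _ C], intro conjI allI impI)
    show "0 < C" using k M by (simp add: C_def)
    fix \<phi> :: "real^3 \<Rightarrow> ennreal" and h :: "real^3 \<Rightarrow> real"
    assume [measurable]: "\<phi> \<in> borel_measurable borel" "h \<in> borel_measurable borel"
      and \<phi>: "(\<integral>\<^sup>+x. \<phi> x \<partial>lborel) \<le> 1" "\<forall>z. \<phi> z * ennreal (norm z ^ 3) \<le> 1" and h0: "\<forall>y. 0 \<le> h y"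
      and "ebnd \<sigma> 1 (\<lambda>y. ennreal (h y))"
    moreover have "v / 1 = v" for v :: ennreal using ennreal_divide_real[of 1 v] by simp
    ultimately have P1: "(\<integral>\<^sup>+y. vpow (\<sigma> y) (ennreal (h y)) \<partial>lborel) \<le> 1" by (simp add: ebnd_def)
    define h1 where "h1 y = (if h y \<le> 1 then h y else 0)" for y
    define h2 where "h2 y = (if h y \<le> 1 then 0 else h y)" for y
    have [measurable]: "h1 \<in> borel_measurable borel" "h2 \<in> borel_measurable borel"
      unfolding h1_def h2_def by measurable
    define A1 where "A1 x = (\<integral>\<^sup>+y. \<phi> (x - y) * ennreal (h1 y) \<partial>lborel)" for x
    define A2 where "A2 x = (\<integral>\<^sup>+y. \<phi> (x - y) * ennreal (h2 y) \<partial>lborel)" for x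
    have [measurable]: "A1 \<in> borel_measurable borel" "A2 \<in> borel_measurable borel"
      unfolding A1_def A2_def by measurable
    have le: "(\<integral>\<^sup>+y. vpow (\<sigma> y) (ennreal (h' y)) \<partial>lborel) \<le> 1" if "\<And>y. h' y \<le> h y" for h'
      using that by (intro order_trans[OF nn_integral_mono P1] vpow_mono \<sigma> ennreal_leI)
    have A: "(\<integral>\<^sup>+y. \<phi> (x - y) * ennreal (h y) \<partial>lborel) = A1 x + A2 x" for x
      unfolding A1_def A2_def
      by (subst nn_integral_add[symmetric]) (auto intro!: nn_integral_cong simp: h1_def h2_def)
    have I1: "(\<integral>\<^sup>+x. vpow (\<sigma> x) (ennreal k * A1 x) \<partial>lborel) \<le> 1 + 2 * ennreal I"
    proof -
      have "(\<integral>\<^sup>+x. vpow (\<sigma> x) (ennreal k * A1 x) \<partial>lborel) \<le> (\<integral>\<^sup>+x. vpow (\<sigma> x) (ennreal (exp (- 8 * c)) * A1 x) \<partial>lborel)"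
        by (intro nn_integral_mono vpow_mono \<sigma> mult_right_mono ennreal_leI) (auto simp: k_def)
      also have "\<dots> \<le> 1 + 2 * ennreal I"
        unfolding A1_def I(1)[symmetric]
        by (rule conv_low[OF _ _ _ \<sigma> c lh(2) \<phi>(1)]) (auto simp: h1_def h0 intro!: le)
      finally show ?thesis .
    qed
    have I2: "(\<integral>\<^sup>+x. vpow (\<sigma> x) (ennreal k * A2 x) \<partial>lborel) \<le> 1"
    proof -
      have "(\<integral>\<^sup>+x. vpow (\<sigma> x) (ennreal k * A2 x) \<partial>lborel) \<le> (\<integral>\<^sup>+x. vpow (\<sigma> x) (ennreal (exp (- 3 * c) / 3) * A2 x) \<partial>lborel)"
        by (intro nn_integral_mono vpow_mono \<sigma> mult_right_mono ennreal_leI) (auto simp: k_def)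
      also have "\<dots> \<le> 1"
        unfolding A2_def
        by (rule conv_peak[OF _ _ _ \<sigma> c lh(1) \<phi>(1)]) (use \<phi>(2) in \<open>auto simp: h2_def h0 intro!: le\<close>)
      finally show ?thesis .
    qed
    have "(\<integral>\<^sup>+x. vpow (\<sigma> x) ((A1 x + A2 x) / ennreal C) \<partial>lborel)
        \<le> (\<integral>\<^sup>+x. ennreal (1 / M) * (vpow (\<sigma> x) (ennreal k * A1 x) + vpow (\<sigma> x) (ennreal k * A2 x)) \<partial>lborel)"
    proof (intro nn_integral_mono)
      fix x
      have "1 / C = 1 / M * (1 / 2 * k)" using M k by (simp add: C_def)
      then have "ennreal (1 / C) = ennreal (1 / M) * (ennreal (1 / 2) * ennreal k)"
        using ennreal_mult[of "1 / M" "1 / 2 * k"] ennreal_mult[of "1 / 2" k] M k by (simp only:) auto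
      then have "(A1 x + A2 x) / ennreal C = ennreal (1 / M) * (ennreal (1 / 2) * (ennreal k * A1 x + ennreal k * A2 x))"
        using \<open>0 < C\<close> by (simp only: ennreal_divide_real) (simp add: algebra_simps)
      then have "vpow (\<sigma> x) ((A1 x + A2 x) / ennreal C) \<le> ennreal (1 / M) * vpow (\<sigma> x) (ennreal (1 / 2) * (ennreal k * A1 x + ennreal k * A2 x))"
        using M vpow_shrink[OF \<sigma>, of "1 / M"] by simp
      also have "\<dots> \<le> ennreal (1 / M) * (vpow (\<sigma> x) (ennreal k * A1 x) + vpow (\<sigma> x) (ennreal k * A2 x))"
        by (intro mult_left_mono vpow_add_half \<sigma>) auto
      finally show "vpow (\<sigma> x) ((A1 x + A2 x) / ennreal C)
        \<le> ennreal (1 / M) * (vpow (\<sigma> x) (ennreal k * A1 x) + vpow (\<sigma> x) (ennreal k * A2 x))" .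
    qed
    also have "\<dots> = ennreal (1 / M) * ((\<integral>\<^sup>+x. vpow (\<sigma> x) (ennreal k * A1 x) \<partial>lborel) + (\<integral>\<^sup>+x. vpow (\<sigma> x) (ennreal k * A2 x) \<partial>lborel))"
      by (simp add: nn_integral_cmult nn_integral_add)
    also have "\<dots> \<le> ennreal (1 / M) * ((1 + 2 * ennreal I) + 1)"
      by (intro mult_left_mono add_mono I1 I2) auto
    also have "(1 + 2 * ennreal I) + 1 = ennreal M"
    proof -
      have "M = 1 + 2 * I + 1" by (simp add: M_def)
      then show ?thesis using I by (simp add: ennreal_mult)
    qed
    also have "ennreal (1 / M) * ennreal M = 1" using M by (simp add: ennreal_mult[symmetric])
    finally show "ebnd \<sigma> C (\<lambda>x. \<integral>\<^sup>+y. \<phi> (x - y) * ennreal (h y) \<partial>lborel)"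
      by (simp add: ebnd_def A)
  qed
qed

section \<open>Fourier integrals of Gaussians\<close>

lemma prod_axis:
  fixes f :: "3 \<Rightarrow> real \<Rightarrow> complex"
  assumes f: "\<And>i. integrable lborel (f i)"
  shows integrable_prod_axis: "integrable lborel (\<lambda>x::real^3. \<Prod>i\<in>UNIV. f i (x $ i))"
    and integral_prod_axis: "(LINT x|(lborel :: (real^3) measure). (\<Prod>i\<in>UNIV. f i (x $ i))) = (\<Prod>i\<in>UNIV. (LINT x|lborel. f i x))"
proof -
  define j :: "3 \<Rightarrow> real^3" where "j i = axis i 1" for i
  have j: "inj j" by (auto simp: inj_on_def axis_eq_axis j_def)
  have B: "(Basis :: (real^3) set) = j ` UNIV" by (auto simp: Basis_vec_def j_def)
  define g where "g b = f (inv j b)" for b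
  have g: "g (j i) = f i" for i using j by (simp add: g_def)
  interpret product_sigma_finite "\<lambda>_::real^3. lborel :: real measure"
    by standard
  have lb: "(lborel :: (real^3) measure) = distr (\<Pi>\<^sub>M b\<in>Basis. (lborel :: real measure)) borel (\<lambda>h. \<Sum>b\<in>Basis. h b *\<^sub>R b)"
    unfolding lborel_def[where 'a = "real^3"] lborel_eq_real ..
  have [measurable]: "f i \<in> borel_measurable borel" for i using borel_measurable_integrable[OF f[of i]] by simp
  have int: "integrable (lborel) (g b)" for b
    using f by (simp add: g_def)
  have eq: "(\<Prod>i\<in>UNIV. f i ((\<Sum>b\<in>Basis. h b *\<^sub>R b) $ i)) = (\<Prod>b\<in>Basis. g b (h b))" for h :: "real^3 \<Rightarrow> real"
  proof -
    have "(\<Sum>b\<in>Basis. h b *\<^sub>R b) $ i = h (j i)" for i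
    proof -
      have "(\<Sum>b\<in>Basis. h b *\<^sub>R b) $ i = (\<Sum>b\<in>Basis. h b *\<^sub>R b) \<bullet> j i"
        by (simp add: j_def cart_eq_inner_axis)
      also have "\<dots> = h (j i)" by (subst inner_sum_left_Basis) (auto simp: B)
      finally show ?thesis .
    qed
    then show ?thesis unfolding B by (subst prod.reindex) (use j in \<open>auto simp: g\<close>)
  qed
  have m: "(\<lambda>h. \<Sum>b\<in>Basis. h b *\<^sub>R b) \<in> measurable (\<Pi>\<^sub>M b\<in>(Basis :: (real^3) set). (lborel :: real measure)) borel"
      "(\<lambda>x::real^3. \<Prod>i\<in>UNIV. f i (x $ i)) \<in> borel_measurable borel"
    by measurable
  have "integrable (Pi\<^sub>M Basis (\<lambda>_::real^3. lborel)) (\<lambda>h. \<Prod>b\<in>Basis. g b (h b))"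
    by (rule product_integrable_prod) (use int in auto)
  then show "integrable lborel (\<lambda>x::real^3. \<Prod>i\<in>UNIV. f i (x $ i))"
    unfolding lb integrable_distr_eq[OF m] eq .
  have "(LINT x|(lborel :: (real^3) measure). (\<Prod>i\<in>UNIV. f i (x $ i)))
     = (LINT h|Pi\<^sub>M Basis (\<lambda>_::real^3. lborel). (\<Prod>b\<in>Basis. g b (h b)))"
    unfolding lb integral_distr[OF m] eq ..
  also have "\<dots> = (\<Prod>b\<in>Basis. (LINT x|lborel. g b x))"
    by (rule product_integral_prod) (use int in auto)
  also have "\<dots> = (\<Prod>i\<in>UNIV. (LINT x|lborel. f i x))"
    unfolding B by (subst prod.reindex) (use j in \<open>auto simp: g\<close>)
  finally show "(LINT x|(lborel :: (real^3) measure). (\<Prod>i\<in>UNIV. f i (x $ i))) = (\<Prod>i\<in>UNIV. (LINT x|lborel. f i x))" .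
qed

definition gauss :: "nat \<Rightarrow> real \<Rightarrow> complex" where
  "gauss n y = (LINT \<xi>|lborel. cis (y * \<xi>) * of_real (\<xi> ^ n * exp (- \<xi>\<^sup>2 / 2)))"

lemma integrable_gauss_real: "integrable lborel (\<lambda>\<xi>::real. \<xi> ^ n * exp (- \<xi>\<^sup>2 / 2))"
proof -
  have "integrable lborel (\<lambda>\<xi>. sqrt (2 * pi) * (std_normal_density \<xi> * \<xi> ^ n))"
    by (intro integrable_mult_right integrable_std_normal_moment)
  then show ?thesis by (simp add: std_normal_density_def mult.commute)
qed

lemma measurable_cis [measurable]: "cis \<in> borel_measurable borel"
  by (intro borel_measurable_continuous_onI continuous_intros)

lemma integrable_gauss: "integrable lborel (\<lambda>\<xi>. cis (y * \<xi>) * of_real (\<xi> ^ n * exp (- \<xi>\<^sup>2 / 2)))"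
  by (rule Bochner_Integration.integrable_bound[OF integrable_norm[OF integrable_gauss_real[of n]]])
     (auto simp: norm_mult norm_power abs_mult power_abs simp flip: of_real_power)

text \<open>Up to normalisation this is the characteristic function of the standard normal
  distribution.\<close>

lemma gauss_0: "gauss 0 y = of_real (sqrt (2 * pi) * exp (- y\<^sup>2 / 2))"
proof -
  have "char std_normal_distribution y = (LINT \<xi>|lborel. of_real (std_normal_density \<xi>) * cis (y * \<xi>))"
    unfolding char_def by (subst integral_density) (auto simp: scaleR_conv_of_real normal_density_nonneg cis_conv_exp)
  also have "\<dots> = (LINT \<xi>|lborel. of_real (1 / sqrt (2 * pi)) * (cis (y * \<xi>) * of_real (exp (- \<xi>\<^sup>2 / 2))))"
    by (simp add: std_normal_density_def mult_ac)
  also have "\<dots> = of_real (1 / sqrt (2 * pi)) * gauss 0 y"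
    unfolding gauss_def by (subst integral_mult_right_zero) simp
  finally have "of_real (sqrt (2 * pi)) * of_real (1 / sqrt (2 * pi)) * gauss 0 y
     = of_real (sqrt (2 * pi)) * of_real (exp (- y\<^sup>2 / 2))"
    by (simp add: char_std_normal_distribution)
  then show ?thesis by (simp flip: of_real_mult)
qed

lemma tendsto_gauss_at_top: "((\<lambda>x::real. x ^ n * exp (- x\<^sup>2 / 2)) \<longlongrightarrow> 0) at_top"
proof (rule tendsto_sandwich[OF _ _ tendsto_const tendsto_power_div_exp_0[of n]])
  show "\<forall>\<^sub>F x::real in at_top. x ^ n * exp (- x\<^sup>2 / 2) \<le> x ^ n / exp x"
    using eventually_ge_at_top[of 2]
  proof eventually_elim
    case (elim x)
    then have "x \<le> x\<^sup>2 / 2" by (simp add: power2_eq_square)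
    then have "exp (- x\<^sup>2 / 2) \<le> exp (- x)" by simp
    then have "x ^ n * exp (- x\<^sup>2 / 2) \<le> x ^ n * exp (- x)" using elim by (intro mult_left_mono) auto
    then show ?case by (simp only: exp_minus divide_inverse)
  qed
  show "\<forall>\<^sub>F x::real in at_top. 0 \<le> x ^ n * exp (- x\<^sup>2 / 2)"
    using eventually_ge_at_top[of 0] by eventually_elim simp
qed

text \<open>Integration by parts: f is the derivative of cis(y \<xi>) \<xi>^n exp(-\<xi>^2/2), which
  vanishes at both ends. For n = 0 the natural number n - 1 is 0, and the factor n removes that
  term.\<close>

lemma gauss_rec: "gauss (Suc n) y = \<i> * of_real y * gauss n y + of_nat n * gauss (n - 1) y"
proof -
  define E where "E n \<xi> = cis (y * \<xi>) * of_real (\<xi> ^ n * exp (- \<xi>\<^sup>2 / 2))" for n \<xi>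
  define f where "f \<xi> = \<i> * of_real y * E n \<xi> + of_nat n * E (n - 1) \<xi> - E (Suc n) \<xi>" for \<xi>
  have [simp]: "integrable lborel (E n)" for n unfolding E_def by (rule integrable_gauss)
  have contE: "isCont (E n) \<xi>" for n \<xi> unfolding E_def cis_conv_exp by (intro continuous_intros) auto
  have nE: "norm (E n \<xi>) = \<bar>\<xi> ^ n * exp (- \<xi>\<^sup>2 / 2)\<bar>" "norm (E n (- \<xi>)) = \<bar>\<xi> ^ n * exp (- \<xi>\<^sup>2 / 2)\<bar>" for n \<xi>
    by (simp_all add: E_def norm_mult norm_power abs_mult power_abs)
  have lim: "((\<lambda>\<xi>. E n \<xi>) \<longlongrightarrow> 0) at_top" "((\<lambda>\<xi>. E n (- \<xi>)) \<longlongrightarrow> 0) at_top"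
    by (rule tendsto_norm_zero_cancel, unfold nE(1), rule tendsto_rabs_zero[OF tendsto_gauss_at_top],
        rule tendsto_norm_zero_cancel, unfold nE(2), rule tendsto_rabs_zero[OF tendsto_gauss_at_top])
  have "(LBINT \<xi>=-\<infinity>..\<infinity>. f \<xi>) = 0 - 0"
  proof (rule interval_integral_FTC_integrable)
    show "(E n has_vector_derivative f \<xi>) (at \<xi>)" for \<xi>
    proof -
      have 1: "((\<lambda>\<xi>. cis (y * \<xi>)) has_vector_derivative (\<i> * of_real y * cis (y * \<xi>))) (at \<xi>)"
      proof -
        have "((\<lambda>z. exp (\<i> * of_real y * z)) has_field_derivative (\<i> * of_real y * exp (\<i> * of_real y * of_real \<xi>))) (at (of_real \<xi>))"
          by (auto intro!: derivative_eq_intros)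
        from has_vector_derivative_real_field[OF this] show ?thesis by (simp add: cis_conv_exp mult.assoc)
      qed
      have 2: "((\<lambda>\<xi>. \<xi> ^ n * exp (- \<xi>\<^sup>2 / 2)) has_real_derivative
          (of_nat n * \<xi> ^ (n - 1) * exp (- \<xi>\<^sup>2 / 2) - \<xi> ^ Suc n * exp (- \<xi>\<^sup>2 / 2))) (at \<xi>)"
      proof -
        have "((\<lambda>\<xi>. exp (- \<xi>\<^sup>2 / 2)) has_real_derivative exp (- \<xi>\<^sup>2 / 2) * (- \<xi>)) (at \<xi>)"
          by (auto intro!: derivative_eq_intros)
        from DERIV_mult[OF DERIV_pow[of n] this] show ?thesis by (rule DERIV_cong) simp
      qed
      have "(E n has_vector_derivative (cis (y * \<xi>) * of_real (of_nat n * \<xi> ^ (n - 1) * exp (- \<xi>\<^sup>2 / 2) - \<xi> ^ Suc n * exp (- \<xi>\<^sup>2 / 2))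
          + (\<i> * of_real y * cis (y * \<xi>)) * of_real (\<xi> ^ n * exp (- \<xi>\<^sup>2 / 2)))) (at \<xi>)"
        unfolding E_def
        by (rule has_vector_derivative_mult[OF 1 has_vector_derivative_of_real[OF 2]])
      then show ?thesis by (rule back_subst[of "\<lambda>d. (E n has_vector_derivative d) (at \<xi>)"])
        (simp add: f_def E_def algebra_simps)
    qed
    show "isCont f \<xi>" for \<xi> unfolding f_def by (intro continuous_intros contE)
    show "set_integrable lborel (einterval (- \<infinity>) \<infinity>) f"
      unfolding f_def by (auto simp: set_integrable_def)
    show "((E n \<circ> real_of_ereal) \<longlongrightarrow> 0) (at_right (- \<infinity>))"
      using lim(2) by (simp add: ereal_tendsto_simps filterlim_at_bot_mirror)
    show "((E n \<circ> real_of_ereal) \<longlongrightarrow> 0) (at_left \<infinity>)"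
      using lim(1) by (simp add: ereal_tendsto_simps)
  qed auto
  then have "(LINT \<xi>|lborel. f \<xi>) = 0"
    by (simp add: interval_integral_to_infinity_eq interval_lebesgue_integral_def set_lebesgue_integral_def)
  then have "\<i> * of_real y * (LINT \<xi>|lborel. E n \<xi>) + of_nat n * (LINT \<xi>|lborel. E (n - 1) \<xi>) - (LINT \<xi>|lborel. E (Suc n) \<xi>) = 0"
    by (simp add: f_def[abs_def])
  then show ?thesis by (simp add: gauss_def E_def)
qed

text \<open>By the recursion the transform is exp(-y^2/2) times a polynomial of degree n in y, which
  half of the exponent absorbs. The constant is 4 from the recursion, 4^3 from (1 + |y|)^3 and 4 for
  sqrt(2 pi). Degree 3 is the highest that the Oseen symbol requires.\<close>

lemma gauss_bound:
  assumes "n \<le> 3"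
  shows "norm (gauss n y) \<le> 1024 * exp (- y\<^sup>2 / 4)"
proof -
  define B where "B = sqrt (2 * pi) * exp (- y\<^sup>2 / 2)"
  have B0: "0 \<le> B" by (simp add: B_def)
  define z where "z = 1 + \<bar>y\<bar>"
  have z: "1 \<le> z" "\<bar>y\<bar> \<le> z" by (auto simp: z_def)
  have g0: "norm (gauss 0 y) = B" unfolding gauss_0 by (simp add: B_def del: of_real_mult)
  have g1: "norm (gauss 1 y) \<le> B * z"
    using gauss_rec[of 0 y] mult_left_mono[OF z(2) B0] g0 by (simp add: norm_mult mult.commute)
  have g2: "norm (gauss 2 y) \<le> 2 * B * z ^ 2"
  proof -
    have "norm (gauss 2 y) \<le> \<bar>y\<bar> * norm (gauss 1 y) + norm (gauss 0 y)"
      using gauss_rec[of 1 y] norm_triangle_ineq[of "\<i> * of_real y * gauss 1 y" "gauss 0 y"]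
      by (simp add: norm_mult numeral_2_eq_2)
    also have "\<dots> \<le> z * (B * z) + B * z ^ 2"
      using g1 z B0 g0 by (intro add_mono mult_mono) (auto simp: mult_le_cancel_left1 one_le_power)
    finally show ?thesis by (simp add: power2_eq_square algebra_simps)
  qed
  have g3: "norm (gauss 3 y) \<le> 4 * B * z ^ 3"
  proof -
    have "norm (gauss 3 y) \<le> \<bar>y\<bar> * norm (gauss 2 y) + 2 * norm (gauss 1 y)"
      using gauss_rec[of 2 y] norm_triangle_ineq[of "\<i> * of_real y * gauss 2 y" "2 * gauss 1 y"]
      by (simp add: norm_mult numeral_3_eq_3 numeral_2_eq_2)
    also have "\<dots> \<le> z * (2 * B * z ^ 2) + 2 * (B * z)"
      using g1 g2 z B0 by (intro add_mono mult_mono) auto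
    also have "B * z \<le> B * z ^ 3" using z B0 by (intro mult_left_mono self_le_power) auto
    finally show ?thesis by (simp add: power3_eq_cube power2_eq_square algebra_simps)
  qed
  have p: "B * z ^ k \<le> B * z ^ 3" if "k \<le> 3" for k
    using z B0 that by (intro mult_left_mono power_increasing) auto
  consider "n = 0" | "n = 1" | "n = 2" | "n = 3" using assms by linarith
  then have "norm (gauss n y) \<le> 4 * (B * z ^ 3)"
    using g0 g1 g2 g3 p[of 0] p[of 1] p[of 2] B0 z by cases (auto simp: algebra_simps)
  also have "z ^ 3 \<le> (4 * exp (y\<^sup>2 / 12)) ^ 3"
  proof (rule power_mono)
    \<comment> \<open>The centre 6 makes |y| <= 3 + y^2/12, so that each of the three factors z uses
      a third of the exponent y^2/4.\<close>
    have "0 \<le> (\<bar>y\<bar> - 6)\<^sup>2" by simp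
    then have "\<bar>y\<bar> \<le> 3 + y\<^sup>2 / 12" by (simp add: power2_diff)
    then have "z \<le> 4 * (1 + y\<^sup>2 / 12)" by (simp add: z_def) (use zero_le_power2[of y] in argo)
    also have "\<dots> \<le> 4 * exp (y\<^sup>2 / 12)" by (intro mult_left_mono exp_ge_add_one_self) auto
    finally show "z \<le> 4 * exp (y\<^sup>2 / 12)" .
  qed (use z in auto)
  also have "\<dots> = 64 * exp (y\<^sup>2 / 4)"
    by (simp add: power_mult_distrib exp_of_nat_mult[of 3, symmetric, simplified])
  finally have "norm (gauss n y) \<le> 256 * (B * exp (y\<^sup>2 / 4))" using B0 by (simp add: mult_left_mono)
  also have "B * exp (y\<^sup>2 / 4) = sqrt (2 * pi) * exp (- y\<^sup>2 / 4)"
    by (simp add: B_def mult.assoc exp_add[symmetric] field_simps)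
  also have "sqrt (2 * pi) \<le> 4" using pi_less_4 by (intro real_le_lsqrt) auto
  finally show ?thesis by (simp add: mult_right_mono)
qed

lemma gauss_scaled:
  assumes "0 < s" "n \<le> 3"
  shows "integrable lborel (\<lambda>\<xi>. cis (y * \<xi>) * of_real (\<xi> ^ n * exp (- s * \<xi>\<^sup>2)))" (is ?A)
    and "norm (LINT \<xi>|lborel. cis (y * \<xi>) * of_real (\<xi> ^ n * exp (- s * \<xi>\<^sup>2)))
      \<le> 1024 * s powr (- (1 + real n) / 2) * exp (- y\<^sup>2 / (8 * s))" (is ?B)
proof -
  \<comment> \<open>The dilation that turns exp(-s \<xi>^2) into exp(-\<xi>^2/2); the 8s in the
    exponent of the claim is 4/c^2.\<close>
  define c where "c = 1 / sqrt (2 * s)"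
  have c: "0 < c" "c\<^sup>2 = 1 / (2 * s)" using assms by (auto simp: c_def power_divide)
  let ?f = "\<lambda>\<xi>. cis (y * \<xi>) * of_real (\<xi> ^ n * exp (- s * \<xi>\<^sup>2)) :: complex"
  have f: "?f (c * \<xi>) = of_real (c ^ n) * (cis (y * c * \<xi>) * of_real (\<xi> ^ n * exp (- \<xi>\<^sup>2 / 2)))" for \<xi>
    using c assms by (simp add: power_mult_distrib mult_ac)
  have I: "integrable lborel (\<lambda>\<xi>. ?f (0 + c * \<xi>))"
    unfolding add_0 f by (intro integrable_mult_right integrable_gauss)
  then show ?A using c by (subst (asm) lborel_integrable_real_affine_iff) auto
  have "(LINT \<xi>|lborel. ?f \<xi>) = c *\<^sub>R (LINT \<xi>|lborel. ?f (0 + c * \<xi>))"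
    using c by (subst lborel_integral_real_affine[of c _ 0]) auto
  also have "\<dots> = of_real (c ^ Suc n) * gauss n (y * c)"
    unfolding add_0 f gauss_def by (simp add: scaleR_conv_of_real)
  finally have "norm (LINT \<xi>|lborel. ?f \<xi>) = c ^ Suc n * norm (gauss n (y * c))"
    using c by (simp add: norm_mult norm_power)
  also have "\<dots> \<le> s powr (- (1 + real n) / 2) * (1024 * exp (- y\<^sup>2 / (8 * s)))"
  proof (intro mult_mono)
    have "c ^ Suc n \<le> (s powr (- 1 / 2)) ^ Suc n"
    proof (rule power_mono)
      have "c = (2 * s) powr (- 1 / 2)"
        using assms by (simp add: c_def powr_minus powr_half_sqrt inverse_eq_divide)
      also have "\<dots> \<le> s powr (- 1 / 2)" using assms by (intro powr_mono2') auto
      finally show "c \<le> s powr (- 1 / 2)" .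
    qed (use c in auto)
    also have "\<dots> = s powr (- (1 + real n) / 2)"
      using assms by (subst powr_realpow[symmetric], simp, subst powr_powr)
        (rule arg_cong[where f = "\<lambda>e. s powr e"], simp add: field_simps)
    finally show "c ^ Suc n \<le> s powr (- (1 + real n) / 2)" .
    show "norm (gauss n (y * c)) \<le> 1024 * exp (- y\<^sup>2 / (8 * s))"
      using gauss_bound[OF assms(2), of "y * c"] c by (simp add: power_mult_distrib)
  qed auto
  finally show ?B by (simp add: mult_ac)
qed

lemma gauss3:
  fixes x :: "real^3" and n :: "3 \<Rightarrow> nat"
  assumes s: "0 < s" and n: "\<And>i. n i \<le> 3"
  shows "integrable lborel (\<lambda>\<xi>::real^3. cis (x \<bullet> \<xi>) * of_real ((\<Prod>i\<in>UNIV. (\<xi> $ i) ^ n i) * exp (- s * (norm \<xi>)\<^sup>2)))" (is ?A)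
    and "norm (LINT \<xi>|lborel. cis (x \<bullet> \<xi>) * of_real ((\<Prod>i\<in>UNIV. (\<xi> $ i) ^ n i) * exp (- s * (norm \<xi>)\<^sup>2)))
      \<le> 1024 ^ 3 * s powr (- (3 + real (\<Sum>i\<in>UNIV. n i)) / 2) * exp (- (norm x)\<^sup>2 / (8 * s))" (is ?B)
proof -
  have nrm: "(norm v)\<^sup>2 = (\<Sum>i\<in>UNIV. (v $ i)\<^sup>2)" for v :: "real^3"
    by (simp add: norm_vec_def L2_set_def sum_nonneg)
  have eq: "cis (x \<bullet> \<xi>) * of_real ((\<Prod>i\<in>UNIV. (\<xi> $ i) ^ n i) * exp (- s * (norm \<xi>)\<^sup>2))
     = (\<Prod>i\<in>UNIV. cis (x $ i * \<xi> $ i) * of_real ((\<xi> $ i) ^ n i * exp (- s * (\<xi> $ i)\<^sup>2)))" for \<xi> :: "real^3"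
  proof -
    have "cis (x \<bullet> \<xi>) = (\<Prod>i\<in>UNIV. cis (x $ i * \<xi> $ i))"
      by (simp add: inner_vec_def cis_conv_exp exp_sum sum_distrib_left)
    moreover have "exp (- s * (norm \<xi>)\<^sup>2) = (\<Prod>i\<in>UNIV. exp (- s * (\<xi> $ i)\<^sup>2))"
      unfolding nrm by (simp add: exp_sum sum_distrib_left)
    ultimately show ?thesis by (simp add: prod.distrib)
  qed
  note g = gauss_scaled[OF s n]
  show ?A unfolding eq by (rule integrable_prod_axis[of "\<lambda>i t. cis (x $ i * t) * of_real (t ^ n i * exp (- s * t\<^sup>2))"]) (rule g)
  have "norm (LINT \<xi>|(lborel :: (real^3) measure). (\<Prod>i\<in>UNIV. cis (x $ i * \<xi> $ i) * of_real ((\<xi> $ i) ^ n i * exp (- s * (\<xi> $ i)\<^sup>2))))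
     = (\<Prod>i\<in>UNIV. norm (LINT t|lborel. cis (x $ i * t) * of_real (t ^ n i * exp (- s * t\<^sup>2))))"
    by (subst integral_prod_axis[of "\<lambda>i t. cis (x $ i * t) * of_real (t ^ n i * exp (- s * t\<^sup>2))"])
       (use g in \<open>auto simp: prod_norm\<close>)
  also have "\<dots> \<le> (\<Prod>i\<in>UNIV. 1024 * s powr (- (1 + real (n i)) / 2) * exp (- (x $ i)\<^sup>2 / (8 * s)))"
    using g(2) by (intro prod_mono) auto
  also have "\<dots> = 1024 ^ 3 * (\<Prod>i\<in>UNIV. s powr (- (1 + real (n i)) / 2)) * exp (- (norm x)\<^sup>2 / (8 * s))"
    unfolding nrm by (simp add: prod.distrib exp_sum sum_divide_distrib sum_negf[symmetric])
  also have "(\<Prod>i\<in>UNIV. s powr (- (1 + real (n i)) / 2)) = s powr (- (3 + real (\<Sum>i\<in>UNIV. n i)) / 2)"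
  proof -
    have "(\<Sum>i\<in>(UNIV :: 3 set). - (1 + real (n i)) / 2) = (\<Sum>i\<in>UNIV. - (1 + real (n i))) / 2"
      by (rule sum_divide_distrib[symmetric])
    also have "\<dots> = - (3 + real (\<Sum>i\<in>UNIV. n i)) / 2"
      by (simp only: sum_negf sum.distrib) simp
    finally have e: "(\<Sum>i\<in>(UNIV :: 3 set). - (1 + real (n i)) / 2) = - (3 + real (\<Sum>i\<in>UNIV. n i)) / 2" .
    have "s \<noteq> 0" using s by simp
    from powr_sum[OF this, of "\<lambda>i. - (1 + real (n i)) / 2" "UNIV :: 3 set"]
    show ?thesis unfolding e ..
  qed
  finally show ?B unfolding eq .
qed

section \<open>Subordination\<close>

lemma powr_ge_linear:
  assumes "0 \<le> (v::real)" "1 \<le> b"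
  shows "v - 1 \<le> v powr b"
proof (cases "v \<le> 1")
  case True then show ?thesis using powr_ge_zero[of v b] by linarith
next
  case False
  then have "v powr 1 \<le> v powr b" using assms by (intro powr_mono) auto
  then show ?thesis using assms by simp
qed

text \<open>The weight 1 + |\<xi>| is the growth allowed to the amplitudes. The integrable
  comparison function (1 + |\<xi>|)^(-4) costs four powers and the weight a fifth; these five are
  dominated by exp(t |\<xi>|), and c is chosen with 5c <= t.\<close>

lemma integrable_exp_norm_powr:
  assumes "0 < t" "1 \<le> b"
  shows "integrable lborel (\<lambda>\<xi>::real^3. (1 + norm \<xi>) * exp (- t * norm \<xi> powr b))"
proof (rule Bochner_Integration.integrable_bound)
  define c where "c = min 1 (t / 5)"
  have "integrable lborel (\<lambda>x::real^3. 1 / (1 + norm x) ^ 4)"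
    using nn_integral_decay by (intro integrableI_bounded) (auto simp: abs_of_nonneg)
  then show "integrable lborel (\<lambda>x::real^3. exp t / c ^ 5 * (1 / (1 + norm x) ^ 4))"
    by (rule integrable_mult_right)
  have c: "0 < c" "c \<le> 1" "5 * c \<le> t" using assms by (auto simp: c_def)
  have "(1 + v) * exp (- t * v powr b) \<le> exp t / c ^ 5 * (1 / (1 + v) ^ 4)" if v: "0 \<le> v" for v :: real
  proof -
    have "(c * (1 + v)) ^ 5 \<le> exp (c * v) ^ 5"
    proof (rule power_mono)
      have "c * (1 + v) \<le> 1 + c * v" using c by (simp add: algebra_simps)
      also have "\<dots> \<le> exp (c * v)" by (rule exp_ge_add_one_self)
      finally show "c * (1 + v) \<le> exp (c * v)" .
    qed (use v c in auto)
    also have "\<dots> = exp (5 * c * v)" by (simp add: exp_of_nat_mult[of 5, symmetric, simplified] mult.assoc)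
    also have "\<dots> \<le> exp (t * v)" using c v by (simp add: mult_right_mono)
    finally have 1: "c ^ 5 * (1 + v) ^ 5 \<le> exp (t * v)" by (simp add: power_mult_distrib)
    have "exp (- t * v powr b) \<le> exp (t - t * v)"
      using mult_left_mono[OF powr_ge_linear[OF v assms(2)], of t] assms by (simp add: algebra_simps)
    then have "(c ^ 5 * (1 + v) ^ 5) * exp (- t * v powr b) \<le> exp (t * v) * exp (t - t * v)"
      using 1 c v by (intro mult_mono) auto
    also have "\<dots> = exp t" by (simp add: exp_add[symmetric])
    finally have "c ^ 5 * (1 + v) ^ 5 * exp (- t * v powr b) \<le> exp t" .
    moreover have "(1 + v) ^ 5 = (1 + v) * (1 + v) ^ 4" by (simp add: eval_nat_numeral)
    ultimately show ?thesis using c v by (simp add: field_simps)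
  qed
  then show "AE \<xi>::real^3 in lborel. norm ((1 + norm \<xi>) * exp (- t * norm \<xi> powr b))
      \<le> norm (exp t / c ^ 5 * (1 / (1 + norm \<xi>) ^ 4))"
    using c by (auto simp: abs_mult abs_of_nonneg)
qed auto


text \<open>The radial factor is a function of r = |\<xi>|^2, so that a Gaussian symbol becomes
  exp(-s r) and the fractional one exp(-t r^\<alpha>), with r^\<alpha> a Bernstein function for
  \<alpha> <= 1.\<close>

definition osc :: "(real^3 \<Rightarrow> complex) \<Rightarrow> real^3 \<Rightarrow> (real \<Rightarrow> real) \<Rightarrow> complex" where
  "osc a x F = (LINT \<xi>|lborel. cis (x \<bullet> \<xi>) * a \<xi> * of_real (F ((norm \<xi>)\<^sup>2)))"

section \<open>Nonnegative coefficients of the binomial series\<close>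

lemma coeff_power_nonneg:
  fixes p :: "real poly"
  assumes "\<And>i. 0 \<le> coeff p i"
  shows "0 \<le> coeff (p ^ m) i"
proof (induction m arbitrary: i)
  case (Suc m)
  then show ?case using assms by (auto simp: coeff_mult intro!: sum_nonneg)
qed (simp add: coeff_1)

text \<open>For k >= 1 this is the coefficient of y^k in 1 - (1 - y)^\<alpha>. At k = 0 its value is
  -1 instead of 0, which is why only \<open>Suc k\<close> occurs below.\<close>

definition binc :: "real \<Rightarrow> nat \<Rightarrow> real" where
  "binc \<alpha> k = - ((\<alpha> gchoose k) * (- 1) ^ k)"

text \<open>Consecutive coefficients differ by the factor (k - \<alpha>)/(k + 1), which is
  nonnegative for k >= 1 because \<alpha> <= 1.\<close>

lemma binc_nonneg:
  assumes "0 < \<alpha>" "\<alpha> \<le> 1"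
  shows "0 \<le> binc \<alpha> (Suc k)"
proof (induction k)
  case 0 then show ?case using assms by (simp add: binc_def)
next
  case (Suc k)
  have "(\<alpha> gchoose (Suc (Suc k))) * of_nat (Suc (Suc k)) = (\<alpha> - of_nat (Suc k)) * (\<alpha> gchoose (Suc k))"
    using gbinomial_absorb_comp[of \<alpha> "Suc k"] gbinomial_mult_1[of \<alpha> "Suc k"] by (simp add: algebra_simps)
  then have "(\<alpha> gchoose (Suc (Suc k))) = (\<alpha> - of_nat (Suc k)) * (\<alpha> gchoose (Suc k)) / of_nat (Suc (Suc k))"
    by (simp add: eq_divide_eq del: of_nat_Suc)
  then have "binc \<alpha> (Suc (Suc k)) = (of_nat (Suc k) - \<alpha>) / of_nat (Suc (Suc k)) * binc \<alpha> (Suc k)"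
    by (simp add: binc_def minus_divide_left algebra_simps del: of_nat_Suc)
  then show ?case using Suc assms by simp
qed

lemma binc_sums:
  assumes "0 \<le> y" "y < 1"
  shows "(\<lambda>k. binc \<alpha> (Suc k) * y ^ Suc k) sums (1 - (1 - y) powr \<alpha>)"
proof -
  have "(\<lambda>n. (\<alpha> gchoose n) * (- y) ^ n) sums (1 + (- y)) powr \<alpha>"
    using assms by (intro gen_binomial_real) auto
  then have "(\<lambda>n. - ((\<alpha> gchoose n) * (- y) ^ n)) sums (- ((1 - y) powr \<alpha>))"
    using sums_minus by fastforce
  then have "(\<lambda>n. binc \<alpha> n * y ^ n) sums (- ((1 - y) powr \<alpha>))"
    by (simp add: binc_def power_minus[of y] mult.assoc)
  then show ?thesis
    using sums_Suc_iff[of "\<lambda>n. binc \<alpha> n * y ^ n" "1 - (1 - y) powr \<alpha>"] by (simp add: binc_def)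
qed

definition binpoly :: "real \<Rightarrow> nat \<Rightarrow> real poly" where
  "binpoly \<alpha> N = (\<Sum>k<N. monom (binc \<alpha> (Suc k)) (Suc k))"

lemma poly_binpoly: "poly (binpoly \<alpha> N) y = (\<Sum>k<N. binc \<alpha> (Suc k) * y ^ Suc k)"
  by (simp add: binpoly_def poly_sum poly_monom)

lemma coeff_binpoly_nonneg:
  assumes "0 < \<alpha>" "\<alpha> \<le> 1"
  shows "0 \<le> coeff (binpoly \<alpha> N) i"
  unfolding binpoly_def coeff_sum using binc_nonneg[OF assms] by (intro sum_nonneg) auto

text \<open>For y < 1 a partial sum is at most the full series 1 - (1 - y)^\<alpha> <= 1;
  polynomials are continuous, so y may increase to 1 without any question of convergence of the
  series there.\<close>

lemma binpoly_le_1: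
  assumes "0 < \<alpha>" "\<alpha> \<le> 1"
  shows "poly (binpoly \<alpha> N) 1 \<le> 1"
proof (rule tendsto_upperbound)
  show "((\<lambda>y. poly (binpoly \<alpha> N) y) \<longlongrightarrow> poly (binpoly \<alpha> N) 1) (at_left 1)"
    by (intro tendsto_intros)
  show "\<forall>\<^sub>F y in at_left (1::real). poly (binpoly \<alpha> N) y \<le> 1"
    using eventually_at_left_real[of 0 "1::real", OF zero_less_one]
  proof eventually_elim
    case (elim y)
    then have y: "0 \<le> y" "y < 1" by auto
    have "poly (binpoly \<alpha> N) y \<le> (\<Sum>k. binc \<alpha> (Suc k) * y ^ Suc k)"
      unfolding poly_binpoly using binc_nonneg[OF assms] y binc_sums[OF y]
      by (intro sum_le_suminf) (auto simp: sums_iff)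
    also have "\<dots> = 1 - (1 - y) powr \<alpha>" using binc_sums[OF y] by (simp add: sums_iff)
    also have "\<dots> \<le> 1" by simp
    finally show ?case .
  qed
qed simp

text \<open>With \<open>\<phi> r = exp (- t r\<^sup>\<alpha>)\<close> for \<open>\<alpha> \<le> 1\<close>: \<open>\<phi>\<close> is a limit of nonnegative combinations of exponentials \<open>exp (- s r)\<close>
  with total mass at most 1. Indeed \<open>r\<^sup>\<alpha>\<close> is the limit of \<open>n\<^sup>\<alpha> (1 - y)\<^sup>\<alpha>\<close> with \<open>y = exp (- r/n)\<close>, and the coefficients of
  \<open>1 - (1 - y)\<^sup>\<alpha>\<close> are nonnegative. Hence a bound for Gaussian symbols that is affine in \<open>exp (- s \<rho>)\<close> passes to the
  stable symbols; \<open>\<kappa> = 1\<close> keeps the factor that vanishes as \<open>t \<rightarrow> 0\<close>. The factor \<open>exp (- \<delta> r)\<close> in \<open>adm\<close> provides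
  a dominating function.\<close>

locale subordination =
  fixes a :: "real^3 \<Rightarrow> complex" and x :: "real^3" and A C \<kappa> \<rho> :: real
  assumes a_meas [measurable]: "a \<in> borel_measurable borel"
    and a_bound: "\<And>\<xi>. norm (a \<xi>) \<le> A * (1 + norm \<xi>)"
    and \<kappa>: "0 \<le> \<kappa>" "\<kappa> \<le> 1" and \<rho>: "0 < \<rho>" and C: "0 \<le> C"
    and gauss_case: "\<And>s. 0 < s \<Longrightarrow> norm (osc a x (\<lambda>r. exp (- s * r))) \<le> C * (1 - \<kappa> * exp (- s * \<rho>))"
begin

lemma A: "0 \<le> A"
  using order_trans[OF norm_ge_zero a_bound[of 0]] by simp

definition adm :: "(real \<Rightarrow> real) \<Rightarrow> bool" where
  "adm F \<longleftrightarrow> F \<in> borel_measurable borel \<and> (\<forall>r>0. 0 \<le> F r \<and> F r \<le> 1) \<and>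
     (\<forall>\<delta>>0. norm (osc a x (\<lambda>r. F r * exp (- \<delta> * r))) \<le> C * (1 - \<kappa> * (F \<rho> * exp (- \<delta> * \<rho>))))"

lemma integrable_dom: "0 < \<delta> \<Longrightarrow> integrable lborel (\<lambda>\<xi>::real^3. A * ((1 + norm \<xi>) * exp (- \<delta> * (norm \<xi>)\<^sup>2)))"
  using integrable_exp_norm_powr[of \<delta> 2] by (intro integrable_mult_right) simp

text \<open>The hypotheses concern r > 0 only, \<xi> = 0 being a null set: the binomial series will
  be summed at y = exp(-s r), which is below 1 just for r > 0.\<close>

lemma osc_limit:
  fixes w :: "real^3 \<Rightarrow> real"
  assumes [measurable]: "\<And>n. F n \<in> borel_measurable borel" "G \<in> borel_measurable borel"
    and w: "integrable lborel w" and le: "\<And>n \<xi>. \<xi> \<noteq> 0 \<Longrightarrow> A * (1 + norm \<xi>) * \<bar>F n ((norm \<xi>)\<^sup>2)\<bar> \<le> w \<xi>"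
    and lim: "\<And>r. 0 < r \<Longrightarrow> (\<lambda>n. F n r) \<longlonglongrightarrow> G r"
  shows "(\<lambda>n. osc a x (F n)) \<longlonglongrightarrow> osc a x G"
  unfolding osc_def
proof (rule integral_dominated_convergence[where w = w])
  show "AE \<xi> in lborel. (\<lambda>n. cis (x \<bullet> \<xi>) * a \<xi> * of_real (F n ((norm \<xi>)\<^sup>2)))
      \<longlonglongrightarrow> cis (x \<bullet> \<xi>) * a \<xi> * of_real (G ((norm \<xi>)\<^sup>2))"
    using AE_lborel_singleton[of 0] by eventually_elim (auto intro!: tendsto_intros lim)
  show "AE \<xi> in lborel. norm (cis (x \<bullet> \<xi>) * a \<xi> * of_real (F n ((norm \<xi>)\<^sup>2))) \<le> w \<xi>" for n
    using AE_lborel_singleton[of 0]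
  proof eventually_elim
    case (elim \<xi>)
    have "norm (cis (x \<bullet> \<xi>) * a \<xi> * of_real (F n ((norm \<xi>)\<^sup>2))) = norm (a \<xi>) * \<bar>F n ((norm \<xi>)\<^sup>2)\<bar>"
      by (simp add: norm_mult)
    also have "\<dots> \<le> A * (1 + norm \<xi>) * \<bar>F n ((norm \<xi>)\<^sup>2)\<bar>" by (intro mult_right_mono a_bound) auto
    finally show ?case using le[OF elim, of n] by linarith
  qed
qed (use w in measurable)

text \<open>Members of the class are bounded by 1, so for fixed \<delta> the factor exp(-\<delta>
  |\<xi>|^2) gives one dominating function for the whole sequence; the bound is affine in F(\<rho>)
  and passes to the limit.\<close>

lemma adm_limit:
  assumes F: "\<And>n. adm (F n)" and [measurable]: "G \<in> borel_measurable borel"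
    and lim: "\<And>r. 0 < r \<Longrightarrow> (\<lambda>n. F n r) \<longlonglongrightarrow> G r"
  shows "adm G"
  unfolding adm_def
proof (intro conjI allI impI)
  have [measurable]: "F n \<in> borel_measurable borel" for n using F[of n] by (simp add: adm_def)
  show "0 \<le> G r" "G r \<le> 1" if "0 < r" for r
    using F that by (auto simp: adm_def intro!: LIMSEQ_le_const[OF lim[OF that]] LIMSEQ_le_const2[OF lim[OF that]])
  fix \<delta> :: real assume \<delta>: "0 < \<delta>"
  have "(\<lambda>n. osc a x (\<lambda>r. F n r * exp (- \<delta> * r))) \<longlonglongrightarrow> osc a x (\<lambda>r. G r * exp (- \<delta> * r))"
  proof (rule osc_limit[OF _ _ integrable_dom[OF \<delta>]])
    show "A * (1 + norm \<xi>) * \<bar>F n ((norm \<xi>)\<^sup>2) * exp (- \<delta> * (norm \<xi>)\<^sup>2)\<bar> \<le> A * ((1 + norm \<xi>) * exp (- \<delta> * (norm \<xi>)\<^sup>2))"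
      if "\<xi> \<noteq> 0" for n \<xi>
    proof -
      have "\<bar>F n ((norm \<xi>)\<^sup>2)\<bar> * exp (- \<delta> * (norm \<xi>)\<^sup>2) \<le> 1 * exp (- \<delta> * (norm \<xi>)\<^sup>2)"
        using F[of n] that by (intro mult_right_mono) (auto simp: adm_def)
      then show ?thesis using A unfolding mult.assoc abs_mult
        by (intro mult_left_mono) auto
    qed
    show "(\<lambda>n. F n r * exp (- \<delta> * r)) \<longlonglongrightarrow> G r * exp (- \<delta> * r)" if "0 < r" for r
      by (intro tendsto_intros lim that)
  qed measurable
  then have "(\<lambda>n. norm (osc a x (\<lambda>r. F n r * exp (- \<delta> * r)))) \<longlonglongrightarrow> norm (osc a x (\<lambda>r. G r * exp (- \<delta> * r)))"
    by (rule tendsto_norm)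
  moreover have "(\<lambda>n. C * (1 - \<kappa> * (F n \<rho> * exp (- \<delta> * \<rho>)))) \<longlonglongrightarrow> C * (1 - \<kappa> * (G \<rho> * exp (- \<delta> * \<rho>)))"
    by (intro tendsto_intros lim \<rho>)
  ultimately show "norm (osc a x (\<lambda>r. G r * exp (- \<delta> * r))) \<le> C * (1 - \<kappa> * (G \<rho> * exp (- \<delta> * \<rho>)))"
    by (rule LIMSEQ_le) (use F \<delta> in \<open>auto simp: adm_def\<close>)
qed measurable

lemma integrable_osc_exp:
  assumes "0 < s"
  shows "integrable lborel (\<lambda>\<xi>. cis (x \<bullet> \<xi>) * a \<xi> * of_real (exp (- s * (norm \<xi>)\<^sup>2)))"
proof (rule Bochner_Integration.integrable_bound[OF integrable_dom[OF assms]])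
  show "AE \<xi> in lborel. norm (cis (x \<bullet> \<xi>) * a \<xi> * of_real (exp (- s * (norm \<xi>)\<^sup>2)))
    \<le> norm (A * ((1 + norm \<xi>) * exp (- s * (norm \<xi>)\<^sup>2)))"
    using a_bound A by (intro always_eventually) (auto simp: norm_mult mult.assoc[symmetric] intro!: mult_right_mono)
qed measurable

text \<open>A polynomial in exp(-s r) with nonnegative coefficients is a positive combination of
  exponentials, and exp(-\<delta> r) keeps every exponent positive, also that of the constant term.
  The Gaussian bound is affine in exp(-s \<rho>) and can therefore be averaged; the total mass b
  p(1) is at most 1.\<close>

lemma adm_poly:
  assumes p: "\<And>i. 0 \<le> coeff p i" and b: "0 \<le> b" "b * poly p 1 \<le> 1" and s: "0 < s"
  shows "adm (\<lambda>r. b * poly p (exp (- s * r)))"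
  unfolding adm_def
proof (intro conjI allI impI)
  show "(\<lambda>r. b * poly p (exp (- s * r))) \<in> borel_measurable borel"
    unfolding poly_altdef by measurable
  fix r :: real assume r: "0 < r"
  show "0 \<le> b * poly p (exp (- s * r))"
    unfolding poly_altdef using p b by (auto intro!: sum_nonneg mult_nonneg_nonneg)
  have "poly p (exp (- s * r)) \<le> poly p 1"
    unfolding poly_altdef using p s r by (auto intro!: sum_mono mult_left_le power_le_one)
  then show "b * poly p (exp (- s * r)) \<le> 1"
    using b mult_left_mono[of _ _ b] by (meson order_trans)
next
  fix \<delta> :: real assume \<delta>: "0 < \<delta>"
  define e where "e i = \<delta> + s * real i" for i
  have e0: "0 < e i" for i using s \<delta> by (simp add: e_def add_pos_nonneg)
  have e: "b * poly p (exp (- s * r)) * exp (- \<delta> * r) = (\<Sum>i\<le>degree p. (b * coeff p i) * exp (- e i * r))" for r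
    unfolding poly_altdef
    by (simp add: sum_distrib_left sum_distrib_right e_def exp_of_nat_mult[symmetric] exp_add[symmetric] algebra_simps flip: exp_add)
  have "osc a x (\<lambda>r. b * poly p (exp (- s * r)) * exp (- \<delta> * r))
      = (\<Sum>i\<le>degree p. of_real (b * coeff p i) * osc a x (\<lambda>r. exp (- e i * r)))"
  proof -
    have "osc a x (\<lambda>r. b * poly p (exp (- s * r)) * exp (- \<delta> * r))
      = (LINT \<xi>|lborel. (\<Sum>i\<le>degree p. of_real (b * coeff p i) * (cis (x \<bullet> \<xi>) * a \<xi> * of_real (exp (- e i * (norm \<xi>)\<^sup>2)))))"
      unfolding osc_def e by (simp add: sum_distrib_left mult_ac)
    also have "\<dots> = (\<Sum>i\<le>degree p. of_real (b * coeff p i) * osc a x (\<lambda>r. exp (- e i * r)))"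
      unfolding osc_def by (subst Bochner_Integration.integral_sum)
        (use integrable_osc_exp[OF e0] in auto)
    finally show ?thesis .
  qed
  also have "norm \<dots> \<le> (\<Sum>i\<le>degree p. (b * coeff p i) * (C * (1 - \<kappa> * exp (- e i * \<rho>))))"
  proof (rule sum_norm_le)
    fix i
    have "norm (of_real (b * coeff p i) * osc a x (\<lambda>r. exp (- e i * r))) = (b * coeff p i) * norm (osc a x (\<lambda>r. exp (- e i * r)))"
      using p[of i] b by (simp add: norm_mult)
    also have "\<dots> \<le> (b * coeff p i) * (C * (1 - \<kappa> * exp (- e i * \<rho>)))"
      using p[of i] b by (intro mult_left_mono gauss_case e0) auto
    finally show "norm (of_real (b * coeff p i) * osc a x (\<lambda>r. exp (- e i * r))) \<le> (b * coeff p i) * (C * (1 - \<kappa> * exp (- e i * \<rho>)))" .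
  qed
  also have "\<dots> = C * (b * poly p 1 - \<kappa> * (b * poly p (exp (- s * \<rho>)) * exp (- \<delta> * \<rho>)))"
    unfolding e by (simp add: poly_altdef sum_distrib_left sum_subtractf algebra_simps)
  also have "\<dots> \<le> C * (1 - \<kappa> * (b * poly p (exp (- s * \<rho>)) * exp (- \<delta> * \<rho>)))"
    using C b by (intro mult_left_mono) auto
  finally show "norm (osc a x (\<lambda>r. b * poly p (exp (- s * r)) * exp (- \<delta> * r)))
    \<le> C * (1 - \<kappa> * (b * poly p (exp (- s * \<rho>)) * exp (- \<delta> * \<rho>)))" .
qed

text \<open>Taylor polynomials of the exponential preserve nonnegative coefficients, and
  exp(-\<tau>) reduces the mass to exp(\<tau> (G(1) - 1)) <= 1. This is the analogue of a compound
  Poisson law with jump weights given by G.\<close>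

lemma adm_exp_poly:
  assumes G: "\<And>i. 0 \<le> coeff G i" "poly G 1 \<le> 1" and \<tau>: "0 \<le> \<tau>" and s: "0 < s"
  shows "adm (\<lambda>r. exp (- \<tau>) * exp (\<tau> * poly G (exp (- s * r))))"
proof (rule adm_limit)
  define p where "p M = (\<Sum>m<M. smult (\<tau> ^ m / fact m) (G ^ m))" for M
  have pp: "poly (p M) y = (\<Sum>m<M. (\<tau> * poly G y) ^ m /\<^sub>R fact m)" for M y
    by (simp add: p_def poly_sum poly_power power_mult_distrib divide_inverse mult_ac)
  show "adm (\<lambda>r. exp (- \<tau>) * poly (p M) (exp (- s * r)))" for M
  proof (rule adm_poly)
    show "0 \<le> coeff (p M) i" for i
      unfolding p_def coeff_sum using coeff_power_nonneg[OF G(1)] \<tau> by (auto intro!: sum_nonneg)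
    have G1: "0 \<le> poly G 1" unfolding poly_altdef using G(1) by (simp add: sum_nonneg)
    have "poly (p M) 1 \<le> exp (\<tau> * poly G 1)"
      unfolding pp exp_def using \<tau> G1 by (intro sum_le_suminf summable_exp_generic) auto
    also have "\<dots> \<le> exp \<tau>" using G(2) \<tau> by (simp add: mult_left_le)
    finally have "exp (- \<tau>) * poly (p M) 1 \<le> exp (- \<tau>) * exp \<tau>" by (intro mult_left_mono) auto
    then show "exp (- \<tau>) * poly (p M) 1 \<le> 1" by (simp add: exp_add[symmetric])
  qed (use s in auto)
  show "(\<lambda>M. exp (- \<tau>) * poly (p M) (exp (- s * r))) \<longlonglongrightarrow> exp (- \<tau>) * exp (\<tau> * poly G (exp (- s * r)))" for r
    unfolding pp using exp_converges[of "\<tau> * poly G (exp (- s * r))"] by (intro tendsto_intros) (simp add: sums_def)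
qed (simp add: poly_altdef)

text \<open>Two limits: the binomial polynomials lead to exp(-\<tau> (1 - exp(-s r))^\<alpha>), and
  the choice s = 1/(n+1), \<tau> = t (n+1)^\<alpha> then leads to exp(-t r^\<alpha>), since (n+1)(1
  - exp(-r/(n+1))) tends to r.\<close>

lemma adm_stable:
  assumes \<alpha>: "0 < \<alpha>" "\<alpha> \<le> 1" and t: "0 \<le> t"
  shows "adm (\<lambda>r. exp (- t * r powr \<alpha>))"
proof -
  have step: "adm (\<lambda>r. exp (- \<tau> * (1 - exp (- s * r)) powr \<alpha>))" if \<tau>: "0 \<le> \<tau>" and s: "0 < s" for \<tau> s
  proof (rule adm_limit[OF adm_exp_poly[OF coeff_binpoly_nonneg[OF \<alpha>] binpoly_le_1[OF \<alpha>] \<tau> s]])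
    show "(\<lambda>N. exp (- \<tau>) * exp (\<tau> * poly (binpoly \<alpha> N) (exp (- s * r)))) \<longlonglongrightarrow> exp (- \<tau> * (1 - exp (- s * r)) powr \<alpha>)"
      if "0 < r" for r
    proof -
      have "(\<lambda>N. poly (binpoly \<alpha> N) (exp (- s * r))) \<longlonglongrightarrow> 1 - (1 - exp (- s * r)) powr \<alpha>"
        unfolding poly_binpoly using binc_sums[of "exp (- s * r)" \<alpha>] s that by (simp add: sums_def)
      then have "(\<lambda>N. exp (- \<tau>) * exp (\<tau> * poly (binpoly \<alpha> N) (exp (- s * r))))
          \<longlonglongrightarrow> exp (- \<tau>) * exp (\<tau> * (1 - (1 - exp (- s * r)) powr \<alpha>))"
        by (intro tendsto_intros)
      then show ?thesis by (simp add: exp_add[symmetric] algebra_simps)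
    qed
  qed measurable
  show ?thesis
  proof (rule adm_limit)
    show "adm (\<lambda>r. exp (- (t * real (Suc n) powr \<alpha>) * (1 - exp (- (1 / real (Suc n)) * r)) powr \<alpha>))" for n
      using t by (intro step) auto
    show "(\<lambda>n. exp (- (t * real (Suc n) powr \<alpha>) * (1 - exp (- (1 / real (Suc n)) * r)) powr \<alpha>)) \<longlonglongrightarrow> exp (- t * r powr \<alpha>)"
      if r: "0 < r" for r
    proof -
      have "(\<lambda>n. real (Suc n) * (1 - exp (- (1 / real (Suc n)) * r))) \<longlonglongrightarrow> r"
        using r by real_asymp
      then have "(\<lambda>n. exp (- t * (real (Suc n) * (1 - exp (- (1 / real (Suc n)) * r))) powr \<alpha>)) \<longlonglongrightarrow> exp (- t * r powr \<alpha>)"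
        using r by (intro tendsto_intros) auto
      moreover have "(real (Suc n) * (1 - exp (- (1 / real (Suc n)) * r))) powr \<alpha>
          = real (Suc n) powr \<alpha> * (1 - exp (- (1 / real (Suc n)) * r)) powr \<alpha>" for n
        using r by (intro powr_mult)
      ultimately show ?thesis by (simp add: mult_ac)
    qed
  qed measurable
qed

text \<open>Removes the factor exp(-\<delta> r) by letting \<delta> = 1/(n+1) tend to 0. The
  dominating function is now the fractional symbol itself, integrable against 1 + |\<xi>| because 2
  \<alpha> >= 1 and t > 0.\<close>

theorem subordination_bound:
  assumes \<alpha>: "1 / 2 < \<alpha>" "\<alpha> \<le> 1" and t: "0 < t"
  shows "norm (osc a x (\<lambda>r. exp (- t * r powr \<alpha>))) \<le> C * (1 - \<kappa> * exp (- t * \<rho> powr \<alpha>))"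
proof -
  define F where "F n r = exp (- t * r powr \<alpha>) * exp (- (1 / real (Suc n)) * r)" for n r
  have w: "F n \<in> borel_measurable borel" for n unfolding F_def by measurable
  have "(\<lambda>n. osc a x (F n)) \<longlonglongrightarrow> osc a x (\<lambda>r. exp (- t * r powr \<alpha>))"
  proof (rule osc_limit)
    show "integrable lborel (\<lambda>\<xi>::real^3. A * ((1 + norm \<xi>) * exp (- t * norm \<xi> powr (2 * \<alpha>))))"
      using \<alpha> t by (intro integrable_mult_right integrable_exp_norm_powr) auto
    show "A * (1 + norm \<xi>) * \<bar>F n ((norm \<xi>)\<^sup>2)\<bar> \<le> A * ((1 + norm \<xi>) * exp (- t * norm \<xi> powr (2 * \<alpha>)))" if "\<xi> \<noteq> 0" for n \<xi>
    proof -
      have "((norm \<xi>)\<^sup>2) powr \<alpha> = norm \<xi> powr (2 * \<alpha>)"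
        using that by (simp add: powr_powr[symmetric])
      then have "\<bar>F n ((norm \<xi>)\<^sup>2)\<bar> \<le> exp (- t * norm \<xi> powr (2 * \<alpha>)) * 1"
        unfolding F_def abs_mult by (intro mult_mono) auto
      then show ?thesis using A unfolding mult.assoc by (intro mult_left_mono) auto
    qed
    show "(\<lambda>n. F n r) \<longlonglongrightarrow> exp (- t * r powr \<alpha>)" for r
    proof -
      have "(\<lambda>n. exp (- (1 / real (Suc n)) * r)) \<longlonglongrightarrow> exp (- 0 * r)"
        by (intro tendsto_intros LIMSEQ_Suc[OF lim_1_over_n])
      from tendsto_mult[OF tendsto_const[of "exp (- t * r powr \<alpha>)"] this] show ?thesis by (simp add: F_def)
    qed
  qed (use w in \<open>auto simp: F_def\<close>)
  then have l: "(\<lambda>n. norm (osc a x (F n))) \<longlonglongrightarrow> norm (osc a x (\<lambda>r. exp (- t * r powr \<alpha>)))"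
    by (rule tendsto_norm)
  have "(\<lambda>n. C * (1 - \<kappa> * (exp (- t * \<rho> powr \<alpha>) * exp (- (1 / real (Suc n)) * \<rho>))))
      \<longlonglongrightarrow> C * (1 - \<kappa> * (exp (- t * \<rho> powr \<alpha>) * exp (- 0 * \<rho>)))"
    by (intro tendsto_intros LIMSEQ_Suc[OF lim_1_over_n])
  with l have "norm (osc a x (\<lambda>r. exp (- t * r powr \<alpha>))) \<le> C * (1 - \<kappa> * (exp (- t * \<rho> powr \<alpha>) * exp (- 0 * \<rho>)))"
  proof (rule LIMSEQ_le)
    have "adm (\<lambda>r. exp (- t * r powr \<alpha>))" using \<alpha> t by (intro adm_stable) auto
    then have "\<forall>\<delta>>0. norm (osc a x (\<lambda>r. exp (- t * r powr \<alpha>) * exp (- \<delta> * r)))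
        \<le> C * (1 - \<kappa> * (exp (- t * \<rho> powr \<alpha>) * exp (- \<delta> * \<rho>)))" unfolding adm_def by blast
    moreover have "0 < 1 / real (Suc n)" for n by simp
    ultimately have "norm (osc a x (F n)) \<le> C * (1 - \<kappa> * (exp (- t * \<rho> powr \<alpha>) * exp (- (1 / real (Suc n)) * \<rho>)))" for n
      unfolding F_def by blast
    then show "\<exists>N. \<forall>n\<ge>N. norm (osc a x (F n)) \<le> C * (1 - \<kappa> * (exp (- t * \<rho> powr \<alpha>) * exp (- (1 / real (Suc n)) * \<rho>)))"
      by blast
  qed
  then show ?thesis by simp
qed

end

section \<open>Pointwise bounds for the kernels\<close>

lemma measurable_vec_nth [measurable (raw)]:
  fixes f :: "'a \<Rightarrow> real^'n"
  assumes "f \<in> borel_measurable M"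
  shows "(\<lambda>x. f x $ i) \<in> borel_measurable M"
  by (rule measurable_compose[OF assms borel_measurable_continuous_onI]) (intro continuous_intros)

section \<open>Gaussian symbols away from the origin\<close>

lemma le_exp_scaled: "0 < k \<Longrightarrow> k + w \<le> k * exp (w / k)" for w k :: real
  using mult_left_mono[OF exp_ge_add_one_self[of "w / k"], of k] by (simp add: algebra_simps)

text \<open>The size |x|^(-3) alone would be too weak in the far field. The bracket is comparable to
  min(1, s/|x|^2) and survives subordination, with \<kappa> = 1 and \<rho> = |x|^(-2), where it
  supplies the missing factor R/|x|. With w = |x|^2/s the claim compares w^(3/2) exp(-w/8) with 1 -
  exp(-1/w), and the latter is at least 1/(1 + w). The constant is 24 = 3 * 8 because the cube of
  exp(w/24) is exp(w/8).\<close>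

lemma heat_gauss_bound:
  fixes x :: "real^3"
  assumes s: "0 < s" and x: "x \<noteq> 0"
  shows "norm (osc (\<lambda>_. 1) x (\<lambda>r. exp (- s * r)))
    \<le> 1024 ^ 3 * 24 ^ 3 / norm x ^ 3 * (1 - 1 * exp (- s * (1 / (norm x)\<^sup>2)))"
proof -
  define w where "w = (norm x)\<^sup>2 / s"
  have w: "0 < w" using s x by (simp add: w_def)
  have "norm (osc (\<lambda>_. 1) x (\<lambda>r. exp (- s * r))) \<le> 1024 ^ 3 * (s powr (- 3 / 2) * exp (- w / 8))"
    using gauss3(2)[OF s, of "\<lambda>_. 0" x] by (simp add: osc_def w_def mult.commute[of 8])
  also have "s powr (- 3 / 2) * exp (- w / 8) = w powr (3 / 2) * exp (- w / 8) / norm x ^ 3"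
  proof -
    have "w powr (3 / 2) = (norm x)\<^sup>2 powr (3 / 2) / s powr (3 / 2)"
      unfolding w_def by (rule powr_divide)
    also have "\<dots> = (norm x)\<^sup>2 powr (3 / 2) * s powr (- 3 / 2)"
      using powr_minus[of s "3 / 2"] by (simp only: divide_inverse minus_mult_left)
    also have "(norm x)\<^sup>2 powr (3 / 2) = norm x ^ 3"
    proof -
      have "(norm x)\<^sup>2 powr (3 / 2) = (norm x powr 2) powr (3 / 2)" using x by simp
      also have "\<dots> = norm x powr 3" by (simp only: powr_powr) simp
      finally show ?thesis using x by simp
    qed
    finally show ?thesis using x by simp
  qed
  also have "w powr (3 / 2) * exp (- w / 8) \<le> 24 ^ 3 * (1 - exp (- 1 / w))"
  proof -
    have "w powr (3 / 2) \<le> (1 + w) powr (3 / 2)" using w by (intro powr_mono2) auto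
    also have "\<dots> \<le> (1 + w) powr 2" using w by (intro powr_mono) auto
    finally have 1: "w powr (3 / 2) \<le> (1 + w)\<^sup>2" using w by simp
    have "1 + w \<le> 24 * exp (w / 24)" using le_exp_scaled[of 24 w] w by simp
    then have "(1 + w) ^ 3 \<le> (24 * exp (w / 24)) ^ 3" using w by (intro power_mono) auto
    also have "\<dots> = 24 ^ 3 * exp (w / 8)"
      unfolding power_mult_distrib exp_of_nat_mult[symmetric] by simp
    finally have 2: "(1 + w) ^ 3 * exp (- w / 8) \<le> 24 ^ 3"
      by (simp add: exp_minus field_simps)
    have "1 + 1 / w \<le> exp (1 / w)" by (rule exp_ge_add_one_self)
    then have "exp (- 1 / w) \<le> 1 / (1 + 1 / w)"
      using w by (simp add: exp_minus inverse_eq_divide divide_left_mono add_pos_pos)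
    also have "1 / (1 + 1 / w) = 1 - 1 / (1 + w)" using w by (simp add: field_simps)
    finally have 3: "1 / (1 + w) \<le> 1 - exp (- 1 / w)" by simp
    have "w powr (3 / 2) * exp (- w / 8) \<le> (1 + w)\<^sup>2 * exp (- w / 8)" using 1 by (simp add: mult_right_mono)
    also have "\<dots> = ((1 + w) ^ 3 * exp (- w / 8)) * (1 / (1 + w))"
      using w by (simp add: power3_eq_cube power2_eq_square)
    also have "\<dots> \<le> 24 ^ 3 * (1 - exp (- 1 / w))" using 2 3 w by (intro mult_mono) auto
    finally show ?thesis .
  qed
  finally show ?thesis using x s by (simp add: w_def divide_right_mono mult_left_mono)
qed

text \<open>With r = |\<xi>|^2 this represents the factor 1/|\<xi>|^2 of the Leray projector as an
  integral of Gaussians.\<close>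

lemma exp_tail:
  assumes "0 < (r::real)"
  shows "has_bochner_integral lborel (\<lambda>\<sigma>. exp (- \<sigma> * r) * indicator {s..} \<sigma>) (exp (- s * r) / r)"
proof (rule has_bochner_integral_nn_integral)
  have "((\<lambda>\<sigma>. - (exp (- \<sigma> * r) / r)) \<longlongrightarrow> 0) at_top"
    using assms by real_asymp
  then have "(\<integral>\<^sup>+\<sigma>. ennreal (exp (- \<sigma> * r)) * indicator {s..} \<sigma> \<partial>lborel) = ennreal (0 - - (exp (- s * r) / r))"
    by (rule nn_integral_FTC_atLeast[rotated 3]) (use assms in \<open>auto intro!: derivative_eq_intros\<close>)
  then show "(\<integral>\<^sup>+\<sigma>. ennreal (exp (- \<sigma> * r) * indicator {s..} \<sigma>) \<partial>lborel) = ennreal (exp (- s * r) / r)"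
    by (simp add: ennreal_mult ennreal_indicator)
qed (use assms in auto)

text \<open>The integrand has the antiderivative (1/(b \<sigma>) + 1/b^2) exp(-b/\<sigma>), with
  limit 1/b^2 at infinity; the bound is uniform in s.\<close>

lemma cube_tail:
  assumes "0 < b" "0 < s"
  shows "(\<integral>\<^sup>+\<sigma>. ennreal (exp (- b / \<sigma>) / \<sigma> ^ 3) * indicator {s..} \<sigma> \<partial>lborel) \<le> ennreal (1 / b\<^sup>2)"
proof -
  have "((\<lambda>\<sigma>. (1 / (b * \<sigma>) + 1 / b\<^sup>2) * exp (- b / \<sigma>)) \<longlongrightarrow> 1 / b\<^sup>2) at_top"
    using assms by real_asymp
  then have "(\<integral>\<^sup>+\<sigma>. ennreal (exp (- b / \<sigma>) / \<sigma> ^ 3) * indicator {s..} \<sigma> \<partial>lborel)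
      = ennreal (1 / b\<^sup>2 - (1 / (b * s) + 1 / b\<^sup>2) * exp (- b / s))"
  proof (rule nn_integral_FTC_atLeast[rotated 3])
    show "((\<lambda>\<sigma>. (1 / (b * \<sigma>) + 1 / b\<^sup>2) * exp (- b / \<sigma>)) has_real_derivative exp (- b / \<sigma>) / \<sigma> ^ 3) (at \<sigma>)"
      if "s \<le> \<sigma>" for \<sigma>
    proof -
      have \<sigma>: "0 < \<sigma>" using that assms by simp
      have "((\<lambda>\<sigma>. (1 / (b * \<sigma>) + 1 / b\<^sup>2) * exp (- b / \<sigma>)) has_real_derivative
          (- b / (b * \<sigma>)\<^sup>2) * exp (- b / \<sigma>) + (b / \<sigma>\<^sup>2 * exp (- b / \<sigma>)) * (1 / (b * \<sigma>) + 1 / b\<^sup>2)) (at \<sigma>)"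
        using \<sigma> assms by (auto intro!: derivative_eq_intros simp: power2_eq_square field_simps)
      moreover have "(- b / (b * \<sigma>)\<^sup>2) * e + (b / \<sigma>\<^sup>2 * e) * (1 / (b * \<sigma>) + 1 / b\<^sup>2) = e / \<sigma> ^ 3" for e
        using \<sigma> assms by (simp add: power2_eq_square power3_eq_cube field_simps)
      ultimately show ?thesis by simp
    qed
  qed (use assms in auto)
  also have "\<dots> \<le> ennreal (1 / b\<^sup>2)" using assms by (intro ennreal_leI) auto
  finally show ?thesis .
qed

definition oseen_symbol :: "3 \<Rightarrow> 3 \<Rightarrow> 3 \<Rightarrow> real^3 \<Rightarrow> complex" where
  "oseen_symbol j h k \<xi> = \<i> * of_real (\<xi> $ k * ((if j = h then 1 else 0) - \<xi> $ j * \<xi> $ h / (norm \<xi>)\<^sup>2))"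

lemma oseen_symbol_bound: "norm (oseen_symbol j h k \<xi>) \<le> 2 * norm \<xi>"
proof -
  have "\<bar>\<xi> $ j * \<xi> $ h / (norm \<xi>)\<^sup>2\<bar> \<le> 1"
    using component_le_norm_cart[of \<xi> j] component_le_norm_cart[of \<xi> h]
    by (cases "\<xi> = 0") (auto simp: abs_mult power2_eq_square divide_le_eq mult_mono)
  moreover have "\<bar>q\<bar> \<le> 1 \<Longrightarrow> \<bar>(if j = h then 1 else 0) - q\<bar> \<le> 2" for q :: real by auto
  ultimately have "\<bar>(if j = h then 1 else 0) - \<xi> $ j * \<xi> $ h / (norm \<xi>)\<^sup>2\<bar> \<le> 2" by blast
  then have "\<bar>\<xi> $ k\<bar> * \<bar>(if j = h then 1 else 0) - \<xi> $ j * \<xi> $ h / (norm \<xi>)\<^sup>2\<bar> \<le> norm \<xi> * 2"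
    using component_le_norm_cart[of \<xi> k] by (intro mult_mono) auto
  then show ?thesis by (simp add: oseen_symbol_def norm_mult abs_mult mult.commute del: of_real_mult of_real_diff)
qed

lemma prod_power_delta: "(\<Prod>i\<in>UNIV. (\<xi> $ i) ^ of_bool (i = k)) = \<xi> $ k" for \<xi> :: "real^3"
proof -
  have "(\<Prod>i\<in>UNIV. (\<xi> $ i) ^ of_bool (i = k)) = (\<Prod>i\<in>UNIV. if i = k then \<xi> $ i else 1)"
    by (intro prod.cong) auto
  then show ?thesis by simp
qed

lemma sum_of_bool_eq: "(\<Sum>i\<in>UNIV. of_bool (i = (k::3))) = (1::nat)"
  by (simp add: of_bool_def)

text \<open>The symbol is split into its linear part and the part with the cubic monomial over
  |\<xi>|^2. For the latter \<open>exp_tail\<close> and Fubini reduce to cubic Gaussian integrals of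
  size \<sigma>^(-3) exp(-|x|^2/(8 \<sigma>)), integrated over \<sigma> >= s. The constant 320 is 64
  from this part plus 256 from the linear one. The right-hand side has the form of the locale
  \<open>subordination\<close> with \<kappa> = 0 and \<rho> = 1.\<close>

lemma oseen_gauss_bound:
  fixes x :: "real^3"
  assumes s: "0 < s" and x: "x \<noteq> 0"
  shows "norm (osc (oseen_symbol j h k) x (\<lambda>r. exp (- s * r))) \<le> 1024 ^ 3 * 320 / norm x ^ 4 * (1 - 0 * exp (- s * 1))"
proof -
  define M :: "real^3 \<Rightarrow> real" where "M \<xi> = \<xi> $ k * \<xi> $ j * \<xi> $ h" for \<xi>
  define f where "f \<sigma> \<xi> = cis (x \<bullet> \<xi>) * of_real (M \<xi> * exp (- \<sigma> * (norm \<xi>)\<^sup>2)) * indicator {s..} \<sigma>" for \<sigma> \<xi>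
  have f_meas [measurable]: "(\<lambda>(\<sigma>, \<xi>). f \<sigma> \<xi>) \<in> borel_measurable (lborel \<Otimes>\<^sub>M lborel)"
    "(\<lambda>(\<xi>, \<sigma>). f \<sigma> \<xi>) \<in> borel_measurable (lborel \<Otimes>\<^sub>M lborel)"
    unfolding f_def M_def by measurable
  have x0: "0 < norm x" using x by simp
  have M3: "norm (LINT \<xi>|lborel. f \<sigma> \<xi>) \<le> 1024 ^ 3 * (exp (- ((norm x)\<^sup>2 / 8) / \<sigma>) / \<sigma> ^ 3) * indicator {s..} \<sigma>" for \<sigma>
  proof (cases "s \<le> \<sigma>")
    case True
    then have \<sigma>: "0 < \<sigma>" using s by simp
    \<comment> \<open>The multi-index of the monomial M; coinciding indices add up, so its total
      degree is always 3.\<close>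
    define n where "n i = (of_bool (i = k) + of_bool (i = j) + of_bool (i = h) :: nat)" for i :: 3
    have P: "(\<Prod>i\<in>UNIV. (\<xi> $ i) ^ n i) = M \<xi>" for \<xi> :: "real^3"
      by (simp only: n_def power_add prod.distrib prod_power_delta M_def)
    have N: "(\<Sum>i\<in>UNIV. n i) = 3" by (simp only: n_def sum.distrib sum_of_bool_eq)
    have "\<sigma> powr (- (3 + real 3) / 2) = 1 / \<sigma> ^ 3" using \<sigma> by (simp add: powr_minus powr_numeral inverse_eq_divide)
    moreover have "n i \<le> 3" for i by (simp add: n_def)
    ultimately have "norm (LINT \<xi>|lborel. cis (x \<bullet> \<xi>) * of_real (M \<xi> * exp (- \<sigma> * (norm \<xi>)\<^sup>2)))
      \<le> 1024 ^ 3 * (1 / \<sigma> ^ 3) * exp (- (norm x)\<^sup>2 / (8 * \<sigma>))"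
      using gauss3(2)[OF \<sigma>, of n x] unfolding P N by simp
    then show ?thesis using True by (simp add: f_def)
  qed (simp add: f_def)
  have tail: "(LINT \<sigma>|lborel. f \<sigma> \<xi>) = cis (x \<bullet> \<xi>) * of_real (M \<xi> * (exp (- s * (norm \<xi>)\<^sup>2) / (norm \<xi>)\<^sup>2))"
    "(LINT \<sigma>|lborel. norm (f \<sigma> \<xi>)) = \<bar>M \<xi>\<bar> * (exp (- s * (norm \<xi>)\<^sup>2) / (norm \<xi>)\<^sup>2)"
    "integrable lborel (\<lambda>\<sigma>. f \<sigma> \<xi>)" for \<xi>
  proof -
    have "has_bochner_integral lborel (\<lambda>\<sigma>. f \<sigma> \<xi>) (cis (x \<bullet> \<xi>) * of_real (M \<xi> * (exp (- s * (norm \<xi>)\<^sup>2) / (norm \<xi>)\<^sup>2)))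
      \<and> has_bochner_integral lborel (\<lambda>\<sigma>. norm (f \<sigma> \<xi>)) (\<bar>M \<xi>\<bar> * (exp (- s * (norm \<xi>)\<^sup>2) / (norm \<xi>)\<^sup>2))"
    proof (cases "\<xi> = 0")
      case True
      then show ?thesis by (simp add: f_def M_def has_bochner_integral_zero)
    next
      case False
      then have E: "has_bochner_integral lborel (\<lambda>\<sigma>. exp (- \<sigma> * (norm \<xi>)\<^sup>2) * indicator {s..} \<sigma>) (exp (- s * (norm \<xi>)\<^sup>2) / (norm \<xi>)\<^sup>2)"
        by (intro exp_tail) simp
      have "has_bochner_integral lborel (\<lambda>\<sigma>. (cis (x \<bullet> \<xi>) * of_real (M \<xi>)) * of_real (exp (- \<sigma> * (norm \<xi>)\<^sup>2) * indicator {s..} \<sigma>))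
         (cis (x \<bullet> \<xi>) * of_real (M \<xi>) * of_real (exp (- s * (norm \<xi>)\<^sup>2) / (norm \<xi>)\<^sup>2))"
        by (intro has_bochner_integral_mult_right has_bochner_integral_of_real E)
      moreover have "has_bochner_integral lborel (\<lambda>\<sigma>. \<bar>M \<xi>\<bar> * (exp (- \<sigma> * (norm \<xi>)\<^sup>2) * indicator {s..} \<sigma>))
         (\<bar>M \<xi>\<bar> * (exp (- s * (norm \<xi>)\<^sup>2) / (norm \<xi>)\<^sup>2))"
        by (intro has_bochner_integral_mult_right E)
      moreover have "cmod (indicator {s..} \<sigma>) = indicat_real {s..} \<sigma>" for \<sigma> by (simp add: indicator_def)
      ultimately show ?thesis
        by (simp add: f_def norm_mult abs_mult of_real_indicator mult_ac)
    qed
    then show "(LINT \<sigma>|lborel. f \<sigma> \<xi>) = cis (x \<bullet> \<xi>) * of_real (M \<xi> * (exp (- s * (norm \<xi>)\<^sup>2) / (norm \<xi>)\<^sup>2))"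
      "(LINT \<sigma>|lborel. norm (f \<sigma> \<xi>)) = \<bar>M \<xi>\<bar> * (exp (- s * (norm \<xi>)\<^sup>2) / (norm \<xi>)\<^sup>2)"
      "integrable lborel (\<lambda>\<sigma>. f \<sigma> \<xi>)"
      by (auto simp: has_bochner_integral_iff)
  qed
  have dom: "integrable lborel (\<lambda>\<xi>::real^3. (1 + norm \<xi>) * exp (- s * (norm \<xi>)\<^sup>2))"
    using integrable_exp_norm_powr[OF s, of 2] by simp
  have Mle: "\<bar>M \<xi>\<bar> * (exp (- s * (norm \<xi>)\<^sup>2) / (norm \<xi>)\<^sup>2) \<le> (1 + norm \<xi>) * exp (- s * (norm \<xi>)\<^sup>2)" for \<xi>
  proof (cases "\<xi> = 0")
    case False
    have "\<bar>M \<xi>\<bar> \<le> norm \<xi> * norm \<xi> * norm \<xi>"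
      unfolding M_def abs_mult by (intro mult_mono component_le_norm_cart) auto
    also have "\<dots> \<le> (1 + norm \<xi>) * (norm \<xi>)\<^sup>2" by (simp add: power2_eq_square algebra_simps)
    finally have "\<bar>M \<xi>\<bar> / (norm \<xi>)\<^sup>2 \<le> 1 + norm \<xi>" using False by (simp add: divide_le_eq)
    from mult_right_mono[OF this, of "exp (- s * (norm \<xi>)\<^sup>2)"] show ?thesis by simp
  qed simp
  have int_f: "integrable (lborel \<Otimes>\<^sub>M lborel) (\<lambda>(\<xi>, \<sigma>). f \<sigma> \<xi>)"
  proof (rule lborel_pair.Fubini_integrable)
    show "integrable lborel (\<lambda>\<xi>. LINT \<sigma>|lborel. norm (case (\<xi>, \<sigma>) of (\<xi>, \<sigma>) \<Rightarrow> f \<sigma> \<xi>))"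
      unfolding prod.case tail(2)
      by (rule Bochner_Integration.integrable_bound[OF dom]) (use Mle in \<open>auto simp: M_def abs_mult\<close>)
  qed (use tail(3) in auto)
  have int1: "integrable lborel (\<lambda>\<sigma>. LINT \<xi>|lborel. f \<sigma> \<xi>)"
    using lborel_pair.integrable_snd[OF int_f] by simp
  have int2: "integrable lborel (\<lambda>\<xi>. LINT \<sigma>|lborel. f \<sigma> \<xi>)"
    using lborel_pair.integrable_fst[OF int_f] by simp
  have fub: "(LINT \<xi>|lborel. (LINT \<sigma>|lborel. f \<sigma> \<xi>)) = (LINT \<sigma>|lborel. (LINT \<xi>|lborel. f \<sigma> \<xi>))"
    using lborel_pair.Fubini_integral[of "\<lambda>\<xi> \<sigma>. f \<sigma> \<xi>"] int_f by simp
  have "ennreal (norm (LINT \<sigma>|lborel. (LINT \<xi>|lborel. f \<sigma> \<xi>))) \<le> (\<integral>\<^sup>+\<sigma>. norm (LINT \<xi>|lborel. f \<sigma> \<xi>) \<partial>lborel)"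
    by (rule integral_norm_bound_ennreal[OF int1])
  also have "\<dots> \<le> (\<integral>\<^sup>+\<sigma>. ennreal (1024 ^ 3) * (ennreal (exp (- ((norm x)\<^sup>2 / 8) / \<sigma>) / \<sigma> ^ 3) * indicator {s..} \<sigma>) \<partial>lborel)"
  proof (intro nn_integral_mono)
    fix \<sigma> :: real
    show "ennreal (norm (LINT \<xi>|lborel. f \<sigma> \<xi>)) \<le> ennreal (1024 ^ 3) * (ennreal (exp (- ((norm x)\<^sup>2 / 8) / \<sigma>) / \<sigma> ^ 3) * indicator {s..} \<sigma>)"
    proof (cases "s \<le> \<sigma>")
      case True
      then have "ennreal (norm (LINT \<xi>|lborel. f \<sigma> \<xi>)) \<le> ennreal (1024 ^ 3 * (exp (- ((norm x)\<^sup>2 / 8) / \<sigma>) / \<sigma> ^ 3))"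
        using M3[of \<sigma>] by (intro ennreal_leI) simp
      also have "\<dots> = ennreal (1024 ^ 3) * ennreal (exp (- ((norm x)\<^sup>2 / 8) / \<sigma>) / \<sigma> ^ 3)"
        by (rule ennreal_mult) (use s True in auto)
      finally show ?thesis using True by simp
    qed (simp add: f_def)
  qed
  also have "\<dots> = ennreal (1024 ^ 3) * (\<integral>\<^sup>+\<sigma>. ennreal (exp (- ((norm x)\<^sup>2 / 8) / \<sigma>) / \<sigma> ^ 3) * indicator {s..} \<sigma> \<partial>lborel)"
    by (rule nn_integral_cmult) measurable
  also have "\<dots> \<le> ennreal (1024 ^ 3) * ennreal (1 / ((norm x)\<^sup>2 / 8)\<^sup>2)"
    using x s by (intro mult_left_mono cube_tail) auto
  also have "\<dots> = ennreal (1024 ^ 3 * 64 / norm x ^ 4)"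
    by (subst ennreal_mult[symmetric]) (auto simp: power_divide)
  finally have B3: "norm (LINT \<sigma>|lborel. (LINT \<xi>|lborel. f \<sigma> \<xi>)) \<le> 1024 ^ 3 * 64 / norm x ^ 4" by simp
  define e1 where "e1 \<xi> = cis (x \<bullet> \<xi>) * of_real (\<xi> $ k * exp (- s * (norm \<xi>)\<^sup>2))" for \<xi>
  have int3: "integrable lborel e1" and B1: "norm (LINT \<xi>|lborel. e1 \<xi>) \<le> 1024 ^ 3 * 256 / norm x ^ 4"
  proof -
    define n where "n i = (of_bool (i = k) :: nat)" for i :: 3
    have e1: "e1 = (\<lambda>\<xi>. cis (x \<bullet> \<xi>) * of_real ((\<Prod>i\<in>UNIV. (\<xi> $ i) ^ n i) * exp (- s * (norm \<xi>)\<^sup>2)))"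
      by (simp add: e1_def n_def prod_power_delta fun_eq_iff)
    have n3: "n i \<le> 3" for i by (simp add: n_def)
    show "integrable lborel e1" unfolding e1 by (rule gauss3(1)[OF s n3])
    define w where "w = (norm x)\<^sup>2 / s"
    have w: "0 < w" using s x by (simp add: w_def)
    have "norm (LINT \<xi>|lborel. e1 \<xi>) \<le> 1024 ^ 3 * s powr (- (3 + real (\<Sum>i\<in>UNIV. n i)) / 2) * exp (- (norm x)\<^sup>2 / (8 * s))"
      unfolding e1 by (rule gauss3(2)[OF s n3])
    also have "(\<Sum>i\<in>UNIV. n i) = 1" by (simp only: n_def sum_of_bool_eq)
    also have "s powr (- (3 + real 1) / 2) = 1 / s\<^sup>2" using s by (simp add: powr_minus powr_numeral inverse_eq_divide)
    also have "1024 ^ 3 * (1 / s\<^sup>2) * exp (- (norm x)\<^sup>2 / (8 * s)) = 1024 ^ 3 * (w\<^sup>2 * exp (- w / 8)) / norm x ^ 4"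
      using x s by (simp add: w_def power_divide mult.commute[of 8])
    also have "w\<^sup>2 * exp (- w / 8) \<le> 256"
    proof -
      have "w\<^sup>2 \<le> (16 * exp (w / 16))\<^sup>2" using le_exp_scaled[of 16 w] w by (intro power_mono) auto
      also have "\<dots> = 256 * exp (w / 8)" unfolding power_mult_distrib exp_of_nat_mult[symmetric] by simp
      finally show ?thesis by (simp add: exp_minus field_simps)
    qed
    finally show "norm (LINT \<xi>|lborel. e1 \<xi>) \<le> 1024 ^ 3 * 256 / norm x ^ 4" by (simp add: divide_right_mono)
  qed
  have "osc (oseen_symbol j h k) x (\<lambda>r. exp (- s * r))
      = (LINT \<xi>|lborel. \<i> * (of_bool (j = h) * e1 \<xi> - (LINT \<sigma>|lborel. f \<sigma> \<xi>)))"
    unfolding osc_def tail(1)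
    by (intro Bochner_Integration.integral_cong) (auto simp: oseen_symbol_def e1_def M_def algebra_simps of_bool_def)
  also have "\<dots> = \<i> * (of_bool (j = h) * (LINT \<xi>|lborel. e1 \<xi>) - (LINT \<xi>|lborel. (LINT \<sigma>|lborel. f \<sigma> \<xi>)))"
    using int2 int3 by simp
  also have "norm \<dots> \<le> norm (LINT \<xi>|lborel. e1 \<xi>) + norm (LINT \<xi>|lborel. (LINT \<sigma>|lborel. f \<sigma> \<xi>))"
    unfolding norm_mult by (rule order_trans[OF mult_left_mono[OF norm_triangle_ineq4]]) (auto simp: norm_mult)
  also have "\<dots> \<le> 1024 ^ 3 * 256 / norm x ^ 4 + 1024 ^ 3 * 64 / norm x ^ 4"
    unfolding fub by (intro add_mono B1 B3)
  also have "\<dots> = 1024 ^ 3 * 320 / norm x ^ 4" by (simp add: add_divide_distrib[symmetric])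
  finally show ?thesis by simp
qed

section \<open>Uniform bounds for the heat and Oseen kernels\<close>

lemma norm_square_powr: "((norm \<xi>)\<^sup>2) powr \<alpha> = norm \<xi> powr (2 * \<alpha>)" for \<xi> :: "'a::real_normed_vector"
proof (cases "\<xi> = 0")
  case False
  then have "(norm \<xi>)\<^sup>2 = norm \<xi> powr 2" by simp
  then show ?thesis by (simp only: powr_powr)
qed simp

lemma heat_kernel_osc:
  "heat_kernel \<alpha> t z = Re (osc (\<lambda>_. 1) z (\<lambda>r. exp (- t * r powr \<alpha>)) / (2 * of_real pi) ^ 3)"
  unfolding heat_kernel_def kernel_of_symbol_def osc_def
  by (subst integral_completion) (auto simp: norm_square_powr)

lemma oseen_kernel_osc:
  "oseen_kernel \<alpha> t j h k z = Re (osc (oseen_symbol j h k) z (\<lambda>r. exp (- t * r powr \<alpha>)) / (2 * of_real pi) ^ 3)"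
  unfolding oseen_kernel_def kernel_of_symbol_def osc_def
  by (subst integral_completion) (auto simp: norm_square_powr oseen_symbol_def mult.assoc)

lemma measurable_osc [measurable (raw)]:
  assumes [measurable]: "a \<in> borel_measurable borel" "f \<in> borel_measurable M" "g \<in> borel_measurable M"
  shows "(\<lambda>p. osc a (g p) (\<lambda>r. exp (- f p * r powr \<alpha>))) \<in> borel_measurable M"
  unfolding osc_def by measurable

lemma measurable_oseen_symbol [measurable]: "oseen_symbol j h k \<in> borel_measurable borel"
  unfolding oseen_symbol_def[abs_def] by measurable

lemma measurable_heat_kernel [measurable (raw)]:
  assumes [measurable]: "f \<in> borel_measurable M" "g \<in> borel_measurable M"
  shows "(\<lambda>p. heat_kernel \<alpha> (f p) (g p)) \<in> borel_measurable M"
  unfolding heat_kernel_osc by measurable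

lemma measurable_oseen_kernel [measurable (raw)]:
  assumes [measurable]: "f \<in> borel_measurable M" "g \<in> borel_measurable M"
  shows "(\<lambda>p. oseen_kernel \<alpha> (f p) j h k (g p)) \<in> borel_measurable M"
  unfolding oseen_kernel_osc by measurable

lemma Re_divide_2pi_le: "\<bar>Re (z / (2 * of_real pi) ^ 3)\<bar> \<le> norm z"
proof -
  have "\<bar>Re (z / (2 * of_real pi) ^ 3)\<bar> \<le> norm z / (2 * pi) ^ 3"
    using abs_Re_le_cmod[of "z / (2 * of_real pi) ^ 3"] by (simp add: norm_divide norm_power norm_mult)
  also have "\<dots> \<le> norm z / 1" using pi_gt3 by (intro divide_left_mono one_le_power) auto
  finally show ?thesis by simp
qed

text \<open>An oscillatory integral is at most the L^1 norm of its symbol. Scaling \<xi> by R =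
  t^(1/(2 \<alpha>)) removes t; the dimension 3 and the growth order m of the amplitude give the
  power 3 + m. This is the bound for the region |x| <= R.\<close>

lemma osc_crude_bound:
  assumes \<alpha>: "1 / 2 < \<alpha>" and m: "m \<le> 1" and a: "\<And>\<xi>. norm (a \<xi>) \<le> 2 * norm \<xi> ^ m"
    and [measurable]: "a \<in> borel_measurable borel"
  shows "\<exists>C>0. \<forall>t>0. \<forall>x. norm (osc a x (\<lambda>r. exp (- t * r powr \<alpha>))) \<le> C / (t powr (1 / (2 * \<alpha>))) ^ (3 + m)"
proof -
  define G :: "real^3 \<Rightarrow> ennreal" where "G \<xi> = ennreal (norm \<xi> ^ m * exp (- 1 * norm \<xi> powr (2 * \<alpha>)))" for \<xi>
  have [measurable]: "G \<in> borel_measurable borel" unfolding G_def by measurable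
  have "(\<integral>\<^sup>+\<xi>. G \<xi> \<partial>lborel) \<le> (\<integral>\<^sup>+\<xi>. ennreal ((1 + norm \<xi>) * exp (- 1 * norm \<xi> powr (2 * \<alpha>))) \<partial>(lborel :: (real^3) measure))"
    unfolding G_def
  proof (intro nn_integral_mono ennreal_leI mult_right_mono)
    fix \<xi> :: "real^3"
    from m have "m = 0 \<or> m = 1" by auto
    then show "norm \<xi> ^ m \<le> 1 + norm \<xi>" by auto
  qed auto
  also have "\<dots> < \<infinity>"
    using integrable_exp_norm_powr[of 1 "2 * \<alpha>"] \<alpha> by (simp add: integrable_iff_bounded abs_mult less_top[symmetric])
  finally obtain I where I: "(\<integral>\<^sup>+\<xi>. G \<xi> \<partial>lborel) = ennreal I" "0 \<le> I"
    by (cases "\<integral>\<^sup>+\<xi>. G \<xi> \<partial>lborel") auto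
  show ?thesis
  proof (intro exI[of _ "2 * I + 1"] conjI allI impI)
    show "0 < 2 * I + 1" using I by simp
    fix t :: real and x :: "real^3" assume t: "0 < t"
    define R where "R = t powr (1 / (2 * \<alpha>))"
    have R: "0 < R" "R powr (2 * \<alpha>) = t" using t \<alpha> by (auto simp: R_def powr_powr)
    have "ennreal (norm (osc a x (\<lambda>r. exp (- t * r powr \<alpha>))))
       \<le> (\<integral>\<^sup>+\<xi>. norm (cis (x \<bullet> \<xi>) * a \<xi> * of_real (exp (- t * ((norm \<xi>)\<^sup>2) powr \<alpha>))) \<partial>lborel)"
      unfolding osc_def
      by (cases "integrable lborel (\<lambda>\<xi>. cis (x \<bullet> \<xi>) * a \<xi> * of_real (exp (- t * ((norm \<xi>)\<^sup>2) powr \<alpha>)))")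
         (auto intro: integral_norm_bound_ennreal simp: not_integrable_integral_eq)
    also have "\<dots> \<le> (\<integral>\<^sup>+\<xi>. 2 * G (0 + R *\<^sub>R \<xi>) / ennreal (R ^ m) \<partial>lborel)"
    proof (intro nn_integral_mono)
      fix \<xi> :: "real^3"
      have "norm (cis (x \<bullet> \<xi>) * a \<xi> * of_real (exp (- t * ((norm \<xi>)\<^sup>2) powr \<alpha>))) = norm (a \<xi>) * exp (- t * norm \<xi> powr (2 * \<alpha>))"
        by (simp add: norm_mult norm_square_powr)
      also have "\<dots> \<le> 2 * norm \<xi> ^ m * exp (- t * norm \<xi> powr (2 * \<alpha>))"
        by (intro mult_right_mono a) auto
      also have "\<dots> = 2 * (norm (R *\<^sub>R \<xi>) ^ m * exp (- 1 * norm (R *\<^sub>R \<xi>) powr (2 * \<alpha>))) / R ^ m"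
        using R by (simp add: power_mult_distrib powr_mult)
      finally have "ennreal (norm (cis (x \<bullet> \<xi>) * a \<xi> * of_real (exp (- t * ((norm \<xi>)\<^sup>2) powr \<alpha>))))
          \<le> ennreal (2 * (norm (R *\<^sub>R \<xi>) ^ m * exp (- 1 * norm (R *\<^sub>R \<xi>) powr (2 * \<alpha>))) / R ^ m)"
        by (rule ennreal_leI)
      also have "\<dots> = 2 * G (0 + R *\<^sub>R \<xi>) / ennreal (R ^ m)"
        unfolding G_def add_0 using R by (subst divide_ennreal[symmetric]) (auto simp: ennreal_mult)
      finally show "ennreal (norm (cis (x \<bullet> \<xi>) * a \<xi> * of_real (exp (- t * ((norm \<xi>)\<^sup>2) powr \<alpha>))))
        \<le> 2 * G (0 + R *\<^sub>R \<xi>) / ennreal (R ^ m)" .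
    qed
    also have "\<dots> = 2 * (\<integral>\<^sup>+\<xi>. G (0 + R *\<^sub>R \<xi>) \<partial>lborel) / ennreal (R ^ m)"
      by (simp add: nn_integral_divide nn_integral_cmult)
    also have "(\<integral>\<^sup>+\<xi>. G (0 + R *\<^sub>R \<xi>) \<partial>lborel) = ennreal (I / R ^ 3)"
    proof -
      have "ennreal I = ennreal (R ^ 3) * (\<integral>\<^sup>+\<xi>. G (0 + R *\<^sub>R \<xi>) \<partial>lborel)"
        unfolding I(1)[symmetric] using nn_integral_lborel_affine[of G R 0] R by simp
      then have "ennreal (1 / R ^ 3) * ennreal I = (ennreal (1 / R ^ 3) * ennreal (R ^ 3)) * (\<integral>\<^sup>+\<xi>. G (0 + R *\<^sub>R \<xi>) \<partial>lborel)"
        by (simp add: mult.assoc)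
      also have "ennreal (1 / R ^ 3) * ennreal (R ^ 3) = 1"
        using R by (simp add: ennreal_mult[symmetric])
      finally show ?thesis using R I by (simp add: ennreal_mult[symmetric])
    qed
    also have "2 * ennreal (I / R ^ 3) / ennreal (R ^ m) = ennreal (2 * I / R ^ (3 + m))"
    proof -
      have "2 * ennreal (I / R ^ 3) = ennreal (2 * (I / R ^ 3))" using ennreal_mult[of 2 "I / R ^ 3"] R I by simp
      then show ?thesis using R I by (simp add: divide_ennreal power_add)
    qed
    finally have "norm (osc a x (\<lambda>r. exp (- t * r powr \<alpha>))) \<le> 2 * I / R ^ (3 + m)"
      using R I by (simp del: ennreal_le_iff add: ennreal_le_iff)
    also have "\<dots> \<le> (2 * I + 1) / R ^ (3 + m)" using R by (intro divide_right_mono) auto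
    finally show "norm (osc a x (\<lambda>r. exp (- t * r powr \<alpha>))) \<le> (2 * I + 1) / (t powr (1 / (2 * \<alpha>))) ^ (3 + m)"
      by (simp add: R_def)
  qed
qed

text \<open>The larger of R and z is at least (R + z)/2, hence the factor 2^4 = 16.\<close>

lemma combine_decay:
  fixes v R z c1 c2 :: real
  assumes R: "0 < R" and z: "0 \<le> z" and c: "0 \<le> c1" "0 \<le> c2"
    and near: "z \<le> R \<Longrightarrow> v \<le> c1 / R ^ 4" and far: "R < z \<Longrightarrow> v \<le> c2 / z ^ 4"
  shows "v \<le> 16 * (c1 + c2) / (R + z) ^ 4"
proof -
  have *: "c / m ^ 4 \<le> 16 * (c1 + c2) / (R + z) ^ 4" if "0 < m" "R + z \<le> 2 * m" "0 \<le> c" "c \<le> c1 + c2" for c m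
  proof -
    have "(R + z) ^ 4 \<le> (2 * m) ^ 4" using that R z by (intro power_mono) auto
    then have "c * (R + z) ^ 4 \<le> (c1 + c2) * (16 * m ^ 4)"
      using that R z by (intro mult_mono) (auto simp: power_mult_distrib)
    then show ?thesis using that R z by (simp add: field_simps)
  qed
  show ?thesis
  proof (cases "z \<le> R")
    case True then show ?thesis using near *[of R c1] R c by auto
  next
    case False then show ?thesis using far *[of z c2] R c by auto
  qed
qed

theorem oseen_kernel_bound:
  assumes \<alpha>: "1 / 2 < \<alpha>" "\<alpha> \<le> 1"
  shows "\<exists>C>0. \<forall>t>0. \<forall>z j h k. \<bar>oseen_kernel \<alpha> t j h k z\<bar> \<le> C / (t powr (1 / (2 * \<alpha>)) + norm z) ^ 4"
proof -
  have "\<exists>C>0. \<forall>t>0. \<forall>x. norm (osc (oseen_symbol j h k) x (\<lambda>r. exp (- t * r powr \<alpha>))) \<le> C / (t powr (1 / (2 * \<alpha>))) ^ (3 + 1)" for j h k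
    using oseen_symbol_bound by (intro osc_crude_bound \<alpha>) auto
  then obtain c where c: "\<And>j h k. 0 < c j h k"
    "\<And>j h k t x. 0 < t \<Longrightarrow> norm (osc (oseen_symbol j h k) x (\<lambda>r. exp (- t * r powr \<alpha>))) \<le> c j h k / (t powr (1 / (2 * \<alpha>))) ^ 4"
    by simp metis
  \<comment> \<open>The sum of the positive constants dominates each of them, so one constant serves
    all index triples.\<close>
  define c1 where "c1 = (\<Sum>j\<in>UNIV. \<Sum>h\<in>UNIV. \<Sum>k\<in>UNIV. c j h k)"
  have cc: "c j h k \<le> c1" for j h k
  proof -
    have "c j h k \<le> (\<Sum>k\<in>UNIV. c j h k)" using c(1) by (intro member_le_sum) (auto intro: less_imp_le)
    also have "\<dots> \<le> (\<Sum>h\<in>UNIV. \<Sum>k\<in>UNIV. c j h k)"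
      using c(1) by (intro member_le_sum[of h UNIV "\<lambda>h. \<Sum>k\<in>UNIV. c j h k"]) (auto intro!: sum_nonneg intro: less_imp_le)
    also have "\<dots> \<le> c1"
      unfolding c1_def using c(1) by (intro member_le_sum[of j UNIV "\<lambda>j. \<Sum>h\<in>UNIV. \<Sum>k\<in>UNIV. c j h k"]) (auto intro!: sum_nonneg intro: less_imp_le)
    finally show ?thesis .
  qed
  have c10: "0 < c1" using less_le_trans[OF c(1) cc] .
  define c2 :: real where "c2 = 1024 ^ 3 * 320"
  show ?thesis
  proof (intro exI[of _ "16 * (c1 + c2)"] conjI allI impI)
    show "0 < 16 * (c1 + c2)" using c10 by (simp add: c2_def)
    fix t :: real and z :: "real^3" and j h k assume t: "0 < t"
    define R where "R = t powr (1 / (2 * \<alpha>))"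
    have R: "0 < R" using t by (simp add: R_def)
    have le: "\<bar>oseen_kernel \<alpha> t j h k z\<bar> \<le> norm (osc (oseen_symbol j h k) z (\<lambda>r. exp (- t * r powr \<alpha>)))"
      unfolding oseen_kernel_osc by (rule Re_divide_2pi_le)
    show "\<bar>oseen_kernel \<alpha> t j h k z\<bar> \<le> 16 * (c1 + c2) / (t powr (1 / (2 * \<alpha>)) + norm z) ^ 4"
      unfolding R_def[symmetric]
    proof (rule combine_decay[OF R])
      show "\<bar>oseen_kernel \<alpha> t j h k z\<bar> \<le> c1 / R ^ 4"
        using le c(2)[OF t, of j h k z] cc[of j h k] R divide_right_mono[of "c j h k" c1 "R ^ 4"] by (simp add: R_def)
      show "\<bar>oseen_kernel \<alpha> t j h k z\<bar> \<le> c2 / norm z ^ 4" if "R < norm z"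
      proof -
        have z: "z \<noteq> 0" using that R by auto
        interpret subordination "oseen_symbol j h k" z 2 "c2 / norm z ^ 4" 0 1
        proof
          show "norm (oseen_symbol j h k \<xi>) \<le> 2 * (1 + norm \<xi>)" for \<xi>
            using oseen_symbol_bound[of j h k \<xi>] by simp
          show "norm (osc (oseen_symbol j h k) z (\<lambda>r. exp (- s * r))) \<le> c2 / norm z ^ 4 * (1 - 0 * exp (- s * 1))" if "0 < s" for s
            using oseen_gauss_bound[OF that z] by (simp add: c2_def)
        qed (auto simp: c2_def)
        show ?thesis using le subordination_bound[OF \<alpha> t] by simp
      qed
    qed (use c10 in \<open>auto simp: c2_def\<close>)
  qed
qed

theorem heat_kernel_bound:
  assumes \<alpha>: "1 / 2 < \<alpha>" "\<alpha> \<le> 1"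
  shows "\<exists>C>0. \<forall>t>0. \<forall>z. \<bar>heat_kernel \<alpha> t z\<bar> \<le> C * (t powr (1 / (2 * \<alpha>)) / (t powr (1 / (2 * \<alpha>)) + norm z) ^ 4)"
proof -
  have "\<exists>C>0. \<forall>t>0. \<forall>x. norm (osc (\<lambda>_. 1) x (\<lambda>r. exp (- t * r powr \<alpha>))) \<le> C / (t powr (1 / (2 * \<alpha>))) ^ (3 + 0)"
    by (intro osc_crude_bound \<alpha>) auto
  then obtain c1 where c1: "0 < c1"
    "\<And>t x. 0 < t \<Longrightarrow> norm (osc (\<lambda>_. 1) x (\<lambda>r. exp (- t * r powr \<alpha>))) \<le> c1 / (t powr (1 / (2 * \<alpha>))) ^ 3"
    by auto
  define c2 :: real where "c2 = 1024 ^ 3 * 24 ^ 3"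
  show ?thesis
  proof (intro exI[of _ "16 * (c1 + c2)"] conjI allI impI)
    show "0 < 16 * (c1 + c2)" using c1 by (simp add: c2_def)
    fix t :: real and z :: "real^3" assume t: "0 < t"
    define R where "R = t powr (1 / (2 * \<alpha>))"
    have R: "0 < R" "R powr (2 * \<alpha>) = t" using t \<alpha> by (auto simp: R_def powr_powr)
    have le: "\<bar>heat_kernel \<alpha> t z\<bar> \<le> norm (osc (\<lambda>_. 1) z (\<lambda>r. exp (- t * r powr \<alpha>)))"
      unfolding heat_kernel_osc by (rule Re_divide_2pi_le)
    have "\<bar>heat_kernel \<alpha> t z\<bar> \<le> 16 * (c1 * R + c2 * R) / (R + norm z) ^ 4"
    proof (rule combine_decay[OF R(1)])
      have "\<bar>heat_kernel \<alpha> t z\<bar> \<le> c1 / R ^ 3"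
        using le c1(2)[OF t, of z] by (simp add: R_def)
      also have "\<dots> = c1 * R / R ^ 4" using R by (simp add: eval_nat_numeral)
      finally show "\<bar>heat_kernel \<alpha> t z\<bar> \<le> c1 * R / R ^ 4" .
      show "\<bar>heat_kernel \<alpha> t z\<bar> \<le> c2 * R / norm z ^ 4" if "R < norm z"
      proof -
        have z: "z \<noteq> 0" using that R by auto
        interpret subordination "\<lambda>_. 1" z 1 "c2 / norm z ^ 3" 1 "1 / (norm z)\<^sup>2"
        proof
          show "norm (osc (\<lambda>_. 1) z (\<lambda>r. exp (- s * r))) \<le> c2 / norm z ^ 3 * (1 - 1 * exp (- s * (1 / (norm z)\<^sup>2)))" if "0 < s" for s
            using heat_gauss_bound[OF that z] by (simp add: c2_def)
        qed (use z in \<open>auto simp: c2_def\<close>)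
        \<comment> \<open>Since R < |z| and 2 \<alpha> >= 1, the power (R/|z|)^(2 \<alpha>) is at
          most R/|z|. Here the fourth power of |z| is gained for the heat kernel.\<close>
        have "t * (1 / (norm z)\<^sup>2) powr \<alpha> = (R / norm z) powr (2 * \<alpha>)"
          using z R by (simp add: powr_divide norm_square_powr)
        also have "\<dots> \<le> (R / norm z) powr 1"
          using that R \<alpha> by (intro powr_mono') (auto simp: divide_le_eq)
        finally have q: "t * (1 / (norm z)\<^sup>2) powr \<alpha> \<le> R / norm z" using R by simp
        have "1 - exp (- t * (1 / (norm z)\<^sup>2) powr \<alpha>) \<le> t * (1 / (norm z)\<^sup>2) powr \<alpha>"
          using exp_ge_add_one_self[of "- t * (1 / (norm z)\<^sup>2) powr \<alpha>"] by simp
        also note q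
        finally have "c2 / norm z ^ 3 * (1 - exp (- t * (1 / (norm z)\<^sup>2) powr \<alpha>)) \<le> c2 / norm z ^ 3 * (R / norm z)"
          by (intro mult_left_mono) (auto simp: c2_def)
        then show ?thesis using le subordination_bound[OF \<alpha> t] by (simp add: eval_nat_numeral mult.assoc)
      qed
    qed (use c1 R in \<open>auto simp: c2_def\<close>)
    then show "\<bar>heat_kernel \<alpha> t z\<bar> \<le> 16 * (c1 + c2) * (t powr (1 / (2 * \<alpha>)) / (t powr (1 / (2 * \<alpha>)) + norm z) ^ 4)"
      unfolding R_def[symmetric] by (simp add: algebra_simps add_divide_distrib)
  qed
qed

section \<open>Bounds on time slices\<close>

text \<open>The function \<open>kern R\<close> has mass independent of \<open>R\<close> and dominates the heat kernel at time \<open>R\<^sup>2\<^sup>\<alpha>\<close> as well as \<open>R\<close> times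
  the Oseen kernel.\<close>

definition kern :: "real \<Rightarrow> real^3 \<Rightarrow> real" where
  "kern R z = R / (R + norm z) ^ 4"

lemma measurable_kern [measurable (raw)]:
  assumes [measurable]: "f \<in> borel_measurable M" "h \<in> borel_measurable M"
  shows "(\<lambda>x. kern (f x) (h x)) \<in> borel_measurable M"
  unfolding kern_def by measurable

lemma kern_nonneg: "0 \<le> R \<Longrightarrow> 0 \<le> kern R z"
  by (simp add: kern_def)

lemma kern_le: "0 < R \<Longrightarrow> kern R z \<le> 1 / R ^ 3"
proof -
  assume R: "0 < R"
  have "R / (R + norm z) ^ 4 \<le> R / R ^ 4" using R
    by (intro divide_left_mono power_mono mult_pos_pos zero_less_power) (auto intro: add_pos_nonneg)
  also have "\<dots> = 1 / R ^ 3" using R by (simp add: eval_nat_numeral)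
  finally show ?thesis by (simp add: kern_def)
qed

lemma kern_cube: "0 < R \<Longrightarrow> kern R z * norm z ^ 3 \<le> 1"
proof -
  assume R: "0 < R"
  have "R * norm z ^ 3 \<le> (R + norm z) * (R + norm z) ^ 3"
    using R by (intro mult_mono power_mono) auto
  also have "\<dots> = (R + norm z) ^ 4" by (simp add: eval_nat_numeral)
  moreover have "0 < (R + norm z) ^ 4" using R by (intro zero_less_power add_pos_nonneg) auto
  ultimately show ?thesis by (simp add: kern_def divide_le_eq_1_pos)
qed

lemma kern_integral: "\<exists>I\<ge>1. \<forall>R>0. (\<integral>\<^sup>+z. ennreal (kern R z) \<partial>lborel) \<le> ennreal I"
proof -
  obtain I where I: "(\<integral>\<^sup>+x. ennreal (1 / (1 + norm x) ^ 4) \<partial>(lborel :: (real^3) measure)) = ennreal I" "0 \<le> I"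
    using nn_integral_decay by (cases "\<integral>\<^sup>+x. ennreal (1 / (1 + norm x) ^ 4) \<partial>(lborel :: (real^3) measure)") auto
  have "(\<integral>\<^sup>+z. ennreal (kern R z) \<partial>lborel) \<le> ennreal (max 1 I)" if R: "0 < R" for R
  proof -
    have "(\<integral>\<^sup>+z. ennreal (kern R z) \<partial>lborel) = ennreal (R ^ 3) * (\<integral>\<^sup>+z. ennreal (kern R (0 + R *\<^sub>R z)) \<partial>lborel)"
      using nn_integral_lborel_affine[of "\<lambda>z. ennreal (kern R z)" R 0] R by simp
    also have "\<dots> = (\<integral>\<^sup>+z. ennreal (R ^ 3) * ennreal (kern R (0 + R *\<^sub>R z)) \<partial>lborel)"
      by (rule nn_integral_cmult[symmetric]) measurable
    also have "\<dots> = (\<integral>\<^sup>+x. ennreal (1 / (1 + norm x) ^ 4) \<partial>(lborel :: (real^3) measure))"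
    proof (intro nn_integral_cong)
      fix z :: "real^3"
      have e: "R + R * norm z = R * (1 + norm z)" by (simp add: algebra_simps)
      have "R ^ 3 * kern R (R *\<^sub>R z) = 1 / (1 + norm z) ^ 4"
        using R by (simp add: kern_def e power_mult_distrib eval_nat_numeral)
      then show "ennreal (R ^ 3) * ennreal (kern R (0 + R *\<^sub>R z)) = ennreal (1 / (1 + norm z) ^ 4)"
        using R by (simp add: ennreal_mult[symmetric] kern_nonneg)
    qed
    finally show ?thesis by (simp add: I)
  qed
  then show ?thesis by (intro exI[of _ "max 1 I"]) auto
qed

text \<open>The property asserted by \<open>conv_bounded\<close>, with the constant as an argument:
  the variable exponent and the constant exponent can then be handled by one proof with a common
  constant.\<close>

definition conv_bound :: "(real^3 \<Rightarrow> real) \<Rightarrow> real \<Rightarrow> bool" where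
  "conv_bound \<sigma> C \<longleftrightarrow> (\<forall>\<phi> h. \<phi> \<in> borel_measurable borel \<longrightarrow> h \<in> borel_measurable borel \<longrightarrow>
     (\<integral>\<^sup>+x. \<phi> x \<partial>lborel) \<le> 1 \<longrightarrow> (\<forall>z. \<phi> z * ennreal (norm z ^ 3) \<le> 1) \<longrightarrow> (\<forall>y. 0 \<le> h y) \<longrightarrow>
     ebnd \<sigma> 1 (\<lambda>y. ennreal (h y)) \<longrightarrow> ebnd \<sigma> C (\<lambda>x. \<integral>\<^sup>+y. \<phi> (x - y) * ennreal (h y) \<partial>lborel))"

text \<open>The convolution bound is applied to (u/l)^2 and to the kernel divided by I; the square
  belongs to the space with doubled reciprocal exponent.\<close>

lemma conv_square:
  fixes G u :: "real^3 \<Rightarrow> real"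
  assumes B: "conv_bound (\<lambda>x. 2 * G x) C" "0 < C" and G: "\<And>x. 0 \<le> G x"
    and I: "1 \<le> I" "(\<integral>\<^sup>+z. ennreal (kern R z) \<partial>lborel) \<le> ennreal I" and R: "0 < R"
    and [measurable]: "u \<in> borel_measurable borel" and u: "\<And>y. 0 \<le> u y"
    and l: "0 < l" "ebnd G l (\<lambda>y. ennreal (u y))"
  shows "ebnd (\<lambda>x. 2 * G x) (I * C * l\<^sup>2) (\<lambda>x. \<integral>\<^sup>+y. ennreal (kern R (x - y)) * ennreal ((u y)\<^sup>2) \<partial>lborel)"
proof -
  define \<phi> where "\<phi> z = ennreal (1 / I) * ennreal (kern R z)" for z
  have [measurable]: "\<phi> \<in> borel_measurable borel" unfolding \<phi>_def by measurable
  have "(\<integral>\<^sup>+z. \<phi> z \<partial>lborel) = ennreal (1 / I) * (\<integral>\<^sup>+z. ennreal (kern R z) \<partial>lborel)"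
    unfolding \<phi>_def by (rule nn_integral_cmult) measurable
  also have "\<dots> \<le> ennreal (1 / I) * ennreal I" by (intro mult_left_mono I) auto
  also have "\<dots> = 1" using I by (simp add: ennreal_mult[symmetric])
  finally have 1: "(\<integral>\<^sup>+z. \<phi> z \<partial>lborel) \<le> 1" .
  have 2: "\<phi> z * ennreal (norm z ^ 3) \<le> 1" for z
  proof -
    have "\<phi> z * ennreal (norm z ^ 3) = ennreal (1 / I * (kern R z * norm z ^ 3))"
      using I R by (simp add: \<phi>_def ennreal_mult[symmetric] kern_nonneg mult.assoc)
    also have "1 / I * (kern R z * norm z ^ 3) \<le> 1 * 1"
      using I R by (intro mult_mono kern_cube) (auto simp: kern_nonneg)
    finally show ?thesis by (simp add: ennreal_leI)
  qed
  define h where "h y = (u y / l)\<^sup>2" for y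
  have [measurable]: "h \<in> borel_measurable borel" unfolding h_def by measurable
  have "vpow (2 * G y) (ennreal (h y) / ennreal 1) = vpow (G y) (ennreal (u y) / ennreal l)" for y
  proof -
    have "ennreal (h y) / ennreal 1 = (ennreal (u y) / ennreal l) * (ennreal (u y) / ennreal l)"
      using u[of y] l by (simp add: h_def divide_ennreal ennreal_mult[symmetric] power2_eq_square del: ennreal_1)
    then show ?thesis using vpow_square[OF G] by simp
  qed
  then have "ebnd (\<lambda>x. 2 * G x) 1 (\<lambda>y. ennreal (h y))"
    using l(2) by (simp add: ebnd_def del: ennreal_1)
  then have "ebnd (\<lambda>x. 2 * G x) C (\<lambda>x. \<integral>\<^sup>+y. \<phi> (x - y) * ennreal (h y) \<partial>lborel)"
    using 1 2 by (intro B(1)[unfolded conv_bound_def, rule_format]) (auto simp: h_def)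
  then have "ebnd (\<lambda>x. 2 * G x) ((I * l\<^sup>2) * C) (\<lambda>x. ennreal (I * l\<^sup>2) * (\<integral>\<^sup>+y. \<phi> (x - y) * ennreal (h y) \<partial>lborel))"
    using I l B(2) by (intro ebnd_scale) auto
  moreover have "ennreal (I * l\<^sup>2) * (\<integral>\<^sup>+y. \<phi> (x - y) * ennreal (h y) \<partial>lborel) = (\<integral>\<^sup>+y. ennreal (kern R (x - y)) * ennreal ((u y)\<^sup>2) \<partial>lborel)" for x
  proof -
    have "ennreal (I * l\<^sup>2) * (\<phi> (x - y) * ennreal (h y)) = ennreal (kern R (x - y)) * ennreal ((u y)\<^sup>2)" for y
    proof -
      have "ennreal (I * l\<^sup>2) * (\<phi> (x - y) * ennreal (h y)) = ennreal (I * l\<^sup>2 * (1 / I * kern R (x - y) * h y))"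
        using I R by (simp add: \<phi>_def ennreal_mult[symmetric] kern_nonneg h_def)
      also have "I * l\<^sup>2 * (1 / I * kern R (x - y) * h y) = kern R (x - y) * (u y)\<^sup>2"
        using I l by (simp add: h_def power_divide)
      finally show ?thesis using R by (simp add: ennreal_mult kern_nonneg)
    qed
    then show ?thesis by (subst nn_integral_cmult[symmetric]) auto
  qed
  ultimately show ?thesis by (simp add: mult_ac)
qed

text \<open>Jensen's inequality for the power \<nu>/2 with the weight kern/I, which afterwards is
  replaced by the maximum R^(-3) of the kernel. Taking the power 2/\<nu> gives R^(-6/\<nu>), kept as
  a square because the estimate is used under a square root.\<close>

lemma conv_sup:
  fixes u :: "real^3 \<Rightarrow> real"
  assumes \<nu>: "2 \<le> \<nu>" and I: "1 \<le> I" "(\<integral>\<^sup>+z. ennreal (kern R z) \<partial>lborel) \<le> ennreal I" and R: "0 < R"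
    and [measurable]: "u \<in> borel_measurable borel" and u: "\<And>y. 0 \<le> u y"
    and l: "0 < l" "ebnd (\<lambda>_. 1 / \<nu>) l (\<lambda>y. ennreal (u y))"
  shows "(\<integral>\<^sup>+y. ennreal (kern R (x - y)) * ennreal ((u y)\<^sup>2) \<partial>lborel) \<le> ennreal (I * l\<^sup>2 * (R powr (- 3 / \<nu>))\<^sup>2)"
proof -
  define \<phi> where "\<phi> y = ennreal (1 / I * kern R (x - y))" for y
  define w where "w y = ennreal ((u y / l)\<^sup>2)" for y
  have [measurable]: "\<phi> \<in> borel_measurable borel" "w \<in> borel_measurable borel" unfolding \<phi>_def w_def by measurable
  have "(\<integral>\<^sup>+y. \<phi> y \<partial>lborel) = ennreal (1 / I) * (\<integral>\<^sup>+y. ennreal (kern R (x - y)) \<partial>lborel)"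
    unfolding \<phi>_def using I R by (subst nn_integral_cmult[symmetric]) (auto simp: ennreal_mult[symmetric] kern_nonneg)
  also have "\<dots> = ennreal (1 / I) * (\<integral>\<^sup>+y. ennreal (kern R y) \<partial>lborel)"
    by (subst nn_integral_lborel_diff) auto
  also have "\<dots> \<le> ennreal (1 / I) * ennreal I" by (intro mult_left_mono I) auto
  also have "\<dots> = 1" using I by (simp add: ennreal_mult[symmetric])
  finally have \<phi>1: "(\<integral>\<^sup>+y. \<phi> y \<partial>lborel) \<le> 1" .
  define A where "A = (\<integral>\<^sup>+y. \<phi> y * w y \<partial>lborel)"
  have "vpow (2 / \<nu>) A \<le> (\<integral>\<^sup>+y. \<phi> y * vpow (2 / \<nu>) (w y) \<partial>lborel)"
    unfolding A_def using \<nu> \<phi>1 by (intro vpow_Jensen) auto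
  also have "\<dots> \<le> (\<integral>\<^sup>+y. ennreal (1 / R ^ 3) * vpow (1 / \<nu>) (ennreal (u y) / ennreal l) \<partial>lborel)"
  proof (intro nn_integral_mono mult_mono)
    fix y
    have "1 / I * kern R (x - y) \<le> 1 * (1 / R ^ 3)"
      using I R by (intro mult_mono kern_le) (auto simp: kern_nonneg)
    then show "\<phi> y \<le> ennreal (1 / R ^ 3)" by (simp add: \<phi>_def ennreal_leI)
    have "w y = (ennreal (u y) / ennreal l) * (ennreal (u y) / ennreal l)"
      using u[of y] l by (simp add: w_def divide_ennreal ennreal_mult[symmetric] power2_eq_square)
    then show "vpow (2 / \<nu>) (w y) \<le> vpow (1 / \<nu>) (ennreal (u y) / ennreal l)"
      using vpow_square[of "1 / \<nu>"] \<nu> by simp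
  qed auto
  also have "\<dots> = ennreal (1 / R ^ 3) * (\<integral>\<^sup>+y. vpow (1 / \<nu>) (ennreal (u y) / ennreal l) \<partial>lborel)"
    by (rule nn_integral_cmult) measurable
  also have "\<dots> \<le> ennreal (1 / R ^ 3) * 1"
    using l(2) by (intro mult_left_mono) (auto simp: ebnd_def)
  finally have A1: "vpow (2 / \<nu>) A \<le> ennreal (1 / R ^ 3)" by simp
  then have "A \<noteq> top" by (auto simp: top_unique)
  then obtain a where a: "A = ennreal a" "0 \<le> a" by (cases A) auto
  have "a powr (\<nu> / 2) \<le> 1 / R ^ 3" using A1 a \<nu> R by (simp add: vpow_ennreal)
  then have "(a powr (\<nu> / 2)) powr (2 / \<nu>) \<le> (1 / R ^ 3) powr (2 / \<nu>)"
    using \<nu> by (intro powr_mono2) auto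
  also have "(a powr (\<nu> / 2)) powr (2 / \<nu>) = a" using \<nu> a by (simp add: powr_powr)
  also have "(1 / R ^ 3) powr (2 / \<nu>) = (R powr (- 3 / \<nu>))\<^sup>2"
  proof -
    have "1 / R ^ 3 = R powr (- 3)" using R by (simp add: powr_minus powr_numeral inverse_eq_divide)
    then have "(1 / R ^ 3) powr (2 / \<nu>) = R powr (- 3 * (2 / \<nu>))" by (simp only: powr_powr)
    also have "- 3 * (2 / \<nu>) = - 3 / \<nu> + - 3 / \<nu>" by simp
    finally show ?thesis by (simp only: powr_add power2_eq_square)
  qed
  finally have a_le: "a \<le> (R powr (- 3 / \<nu>))\<^sup>2" .
  have "(\<integral>\<^sup>+y. ennreal (kern R (x - y)) * ennreal ((u y)\<^sup>2) \<partial>lborel) = (\<integral>\<^sup>+y. ennreal (I * l\<^sup>2) * (\<phi> y * w y) \<partial>lborel)"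
  proof (intro nn_integral_cong)
    fix y
    have "ennreal (I * l\<^sup>2) * (\<phi> y * w y) = ennreal (I * l\<^sup>2 * (1 / I * kern R (x - y) * (u y / l)\<^sup>2))"
      unfolding \<phi>_def w_def using I R kern_nonneg[of R "x - y"] by (simp add: ennreal_mult[symmetric])
    also have "I * l\<^sup>2 * (1 / I * kern R (x - y) * (u y / l)\<^sup>2) = kern R (x - y) * (u y)\<^sup>2"
      using I l by (simp add: power_divide)
    finally show "ennreal (kern R (x - y)) * ennreal ((u y)\<^sup>2) = ennreal (I * l\<^sup>2) * (\<phi> y * w y)"
      using R by (simp add: ennreal_mult kern_nonneg)
  qed
  also have "\<dots> = ennreal (I * l\<^sup>2) * A" unfolding A_def by (rule nn_integral_cmult) measurable
  also have "\<dots> \<le> ennreal (I * l\<^sup>2 * (R powr (- 3 / \<nu>))\<^sup>2)"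
    using a a_le I l by (simp add: ennreal_mult[symmetric] mult_left_mono)
  finally show ?thesis .
qed

text \<open>The way back from exponent q/2 to q: M bounds a quantity of the size of a square, so N
  is bounded by the root of c M.\<close>

lemma ebnd_sqrt:
  assumes Q: "ebnd (\<lambda>x. 2 * G x) M Q" and G: "\<And>x. 0 \<le> G x" and c: "0 < c" and L: "0 < L" "L\<^sup>2 = c * M" and M: "0 < M"
    and N: "\<And>x. (N x)\<^sup>2 \<le> ennreal c * Q x"
  shows "ebnd G L N"
proof -
  have "vpow (G x) (N x / ennreal L) \<le> vpow (2 * G x) (Q x / ennreal M)" for x
  proof -
    have "(N x / ennreal L) * (N x / ennreal L) = ennreal (1 / L\<^sup>2) * (N x)\<^sup>2"
    proof -
      have "(N x / ennreal L) * (N x / ennreal L) = (ennreal (1 / L) * ennreal (1 / L)) * (N x)\<^sup>2"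
        using L by (simp only: ennreal_divide_real power2_eq_square mult_ac)
      also have "ennreal (1 / L) * ennreal (1 / L) = ennreal (1 / L\<^sup>2)"
        using L by (simp add: ennreal_mult[symmetric] power2_eq_square)
      finally show ?thesis .
    qed
    also have "\<dots> \<le> ennreal (1 / L\<^sup>2) * (ennreal c * Q x)" by (intro mult_left_mono N) auto
    also have "\<dots> = (ennreal (1 / L\<^sup>2) * ennreal c) * Q x" by (simp only: mult.assoc)
    also have "ennreal (1 / L\<^sup>2) * ennreal c = ennreal (1 / M)"
      using c M by (simp add: L(2) ennreal_mult[symmetric])
    also have "ennreal (1 / M) * Q x = Q x / ennreal M" using M by (simp only: ennreal_divide_real)
    finally show ?thesis
      unfolding vpow_square[OF G, of x "N x / ennreal L"] using G by (intro vpow_mono) auto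
  qed
  then have "(\<integral>\<^sup>+x. vpow (G x) (N x / ennreal L) \<partial>lborel) \<le> (\<integral>\<^sup>+x. vpow (2 * G x) (Q x / ennreal M) \<partial>lborel)"
    by (intro nn_integral_mono) auto
  then show ?thesis using Q by (simp add: ebnd_def)
qed

lemma conv_Cauchy_Schwarz:
  fixes u v :: "real^3 \<Rightarrow> real"
  assumes [measurable]: "u \<in> borel_measurable borel" "v \<in> borel_measurable borel"
    and u: "\<And>y. 0 \<le> u y" "\<And>y. 0 \<le> v y" and R: "0 < R"
  shows "(\<integral>\<^sup>+y. ennreal (kern R (x - y) * u y * v y) \<partial>lborel)\<^sup>2
    \<le> (\<integral>\<^sup>+y. ennreal (kern R (x - y)) * ennreal ((u y)\<^sup>2) \<partial>lborel) * (\<integral>\<^sup>+y. ennreal (kern R (x - y)) * ennreal ((v y)\<^sup>2) \<partial>lborel)"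
proof -
  let ?k = "\<lambda>y. sqrt (kern R (x - y))"
  have k: "0 \<le> kern R (x - y)" for y using R by (simp add: kern_nonneg)
  have 1: "ennreal (kern R (x - y) * u y * v y) = ennreal (?k y * u y) * ennreal (?k y * v y)" for y
  proof -
    have "kern R (x - y) * u y * v y = (?k y * ?k y) * u y * v y" using k[of y] by simp
    also have "\<dots> = (?k y * u y) * (?k y * v y)" by (simp only: mult_ac)
    finally show ?thesis using k[of y] u[of y] by (simp only: ennreal_mult mult_nonneg_nonneg real_sqrt_ge_zero)
  qed
  have 2: "ennreal (kern R (x - y)) * ennreal (t\<^sup>2) = (ennreal (?k y * t))\<^sup>2" if "0 \<le> t" for t y
    using k[of y] that by (simp add: ennreal_power ennreal_mult[symmetric] power_mult_distrib)
  show ?thesis unfolding 1 2[OF u(1)] 2[OF u(2)] by (rule Cauchy_Schwarz_nn_integral) measurable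
qed

text \<open>Here g is 1/q; the bound 1/2 expresses q >= 2 and makes 2g the reciprocal of an
  admissible exponent.\<close>

locale variable_exponent =
  fixes g :: "real^3 \<Rightarrow> real" and c gi \<nu> :: real
  assumes g_meas [measurable]: "g \<in> borel_measurable borel"
    and g: "\<And>x. 0 \<le> g x" "\<And>x. g x \<le> 1 / 2" and c: "0 < c"
    and log_Hoelder: "\<And>x y. \<bar>g x - g y\<bar> \<le> c / ln (exp 1 + 1 / norm (x - y))"
    and log_decay: "\<And>x. \<bar>g x - gi\<bar> \<le> c / ln (exp 1 + norm x)"
    and \<nu>: "3 < \<nu>"
begin

definition XB :: "real \<Rightarrow> (real^3 \<Rightarrow> ennreal) \<Rightarrow> bool" where
  "XB l V \<longleftrightarrow> ebnd g l V \<and> ebnd (\<lambda>_. 1 / \<nu>) l V"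

text \<open>By Cauchy--Schwarz, \<open>kern R * (u v) \<le> (kern R * u\<^sup>2)\<^sup>1\<^sup>/\<^sup>2 (kern R * v\<^sup>2)\<^sup>1\<^sup>/\<^sup>2\<close>. The first factor is bounded uniformly through
  the \<open>\<nu>\<close>-norm of \<open>u\<close>, the second in the space with the halved exponent \<open>q/2 \<ge> 1\<close>.\<close>

lemma slice_bounds:
  "\<exists>C\<ge>1. \<forall>R>0. \<forall>u v a b. u \<in> borel_measurable borel \<longrightarrow> v \<in> borel_measurable borel \<longrightarrow>
     (\<forall>y. 0 \<le> u y) \<longrightarrow> (\<forall>y. 0 \<le> v y) \<longrightarrow> 0 < a \<longrightarrow> 0 < b \<longrightarrow> XB a (\<lambda>y. ennreal (u y)) \<longrightarrow> XB b (\<lambda>y. ennreal (v y)) \<longrightarrow>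
       XB (C * a) (\<lambda>x. \<integral>\<^sup>+y. ennreal (kern R (x - y) * u y) \<partial>lborel) \<and>
       XB (C * a * b * R powr (- 3 / \<nu>)) (\<lambda>x. \<integral>\<^sup>+y. ennreal (kern R (x - y) * u y * v y) \<partial>lborel)"
proof -
  have e: "0 < ln (exp 1 + t)" if "0 \<le> t" for t :: real
  proof -
    have "1 < exp (1::real)" by simp
    then show ?thesis using that by (intro ln_gt_zero) linarith
  qed
  have "\<exists>C>0. conv_bound (\<lambda>x. 2 * g x) C"
    unfolding conv_bound_def
  proof (rule conv_bounded[of _ "2 * c" "2 * gi"])
    show "\<bar>2 * g x - 2 * g y\<bar> \<le> 2 * c / ln (exp 1 + 1 / norm (x - y))" for x y
      using log_Hoelder[of x y] by simp
    show "\<bar>2 * g x - 2 * gi\<bar> \<le> 2 * c / ln (exp 1 + norm x)" for x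
      using log_decay[of x] by simp
    show "2 * g x \<le> 1" for x using g(2)[of x] by simp
  qed (use g c in auto)
  then obtain C1 where C1: "0 < C1" "conv_bound (\<lambda>x. 2 * g x) C1" by blast
  \<comment> \<open>A constant exponent is trivially log-Hoelder continuous, so the classical
    L^\<nu> norm is covered by the same theorem.\<close>
  have "\<exists>C>0. conv_bound (\<lambda>x. 2 * (1 / \<nu>)) C"
    unfolding conv_bound_def
    by (rule conv_bounded[of _ 1 "2 * (1 / \<nu>)"]) (use \<nu> e in \<open>auto intro: less_imp_le\<close>)
  then obtain C2 where C2: "0 < C2" "conv_bound (\<lambda>x. 2 * (1 / \<nu>)) C2" by blast
  obtain I where I: "1 \<le> I" "\<And>R. 0 < R \<Longrightarrow> (\<integral>\<^sup>+z. ennreal (kern R z) \<partial>lborel) \<le> ennreal I"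
    using kern_integral by blast
  define C where "C = I * sqrt (max 1 (max C1 C2))"
  have main: "ebnd G (C * a) (\<lambda>x. \<integral>\<^sup>+y. ennreal (kern R (x - y) * u y) \<partial>lborel) \<and>
      ebnd G (C * a * b * R powr (- 3 / \<nu>)) (\<lambda>x. \<integral>\<^sup>+y. ennreal (kern R (x - y) * u y * v y) \<partial>lborel)"
    if R: "0 < R" and [measurable]: "u \<in> borel_measurable borel" "v \<in> borel_measurable borel"
      and u: "\<And>y. 0 \<le> u y" "\<And>y. 0 \<le> v y" and a: "0 < a" "0 < b"
      and Xu: "ebnd G a (\<lambda>y. ennreal (u y))" "ebnd (\<lambda>_. 1 / \<nu>) a (\<lambda>y. ennreal (u y))"
      and Xv: "ebnd G b (\<lambda>y. ennreal (v y))"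
      and G: "\<And>x. 0 \<le> G x" and D: "conv_bound (\<lambda>x. 2 * G x) D" "0 < D" "D \<le> max C1 C2"
    for R u v a b G D
  proof -
    define E where "E = sqrt D * I"
    have E: "0 < E" "E \<le> C"
      using D I by (auto simp: E_def C_def mult.commute intro!: mult_left_mono)
    \<comment> \<open>The linear estimate is Cauchy-Schwarz too, with the constant function 1 as the
      other factor; so it rests on the same bound for the halved exponent.\<close>
    have h1: "ebnd G (E * a) (\<lambda>x. \<integral>\<^sup>+y. ennreal (kern R (x - y) * u y) \<partial>lborel)"
    proof (rule ebnd_sqrt[OF conv_square[OF D(1,2) G I(1) I(2)[OF R] R _ u(1) a(1) Xu(1)] G])
      show "(\<integral>\<^sup>+y. ennreal (kern R (x - y) * u y) \<partial>lborel)\<^sup>2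
          \<le> ennreal I * (\<integral>\<^sup>+y. ennreal (kern R (x - y)) * ennreal ((u y)\<^sup>2) \<partial>lborel)" for x
      proof -
        have "(\<integral>\<^sup>+y. ennreal (kern R (x - y) * 1 * u y) \<partial>lborel)\<^sup>2
          \<le> (\<integral>\<^sup>+y. ennreal (kern R (x - y)) * ennreal (1\<^sup>2) \<partial>lborel) * (\<integral>\<^sup>+y. ennreal (kern R (x - y)) * ennreal ((u y)\<^sup>2) \<partial>lborel)"
          by (rule conv_Cauchy_Schwarz) (use R u in auto)
        also have "(\<integral>\<^sup>+y. ennreal (kern R (x - y)) * ennreal (1\<^sup>2) \<partial>lborel) = (\<integral>\<^sup>+y. ennreal (kern R y) \<partial>lborel)"
          using nn_integral_lborel_diff(1)[of "\<lambda>y. ennreal (kern R y)" x] by simp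
        also have "\<dots> * (\<integral>\<^sup>+y. ennreal (kern R (x - y)) * ennreal ((u y)\<^sup>2) \<partial>lborel)
          \<le> ennreal I * (\<integral>\<^sup>+y. ennreal (kern R (x - y)) * ennreal ((u y)\<^sup>2) \<partial>lborel)"
          by (intro mult_right_mono I R) auto
        finally show ?thesis by simp
      qed
      show "(E * a)\<^sup>2 = I * (I * D * a\<^sup>2)" using D by (simp add: E_def power_mult_distrib power2_eq_square)
    qed (use D I E a in auto)
    have h2: "ebnd G (E * a * b * R powr (- 3 / \<nu>)) (\<lambda>x. \<integral>\<^sup>+y. ennreal (kern R (x - y) * u y * v y) \<partial>lborel)"
    proof (rule ebnd_sqrt[OF conv_square[OF D(1,2) G I(1) I(2)[OF R] R _ u(2) a(2) Xv] G])
      show "(\<integral>\<^sup>+y. ennreal (kern R (x - y) * u y * v y) \<partial>lborel)\<^sup>2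
          \<le> ennreal (I * a\<^sup>2 * (R powr (- 3 / \<nu>))\<^sup>2) * (\<integral>\<^sup>+y. ennreal (kern R (x - y)) * ennreal ((v y)\<^sup>2) \<partial>lborel)" for x
      proof -
        have "(\<integral>\<^sup>+y. ennreal (kern R (x - y) * u y * v y) \<partial>lborel)\<^sup>2
          \<le> (\<integral>\<^sup>+y. ennreal (kern R (x - y)) * ennreal ((u y)\<^sup>2) \<partial>lborel) * (\<integral>\<^sup>+y. ennreal (kern R (x - y)) * ennreal ((v y)\<^sup>2) \<partial>lborel)"
          by (rule conv_Cauchy_Schwarz) (use R u in auto)
        also have "\<dots> \<le> ennreal (I * a\<^sup>2 * (R powr (- 3 / \<nu>))\<^sup>2) * (\<integral>\<^sup>+y. ennreal (kern R (x - y)) * ennreal ((v y)\<^sup>2) \<partial>lborel)"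
          by (intro mult_right_mono conv_sup[OF _ I(1) I(2)[OF R] R _ u(1) a(1) Xu(2)]) (use \<nu> in auto)
        finally show ?thesis .
      qed
      show "(E * a * b * R powr (- 3 / \<nu>))\<^sup>2 = I * a\<^sup>2 * (R powr (- 3 / \<nu>))\<^sup>2 * (I * D * b\<^sup>2)"
        using D by (simp add: E_def power_mult_distrib power2_eq_square)
    qed (use D I E a R in auto)
    have le: "E * a \<le> C * a" "E * a * b * R powr (- 3 / \<nu>) \<le> C * a * b * R powr (- 3 / \<nu>)"
      using E a by (auto intro!: mult_right_mono)
    show ?thesis
      using ebnd_mono[OF h1 _ G _ le(1)] ebnd_mono[OF h2 _ G _ le(2)] E a R by auto
  qed
  have C: "1 \<le> C"
    using mult_mono[of 1 I 1 "sqrt (max 1 (max C1 C2))"] I(1) by (simp add: C_def)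
  show ?thesis
  proof (rule exI[of _ C], intro conjI C allI impI)
    fix R a b :: real and u v :: "real^3 \<Rightarrow> real"
    assume R: "0 < R" and m: "u \<in> borel_measurable borel" "v \<in> borel_measurable borel"
      and uv: "\<forall>y. 0 \<le> u y" "\<forall>y. 0 \<le> v y" and ab: "0 < a" "0 < b"
      and X: "XB a (\<lambda>y. ennreal (u y))" "XB b (\<lambda>y. ennreal (v y))"
    have 1: "ebnd g (C * a) (\<lambda>x. \<integral>\<^sup>+y. ennreal (kern R (x - y) * u y) \<partial>lborel) \<and>
      ebnd g (C * a * b * R powr (- 3 / \<nu>)) (\<lambda>x. \<integral>\<^sup>+y. ennreal (kern R (x - y) * u y * v y) \<partial>lborel)"
      using X uv by (intro main[OF R m _ _ ab _ _ _ _ C1(2,1)]) (auto simp: XB_def g)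
    have 2: "ebnd (\<lambda>_. 1 / \<nu>) (C * a) (\<lambda>x. \<integral>\<^sup>+y. ennreal (kern R (x - y) * u y) \<partial>lborel) \<and>
      ebnd (\<lambda>_. 1 / \<nu>) (C * a * b * R powr (- 3 / \<nu>)) (\<lambda>x. \<integral>\<^sup>+y. ennreal (kern R (x - y) * u y * v y) \<partial>lborel)"
      using X uv \<nu> by (intro main[OF R m _ _ ab _ _ _ _ C2(2,1)]) (auto simp: XB_def)
    show "XB (C * a) (\<lambda>x. \<integral>\<^sup>+y. ennreal (kern R (x - y) * u y) \<partial>lborel)"
      "XB (C * a * b * R powr (- 3 / \<nu>)) (\<lambda>x. \<integral>\<^sup>+y. ennreal (kern R (x - y) * u y * v y) \<partial>lborel)"
      using 1 2 by (auto simp: XB_def)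
  qed
qed

lemma g_le_1: "g x \<le> 1" using g(2)[of x] by linarith

lemma XB_mono:
  assumes "XB l W" "AE x in lborel. V x \<le> W x" "0 < l" "l \<le> m"
  shows "XB m V"
  using assms \<nu> g(1) unfolding XB_def by (auto intro: ebnd_mono)

lemma XB_0: "XB l (\<lambda>_. 0)"
  by (simp add: XB_def ebnd_def)

lemma XB_scale: "XB l V \<Longrightarrow> 0 < l \<Longrightarrow> 0 < k \<Longrightarrow> XB (k * l) (\<lambda>x. ennreal k * V x)"
  unfolding XB_def by (auto intro: ebnd_scale)

lemma XB_finite: "XB l V \<Longrightarrow> V \<in> borel_measurable borel \<Longrightarrow> AE x in lborel. V x < \<infinity>"
  unfolding XB_def by (auto intro: ebnd_finite[OF _ g_meas, simplified])

lemma XB_zero: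
  assumes "\<And>n. XB (\<epsilon> n) V" "\<epsilon> \<longlonglongrightarrow> 0" "\<And>n. 0 < \<epsilon> n" "V \<in> borel_measurable borel"
  shows "AE x in lborel. V x = 0"
  by (rule ebnd_zero[of g \<epsilon>]) (use assms g(1) g_le_1 in \<open>auto simp: XB_def\<close>)

lemma XB_Minkowski:
  fixes W :: "'s \<Rightarrow> real^3 \<Rightarrow> ennreal"
  assumes M: "sigma_finite_measure M" "(\<lambda>(s, x). W s x) \<in> borel_measurable (M \<Otimes>\<^sub>M borel)" "N \<in> borel_measurable M"
    and AE: "AE s in M. (\<forall>x. W s x = 0) \<or> 0 < N s \<and> XB (N s) (W s)"
    and L: "(\<integral>\<^sup>+s. ennreal (N s) \<partial>M) \<le> ennreal L" "0 < L"
  shows "XB L (\<lambda>x. \<integral>\<^sup>+s. W s x \<partial>M)"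
  unfolding XB_def
proof
  show "ebnd g L (\<lambda>x. \<integral>\<^sup>+s. W s x \<partial>M)"
    by (rule ebnd_Minkowski[OF M g_meas g(1) g_le_1 _ L]) (use AE in \<open>auto simp: XB_def elim: eventually_mono\<close>)
  show "ebnd (\<lambda>_. 1 / \<nu>) L (\<lambda>x. \<integral>\<^sup>+s. W s x \<partial>M)"
    by (rule ebnd_Minkowski[OF M _ _ _ _ L]) (use AE \<nu> in \<open>auto simp: XB_def elim: eventually_mono\<close>)
qed

text \<open>Minkowski's inequality for counting measure on the naturals; \<open>XB_add\<close> is
  the case of two points.\<close>

lemma XB_suminf:
  assumes [measurable]: "\<And>n. V n \<in> borel_measurable borel" and V: "\<And>n. XB (a n) (V n)"
    and a: "\<And>n. 0 < a n" "a sums L"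
  shows "XB L (\<lambda>x. \<Sum>n. V n x)"
proof -
  have "XB L (\<lambda>x. \<integral>\<^sup>+n. V n x \<partial>count_space (UNIV :: nat set))"
  proof (rule XB_Minkowski)
    show "sigma_finite_measure (count_space (UNIV :: nat set))"
      by (rule sigma_finite_measure_count_space_countable) simp
    show "(\<lambda>(n, x). V n x) \<in> borel_measurable (count_space UNIV \<Otimes>\<^sub>M borel)"
      by (rule measurable_pair_measure_countable1) auto
    show "(\<integral>\<^sup>+n. ennreal (a n) \<partial>count_space UNIV) \<le> ennreal L"
      using a sums_unique[OF a(2)] by (simp add: nn_integral_count_space_nat suminf_ennreal_eq less_imp_le)
    show "0 < L" using a suminf_pos[of a] by (simp add: sums_iff)
  qed (use V a in auto)
  then show ?thesis by (simp add: nn_integral_count_space_nat)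
qed

lemma XB_add:
  assumes [measurable]: "V \<in> borel_measurable borel" "W \<in> borel_measurable borel"
    and V: "XB a V" "0 < a" "XB b W" "0 < b"
  shows "XB (a + b) (\<lambda>x. V x + W x)"
proof -
  have "XB (a + b) (\<lambda>x. \<integral>\<^sup>+n. (if n then V x else W x) \<partial>count_space (UNIV :: bool set))"
  proof (rule XB_Minkowski[where N = "\<lambda>n. if n then a else b"])
    show "sigma_finite_measure (count_space (UNIV :: bool set))"
      by (rule sigma_finite_measure_count_space_countable) simp
    show "(\<lambda>(n, x). if n then V x else W x) \<in> borel_measurable (count_space UNIV \<Otimes>\<^sub>M borel)"
      by (rule measurable_pair_measure_countable1) (auto simp: V)
    show "(\<integral>\<^sup>+n. ennreal (if n then a else b) \<partial>count_space UNIV) \<le> ennreal (a + b)"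
      using V by (simp add: nn_integral_count_space_finite UNIV_bool add.commute)
  qed (use V in auto)
  then show ?thesis by (simp add: nn_integral_count_space_finite UNIV_bool add.commute)
qed

end

section \<open>The integral operators\<close>

lemma nn_integral_powr_0:
  assumes "-1 < e" "0 \<le> t"
  shows "(\<integral>\<^sup>+s. ennreal ((t - s) powr e) * indicator {0<..<t} s \<partial>lborel) \<le> ennreal (t powr (e + 1) / (e + 1))"
proof -
  have "(\<integral>\<^sup>+s. ennreal ((t - s) powr e) * indicator {0<..<t} s \<partial>lborel)
      \<le> (\<integral>\<^sup>+s. ennreal ((t - s) powr e * indicator {0..t} (t - s)) \<partial>lborel)"
    by (intro nn_integral_mono) (auto split: split_indicator)
  also have "\<dots> = (\<integral>\<^sup>+s. ennreal (s powr e * indicator {0..t} s) \<partial>lborel)"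
    by (rule nn_integral_lborel_diff(1)[of "\<lambda>s. ennreal (s powr e * indicator {0..t} s)" t]) measurable
  also have "\<dots> = ennreal (t powr (e + 1) / (e + 1))"
  proof (rule nn_integral_has_integral_lborel)
    show "((\<lambda>s. s powr e * indicator {0..t} s) has_integral t powr (e + 1) / (e + 1)) UNIV"
    proof -
      have "(\<lambda>s. s powr e * indicator {0..t} s) = (\<lambda>s. if s \<in> {0..t} then s powr e else 0)"
        by (auto split: split_indicator)
      then show ?thesis using has_integral_powr_from_0[OF assms] by (simp only: has_integral_restrict_UNIV)
    qed
  qed auto
  finally show ?thesis .
qed

text \<open>Young's inequality for the conjugate exponents r/(r - 2) and r/2, without constants:
  according to whether x <= y^(r - 2), one of the two terms alone dominates.\<close>

lemma mult_le_powr_add: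
  fixes x y r :: real
  assumes "0 \<le> x" "0 \<le> y" "2 < r"
  shows "x * y\<^sup>2 \<le> x powr (1 / (1 - 2 / r)) + y powr r"
proof (cases "x \<le> y powr (r - 2)")
  case True
  have "x * y\<^sup>2 \<le> y powr (r - 2) * y\<^sup>2" using True by (intro mult_right_mono) auto
  also have "\<dots> = y powr r"
  proof (cases "y = 0")
    case False
    then have "y\<^sup>2 = y powr 2" using assms by simp
    then show ?thesis by (simp only: powr_add[symmetric]) simp
  qed simp
  finally show ?thesis by (simp add: add_increasing)
next
  case False
  then have x: "0 < x" using powr_ge_zero[of y "r - 2"] by linarith
  have "(y powr (r - 2)) powr (2 / (r - 2)) \<le> x powr (2 / (r - 2))"
    using False assms by (intro powr_mono2) auto
  moreover have "(r - 2) * (2 / (r - 2)) = 2" using assms by (subst times_divide_eq_right, subst nonzero_mult_div_cancel_left) auto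
  ultimately have y2: "y powr 2 \<le> x powr (2 / (r - 2))" by (simp only: powr_powr)
  have "x * y\<^sup>2 \<le> x powr 1 * x powr (2 / (r - 2))" using y2 x assms by (intro mult_mono) auto
  also have "\<dots> = x powr (1 / (1 - 2 / r))"
    unfolding powr_add[symmetric] using assms by (intro arg_cong[where f = "\<lambda>e. x powr e"]) (simp add: field_simps)
  finally show ?thesis by (simp add: add_increasing2)
qed

text \<open>The number r will be a constant lower bound for the time exponent, and
  \<open>rate\<close> makes the singular time integrals converge against it. The other new
  assumptions fix the constants of the slice and kernel estimates.\<close>

locale mild = variable_exponent +
  fixes \<alpha> r C CH CO :: real
  assumes \<alpha>: "1 / 2 < \<alpha>" "\<alpha> \<le> 1" and r: "2 < r" and rate: "(1 + 3 / \<nu>) / (2 * \<alpha>) < 1 - 2 / r"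
    and C: "1 \<le> C" and CH: "0 < CH" and CO: "0 < CO"
    and slice: "\<And>R u v a b. 0 < R \<Longrightarrow> u \<in> borel_measurable borel \<Longrightarrow> v \<in> borel_measurable borel \<Longrightarrow>
      (\<And>y. 0 \<le> u y) \<Longrightarrow> (\<And>y. 0 \<le> v y) \<Longrightarrow> 0 < a \<Longrightarrow> 0 < b \<Longrightarrow> XB a (\<lambda>y. ennreal (u y)) \<Longrightarrow> XB b (\<lambda>y. ennreal (v y)) \<Longrightarrow>
       XB (C * a) (\<lambda>x. \<integral>\<^sup>+y. ennreal (kern R (x - y) * u y) \<partial>lborel) \<and>
       XB (C * a * b * R powr (- 3 / \<nu>)) (\<lambda>x. \<integral>\<^sup>+y. ennreal (kern R (x - y) * u y * v y) \<partial>lborel)"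
    and heat: "\<And>t z. 0 < t \<Longrightarrow> \<bar>heat_kernel \<alpha> t z\<bar> \<le> CH * kern (t powr (1 / (2 * \<alpha>))) z"
    and oseen: "\<And>t z j h k. 0 < t \<Longrightarrow> \<bar>oseen_kernel \<alpha> t j h k z\<bar> \<le> CO * (kern (t powr (1 / (2 * \<alpha>))) z / t powr (1 / (2 * \<alpha>)))"
begin

definition \<gamma> :: real where "\<gamma> = (1 + 3 / \<nu>) / (2 * \<alpha>)"
definition R :: "real \<Rightarrow> real" where "R t = t powr (1 / (2 * \<alpha>))"
text \<open>27 counts the index triples: the norm is bounded by the sum over j, and each component
  is a sum over h and k.\<close>

definition KB :: real where "KB = 27 * CO"

lemma \<gamma>: "0 < \<gamma>" "\<gamma> < 1" "\<gamma> < 1 - 2 / r"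
proof -
  have "0 < 1 + 3 / \<nu>" using \<nu> by (simp add: add_pos_pos)
  then show "0 < \<gamma>" using \<alpha> by (simp add: \<gamma>_def)
  show "\<gamma> < 1 - 2 / r" using rate by (simp add: \<gamma>_def)
  moreover have "0 < 2 / r" using r by simp
  ultimately show "\<gamma> < 1" by linarith
qed

lemma KB: "0 < KB" using CO by (simp add: KB_def)

lemma R_pos: "0 < t \<Longrightarrow> 0 < R t" by (simp add: R_def)
lemma R_nonneg: "0 \<le> R t" by (simp add: R_def)

lemma measurable_R [measurable (raw)]: "f \<in> borel_measurable M \<Longrightarrow> (\<lambda>x. R (f x)) \<in> borel_measurable M"
  unfolding R_def by measurable

text \<open>The factor 1/R(t) comes from the derivative in the Oseen kernel, the factor
  R(t)^(-3/\<nu>) from the uniform bound on one of the two velocities.\<close>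

lemma R_rate: "0 < t \<Longrightarrow> 1 / R t * R t powr (- 3 / \<nu>) = t powr (- \<gamma>)"
proof -
  assume t: "0 < t"
  have "1 / R t = t powr (- (1 / (2 * \<alpha>)))" by (simp add: R_def powr_minus inverse_eq_divide)
  moreover have "R t powr (- 3 / \<nu>) = t powr (1 / (2 * \<alpha>) * (- 3 / \<nu>))" by (simp only: R_def powr_powr)
  moreover have "- (1 / (2 * \<alpha>)) + 1 / (2 * \<alpha>) * (- 3 / \<nu>) = - \<gamma>" by (simp add: \<gamma>_def add_divide_distrib)
  ultimately show ?thesis by (simp only: powr_add[symmetric])
qed

text \<open>Contracted with two separate vectors, although the equation has the same vector twice:
  the polarised form gives access to differences of quadratic terms (\<open>K_diff\<close>).\<close>

definition K :: "real \<Rightarrow> real^3 \<Rightarrow> real^3 \<Rightarrow> real^3 \<Rightarrow> real^3" where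
  "K t z a b = (\<chi> j. \<Sum>h\<in>UNIV. \<Sum>k\<in>UNIV. oseen_kernel \<alpha> t j h k z * (a $ h * b $ k))"

lemma norm_K_le:
  assumes "0 < t"
  shows "norm (K t z a b) \<le> KB * (kern (R t) z / R t) * (norm a * norm b)"
proof -
  define e where "e = kern (R t) z / R t"
  have e: "0 \<le> e" using R_nonneg by (simp add: e_def kern_nonneg)
  have o: "\<bar>oseen_kernel \<alpha> t j h k z\<bar> \<le> CO * e" for j h k
    using oseen[OF assms] by (simp add: e_def R_def)
  have "\<bar>K t z a b $ j\<bar> \<le> (\<Sum>h\<in>(UNIV::3 set). \<Sum>k\<in>(UNIV::3 set). CO * e * (norm a * norm b))" for j
  proof -
    have "\<bar>K t z a b $ j\<bar> \<le> (\<Sum>h\<in>UNIV. \<bar>\<Sum>k\<in>UNIV. oseen_kernel \<alpha> t j h k z * (a $ h * b $ k)\<bar>)"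
      by (simp add: K_def)
    also have "\<dots> \<le> (\<Sum>h\<in>(UNIV::3 set). \<Sum>k\<in>(UNIV::3 set). CO * e * (norm a * norm b))"
    proof (intro sum_mono)
      fix h :: 3
      have "\<bar>\<Sum>k\<in>UNIV. oseen_kernel \<alpha> t j h k z * (a $ h * b $ k)\<bar> \<le> (\<Sum>k\<in>UNIV. \<bar>oseen_kernel \<alpha> t j h k z * (a $ h * b $ k)\<bar>)"
        by (rule sum_abs)
      also have "\<dots> \<le> (\<Sum>k\<in>(UNIV::3 set). CO * e * (norm a * norm b))"
        unfolding abs_mult
        by (intro sum_mono mult_mono component_le_norm_cart o) (use e CO in auto)
      finally show "\<bar>\<Sum>k\<in>UNIV. oseen_kernel \<alpha> t j h k z * (a $ h * b $ k)\<bar> \<le> (\<Sum>k\<in>(UNIV::3 set). CO * e * (norm a * norm b))" .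
    qed
    finally show ?thesis .
  qed
  then have "\<bar>K t z a b $ j\<bar> \<le> 9 * (CO * e * (norm a * norm b))" for j
    by simp
  then have "(\<Sum>j\<in>UNIV. \<bar>K t z a b $ j\<bar>) \<le> (\<Sum>j\<in>(UNIV::3 set). 9 * (CO * e * (norm a * norm b)))"
    by (intro sum_mono)
  with norm_le_l1_cart[of "K t z a b"] have "norm (K t z a b) \<le> 27 * (CO * e * (norm a * norm b))"
    by simp
  then show ?thesis by (simp add: KB_def e_def mult.assoc)
qed

lemma measurable_K [measurable (raw)]:
  assumes [measurable]: "f \<in> borel_measurable M" "z \<in> borel_measurable M" "a \<in> borel_measurable M" "b \<in> borel_measurable M"
  shows "(\<lambda>x. K (f x) (z x) (a x) (b x)) \<in> borel_measurable M"
proof -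
  have "K (f x) (z x) (a x) (b x) = (\<Sum>j\<in>UNIV. (\<Sum>h\<in>UNIV. \<Sum>k\<in>UNIV. oseen_kernel \<alpha> (f x) j h k (z x) * (a x $ h * b x $ k)) *\<^sub>R axis j 1)" for x
    by (auto simp: K_def vec_eq_iff axis_def if_distrib cong: if_cong)
  then show ?thesis by (simp only:) measurable
qed

lemma K_diff: "K t z a a - K t z b b = K t z (a - b) a + K t z b (a - b)"
  by (simp add: K_def vec_eq_iff sum.distrib[symmetric] sum_subtractf[symmetric] algebra_simps)

text \<open>Majorants with absolute values inside the integrals; their finiteness is the absolute convergence demanded of a
  mild solution.\<close>

definition bmaj :: "(real \<times> (real^3) \<Rightarrow> real^3) \<Rightarrow> (real \<times> (real^3) \<Rightarrow> real^3) \<Rightarrow> real \<Rightarrow> real^3 \<Rightarrow> ennreal" where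
  "bmaj U V t x = (\<integral>\<^sup>+p. ennreal (KB * (kern (R (t - fst p)) (x - snd p) / R (t - fst p)) * (norm (U p) * norm (V p)))
      * indicator {0<..<t} (fst p) \<partial>lborel)"

text \<open>A single integral over space-time rather than an iterated one: a finite
  \<open>bmaj\<close> then implies integrability (\<open>integrable_bop\<close>), and
  \<open>iterated_integral\<close> recovers the iterated form. Fields are functions of pairs so that
  measurability is joint.\<close>

definition bop :: "(real \<times> (real^3) \<Rightarrow> real^3) \<Rightarrow> (real \<times> (real^3) \<Rightarrow> real^3) \<Rightarrow> real \<times> (real^3) \<Rightarrow> real^3" where
  "bop U V z = (LINT p|lborel. indicator {0<..<fst z} (fst p) *\<^sub>R K (fst z - fst p) (snd z - snd p) (U p) (V p))"

definition lmaj :: "(real^3 \<Rightarrow> real^3) \<Rightarrow> (real \<times> (real^3) \<Rightarrow> real^3) \<Rightarrow> real \<Rightarrow> real^3 \<Rightarrow> ennreal" where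
  "lmaj U0 F t x = (\<integral>\<^sup>+y. ennreal (CH * kern (R t) (x - y) * norm (U0 y)) \<partial>lborel)
     + (\<integral>\<^sup>+p. ennreal (CH * kern (R (t - fst p)) (x - snd p) * norm (F p)) * indicator {0<..<t} (fst p) \<partial>lborel)"

definition lin :: "(real^3 \<Rightarrow> real^3) \<Rightarrow> (real \<times> (real^3) \<Rightarrow> real^3) \<Rightarrow> real \<times> (real^3) \<Rightarrow> real^3" where
  "lin U0 F z = (LINT y|lborel. heat_kernel \<alpha> (fst z) (snd z - y) *\<^sub>R U0 y)
     + (LINT p|lborel. indicator {0<..<fst z} (fst p) *\<^sub>R heat_kernel \<alpha> (fst z - fst p) (snd z - snd p) *\<^sub>R F p)"

lemma ind_measurable [measurable (raw)]:
  assumes [measurable]: "f \<in> borel_measurable M" "h \<in> borel_measurable M"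
  shows "(\<lambda>x. indicator {0<..<(f x :: real)} (h x) :: real) \<in> borel_measurable M"
    "(\<lambda>x. indicator {0<..<(f x :: real)} (h x) :: ennreal) \<in> borel_measurable M"
proof -
  have e: "indicator {0<..<f x} (h x) = (if 0 < h x \<and> h x < f x then 1 else (0::'b::zero_neq_one))" for x
    by (auto simp: indicator_def)
  show "(\<lambda>x. indicator {0<..<(f x :: real)} (h x) :: real) \<in> borel_measurable M"
    "(\<lambda>x. indicator {0<..<(f x :: real)} (h x) :: ennreal) \<in> borel_measurable M"
    unfolding e by measurable
qed

lemma lborel_pairs: "(lborel :: (real \<times> (real^3)) measure) = lborel \<Otimes>\<^sub>M lborel"
  by (rule lborel_prod[symmetric])

lemma borel_pair_measurable:
  fixes F :: "real \<times> (real^3) \<Rightarrow> 'b::topological_space"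
  shows "F \<in> borel_measurable borel \<longleftrightarrow> F \<in> borel_measurable (borel \<Otimes>\<^sub>M borel)"
  by (simp add: borel_prod)

lemma measurable_bmaj [measurable (raw)]:
  assumes [measurable]: "U \<in> borel_measurable borel" "V \<in> borel_measurable borel" "f \<in> borel_measurable M" "z \<in> borel_measurable M"
  shows "(\<lambda>x. bmaj U V (f x) (z x)) \<in> borel_measurable M"
proof -
  have [measurable]: "U \<in> borel_measurable (borel \<Otimes>\<^sub>M borel)" "V \<in> borel_measurable (borel \<Otimes>\<^sub>M borel)"
    using assms(1,2) by (simp_all add: borel_prod)
  show ?thesis unfolding bmaj_def lborel_pairs by measurable
qed

lemma measurable_lmaj [measurable (raw)]:
  assumes [measurable]: "U0 \<in> borel_measurable borel" "F \<in> borel_measurable borel" "f \<in> borel_measurable M" "z \<in> borel_measurable M"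
  shows "(\<lambda>x. lmaj U0 F (f x) (z x)) \<in> borel_measurable M"
proof -
  have [measurable]: "F \<in> borel_measurable (borel \<Otimes>\<^sub>M borel)" using assms(2) by (simp add: borel_prod)
  show ?thesis unfolding lmaj_def lborel_pairs by measurable
qed

lemma measurable_bop [measurable]:
  assumes "U \<in> borel_measurable borel" "V \<in> borel_measurable borel"
  shows "bop U V \<in> borel_measurable borel"
proof -
  have [measurable]: "U \<in> borel_measurable (borel \<Otimes>\<^sub>M borel)" "V \<in> borel_measurable (borel \<Otimes>\<^sub>M borel)"
    using assms by (simp_all add: borel_prod)
  show ?thesis unfolding bop_def[abs_def] lborel_pairs borel_pair_measurable by measurable
qed

lemma measurable_lin [measurable]:
  assumes [measurable]: "U0 \<in> borel_measurable borel" and F: "F \<in> borel_measurable borel"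
  shows "lin U0 F \<in> borel_measurable borel"
proof -
  have [measurable]: "F \<in> borel_measurable (borel \<Otimes>\<^sub>M borel)" using F by (simp add: borel_prod)
  show ?thesis unfolding lin_def[abs_def] lborel_pairs borel_pair_measurable by measurable
qed

lemma norm_K_ind:
  "ennreal (norm (indicator {0<..<t} s *\<^sub>R K (t - s) z a b))
    \<le> ennreal (KB * (kern (R (t - s)) z / R (t - s)) * (norm a * norm b)) * indicator {0<..<t} s"
proof (cases "s \<in> {0<..<t}")
  case True
  then show ?thesis using ennreal_leI[OF norm_K_le[of "t - s" z a b]] by simp
qed simp

lemma integrable_bop:
  assumes [measurable]: "U \<in> borel_measurable borel" "V \<in> borel_measurable borel" and fin: "bmaj U V t x < \<infinity>"
  shows "integrable lborel (\<lambda>p. indicator {0<..<t} (fst p) *\<^sub>R K (t - fst p) (x - snd p) (U p) (V p))"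
proof -
  have [measurable]: "U \<in> borel_measurable (borel \<Otimes>\<^sub>M borel)" "V \<in> borel_measurable (borel \<Otimes>\<^sub>M borel)"
    using assms by (simp_all add: borel_prod)
  show ?thesis
  proof (rule integrableI_bounded)
    show "(\<lambda>p. indicator {0<..<t} (fst p) *\<^sub>R K (t - fst p) (x - snd p) (U p) (V p)) \<in> borel_measurable lborel"
      unfolding lborel_pairs by measurable
    have "(\<integral>\<^sup>+p. ennreal (norm (indicator {0<..<t} (fst p) *\<^sub>R K (t - fst p) (x - snd p) (U p) (V p))) \<partial>lborel) \<le> bmaj U V t x"
      unfolding bmaj_def
      by (intro nn_integral_mono norm_K_ind)
    then show "(\<integral>\<^sup>+p. ennreal (norm (indicator {0<..<t} (fst p) *\<^sub>R K (t - fst p) (x - snd p) (U p) (V p))) \<partial>lborel) < \<infinity>"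
      using fin by (rule le_less_trans)
  qed
qed

text \<open>If f is not integrable, its Bochner integral is 0 and the bound is trivial; so the
  pointwise majorant alone suffices.\<close>

lemma norm_integral_le:
  fixes f :: "'x \<Rightarrow> real^3"
  assumes "\<And>p. p \<in> space M \<Longrightarrow> ennreal (norm (f p)) \<le> w p"
  shows "ennreal (norm (LINT p|M. f p)) \<le> (\<integral>\<^sup>+p. w p \<partial>M)"
proof (cases "integrable M f")
  case True
  then have "ennreal (norm (LINT p|M. f p)) \<le> (\<integral>\<^sup>+p. norm (f p) \<partial>M)" by (rule integral_norm_bound_ennreal)
  also have "\<dots> \<le> (\<integral>\<^sup>+p. w p \<partial>M)" using assms by (rule nn_integral_mono)
  finally show ?thesis .
qed (simp add: not_integrable_integral_eq)

lemma bmaj_integrand_measurable [measurable]: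
  assumes "U \<in> borel_measurable borel" "V \<in> borel_measurable borel"
  shows "(\<lambda>p. ennreal (KB * (kern (R (t - fst p)) (x - snd p) / R (t - fst p)) * (norm (U p) * norm (V p)))
      * indicator {0<..<t} (fst p)) \<in> borel_measurable lborel"
proof -
  have [measurable]: "U \<in> borel_measurable (borel \<Otimes>\<^sub>M borel)" "V \<in> borel_measurable (borel \<Otimes>\<^sub>M borel)"
    using assms by (simp_all add: borel_prod)
  show ?thesis unfolding lborel_pairs by measurable
qed

lemma norm_bop_le: "ennreal (norm (bop U V (t, x))) \<le> bmaj U V t x"
  unfolding bop_def bmaj_def
  unfolding fst_conv snd_conv by (rule norm_integral_le) (rule norm_K_ind)

lemma norm_lin_le:
  assumes "0 < t"
  shows "ennreal (norm (lin U0 F (t, x))) \<le> lmaj U0 F t x"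
proof -
  have "ennreal (norm (lin U0 F (t, x))) \<le> ennreal (norm (LINT y|lborel. heat_kernel \<alpha> t (x - y) *\<^sub>R U0 y))
     + ennreal (norm (LINT p|lborel. indicator {0<..<t} (fst p) *\<^sub>R heat_kernel \<alpha> (t - fst p) (x - snd p) *\<^sub>R F p))"
    unfolding lin_def by (simp add: ennreal_plus[symmetric] ennreal_leI norm_triangle_ineq del: ennreal_plus)
  also have "\<dots> \<le> lmaj U0 F t x"
    unfolding lmaj_def
    by (intro add_mono norm_integral_le)
       (use heat assms in \<open>auto simp: R_def split: split_indicator intro!: ennreal_leI mult_right_mono\<close>)
  finally show ?thesis .
qed

text \<open>Finite majorants allow the two integrals to be merged into one; then
  \<open>K_diff\<close> leaves one factor U - V in each of two terms.\<close>

lemma norm_bop_diff: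
  assumes [measurable]: "U \<in> borel_measurable borel" "V \<in> borel_measurable borel"
    and fin: "bmaj U U t x < \<infinity>" "bmaj V V t x < \<infinity>"
  shows "ennreal (norm (bop U U (t, x) - bop V V (t, x))) \<le> bmaj (\<lambda>p. U p - V p) U t x + bmaj V (\<lambda>p. U p - V p) t x"
proof -
  have eq: "bop U U (t, x) - bop V V (t, x) = (LINT p|lborel. indicator {0<..<t} (fst p) *\<^sub>R K (t - fst p) (x - snd p) (U p) (U p)
      - indicator {0<..<t} (fst p) *\<^sub>R K (t - fst p) (x - snd p) (V p) (V p))"
    unfolding bop_def using integrable_bop[OF _ _ fin(1)] integrable_bop[OF _ _ fin(2)]
    by simp
  have "ennreal (norm (bop U U (t, x) - bop V V (t, x))) \<le> (\<integral>\<^sup>+p. (ennreal (KB * (kern (R (t - fst p)) (x - snd p) / R (t - fst p)) * (norm (U p - V p) * norm (U p))) * indicator {0<..<t} (fst p)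
      + ennreal (KB * (kern (R (t - fst p)) (x - snd p) / R (t - fst p)) * (norm (V p) * norm (U p - V p))) * indicator {0<..<t} (fst p)) \<partial>lborel)"
    unfolding eq
  proof (rule norm_integral_le)
    fix p :: "real \<times> (real^3)"
    show "ennreal (norm (indicator {0<..<t} (fst p) *\<^sub>R K (t - fst p) (x - snd p) (U p) (U p)
      - indicator {0<..<t} (fst p) *\<^sub>R K (t - fst p) (x - snd p) (V p) (V p)))
      \<le> ennreal (KB * (kern (R (t - fst p)) (x - snd p) / R (t - fst p)) * (norm (U p - V p) * norm (U p))) * indicator {0<..<t} (fst p)
      + ennreal (KB * (kern (R (t - fst p)) (x - snd p) / R (t - fst p)) * (norm (V p) * norm (U p - V p))) * indicator {0<..<t} (fst p)"
    proof (cases "fst p \<in> {0<..<t}")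
      case True
      then have "norm (K (t - fst p) (x - snd p) (U p) (U p) - K (t - fst p) (x - snd p) (V p) (V p))
        \<le> KB * (kern (R (t - fst p)) (x - snd p) / R (t - fst p)) * (norm (U p - V p) * norm (U p))
        + KB * (kern (R (t - fst p)) (x - snd p) / R (t - fst p)) * (norm (V p) * norm (U p - V p))"
        unfolding K_diff by (intro order_trans[OF norm_triangle_ineq] add_mono norm_K_le) auto
      from ennreal_leI[OF this] show ?thesis
        using True KB R_nonneg by (subst (asm) ennreal_plus) (auto intro!: mult_nonneg_nonneg simp: kern_nonneg)
    qed simp
  qed
  also have "\<dots> = bmaj (\<lambda>p. U p - V p) U t x + bmaj V (\<lambda>p. U p - V p) t x"
  proof -
    have D: "(\<lambda>p. U p - V p) \<in> borel_measurable borel" using assms(1,2) by (rule borel_measurable_diff)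
    show ?thesis
      unfolding bmaj_def
      by (rule nn_integral_add[OF bmaj_integrand_measurable[OF D assms(1)] bmaj_integrand_measurable[OF assms(2) D]])
  qed
  finally show ?thesis .
qed

section \<open>Estimates of the majorants in X\<close>

abbreviation nm :: "(real \<times> (real^3) \<Rightarrow> real^3) \<Rightarrow> real \<Rightarrow> real^3 \<Rightarrow> ennreal" where
  "nm U t \<equiv> (\<lambda>x. ennreal (norm (U (t, x))))"

lemma slice_measurable [measurable]:
  "U \<in> borel_measurable borel \<Longrightarrow> (\<lambda>x. U (t, x)) \<in> borel_measurable borel" for U :: "real \<times> (real^3) \<Rightarrow> 'b::topological_space"
  by (rule measurable_compose[where N = borel, OF borel_measurable_continuous_onI]) (auto intro!: continuous_intros)

text \<open>At fixed s the slice estimate bounds the spatial integral in X by KB C (t -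
  s)^(-\<gamma>) a(s) b(s), and Minkowski's inequality integrates these bounds over s. The bounds a
  and b depend on time to serve both functions in L^r of time and exponential weights.\<close>

lemma XB_bmaj:
  assumes U [measurable]: "U \<in> borel_measurable borel" "V \<in> borel_measurable borel"
    and ab [measurable]: "a \<in> borel_measurable borel" "b \<in> borel_measurable borel"
    and AE: "AE s in lborel. 0 < s \<longrightarrow> s < t \<longrightarrow> 0 < a s \<and> XB (a s) (nm U s) \<and> 0 < b s \<and> XB (b s) (nm V s)"
    and L: "(\<integral>\<^sup>+s. ennreal (KB * C * (t - s) powr (- \<gamma>) * a s * b s) * indicator {0<..<t} s \<partial>lborel) \<le> ennreal L" "0 < L"
  shows "XB L (bmaj U V t)"
proof -
  define W where "W s x = (\<integral>\<^sup>+y. ennreal (KB * (kern (R (t - s)) (x - y) / R (t - s)) * (norm (U (s, y)) * norm (V (s, y))))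
      * indicator {0<..<t} s \<partial>lborel)" for s x
  have W: "bmaj U V t = (\<lambda>x. \<integral>\<^sup>+s. W s x \<partial>lborel)"
  proof
    fix x
    have "(\<lambda>p. ennreal (KB * (kern (R (t - fst p)) (x - snd p) / R (t - fst p)) * (norm (U p) * norm (V p)))
      * indicator {0<..<t} (fst p)) \<in> borel_measurable (lborel \<Otimes>\<^sub>M lborel)"
      using bmaj_integrand_measurable[OF U, of t x] unfolding lborel_pairs .
    from lborel.nn_integral_fst[OF this] show "bmaj U V t x = (\<integral>\<^sup>+s. W s x \<partial>lborel)"
      unfolding bmaj_def lborel_pairs W_def by simp
  qed
  have [measurable]: "U \<in> borel_measurable (borel \<Otimes>\<^sub>M borel)" "V \<in> borel_measurable (borel \<Otimes>\<^sub>M borel)"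
    using U by (simp_all add: borel_prod)
  show ?thesis unfolding W
  proof (rule XB_Minkowski[where N = "\<lambda>s. KB * C * (t - s) powr (- \<gamma>) * a s * b s * indicator {0<..<t} s"])
    show "sigma_finite_measure (lborel :: real measure)" ..
    show "(\<lambda>(s, x). W s x) \<in> borel_measurable (lborel \<Otimes>\<^sub>M borel)"
      unfolding W_def by measurable
    show "AE s in lborel. (\<forall>x. W s x = 0) \<or> 0 < KB * C * (t - s) powr (- \<gamma>) * a s * b s * indicator {0<..<t} s
      \<and> XB (KB * C * (t - s) powr (- \<gamma>) * a s * b s * indicator {0<..<t} s) (W s)"
      using AE
    proof eventually_elim
      case (elim s)
      show ?case
      proof (cases "s \<in> {0<..<t}")
        case True
        then have e: "0 < a s" "XB (a s) (nm U s)" "0 < b s" "XB (b s) (nm V s)" using elim by auto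
        define \<tau> where "\<tau> = t - s"
        have \<tau>: "0 < \<tau>" using True by (simp add: \<tau>_def)
        have "XB (KB / R \<tau> * (C * a s * b s * R \<tau> powr (- 3 / \<nu>)))
          (\<lambda>x. ennreal (KB / R \<tau>) * (\<integral>\<^sup>+y. ennreal (kern (R \<tau>) (x - y) * norm (U (s, y)) * norm (V (s, y))) \<partial>lborel))"
          using slice[OF R_pos[OF \<tau>], of "\<lambda>y. norm (U (s, y))" "\<lambda>y. norm (V (s, y))"] e C KB R_pos[OF \<tau>]
          by (intro XB_scale) auto
        also have "KB / R \<tau> * (C * a s * b s * R \<tau> powr (- 3 / \<nu>)) = KB * C * (1 / R \<tau> * R \<tau> powr (- 3 / \<nu>)) * a s * b s"
          by simp
        also have "\<dots> = KB * C * (t - s) powr (- \<gamma>) * a s * b s" unfolding R_rate[OF \<tau>] by (simp add: \<tau>_def)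
        also have "(\<lambda>x. ennreal (KB / R \<tau>) * (\<integral>\<^sup>+y. ennreal (kern (R \<tau>) (x - y) * norm (U (s, y)) * norm (V (s, y))) \<partial>lborel)) = W s"
        proof
          fix x
          have "ennreal (KB / R \<tau>) * ennreal (kern (R \<tau>) (x - y) * norm (U (s, y)) * norm (V (s, y)))
            = ennreal (KB * (kern (R \<tau>) (x - y) / R \<tau>) * (norm (U (s, y)) * norm (V (s, y))))" for y
            using KB R_pos[OF \<tau>] by (subst ennreal_mult[symmetric]) (auto simp: kern_nonneg)
          then show "ennreal (KB / R \<tau>) * (\<integral>\<^sup>+y. ennreal (kern (R \<tau>) (x - y) * norm (U (s, y)) * norm (V (s, y))) \<partial>lborel) = W s x"
            using True unfolding W_def \<tau>_def[symmetric] by (subst nn_integral_cmult[symmetric]) auto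
        qed
        finally show ?thesis using True e KB C by (simp add: \<tau>_def)
      qed (simp add: W_def)
    qed
    have "ennreal (KB * C * (t - s) powr (- \<gamma>) * a s * b s * indicator {0<..<t} s)
      = ennreal (KB * C * (t - s) powr (- \<gamma>) * a s * b s) * indicator {0<..<t} s" for s
      by (simp split: split_indicator)
    then show "(\<integral>\<^sup>+s. ennreal (KB * C * (t - s) powr (- \<gamma>) * a s * b s * indicator {0<..<t} s) \<partial>lborel) \<le> ennreal L"
      using L by simp
  qed (use L in measurable)
qed

text \<open>Convolution with the heat kernel is bounded on X uniformly in time, with no singular
  power of t - s; so a force that is merely integrable in time contributes a bound independent of
  t.\<close>

lemma XB_lmaj:
  assumes U0 [measurable]: "U0 \<in> borel_measurable borel" and F [measurable]: "F \<in> borel_measurable borel"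
    and n [measurable]: "n \<in> borel_measurable borel"
    and l0: "0 < l0" "XB l0 (\<lambda>x. ennreal (norm (U0 x)))"
    and AE: "AE s in lborel. 0 < s \<longrightarrow> s < 1 \<longrightarrow> 0 < n s \<and> XB (n s) (nm F s)"
    and L: "(\<integral>\<^sup>+s. ennreal (n s) * indicator {0<..<1} s \<partial>lborel) \<le> ennreal L" "0 < L"
    and t: "0 < t" "t \<le> 1"
  shows "XB (CH * C * (l0 + L)) (lmaj U0 F t)"
proof -
  have Fm: "(\<lambda>p. ennreal (CH * kern (R (t - fst p)) (x - snd p) * norm (F p)) * indicator {0<..<t} (fst p)) \<in> borel_measurable (lborel \<Otimes>\<^sub>M lborel)" for x
  proof -
    have [measurable]: "F \<in> borel_measurable (borel \<Otimes>\<^sub>M borel)" using F by (simp add: borel_prod)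
    show ?thesis by measurable
  qed
  define W where "W s x = (\<integral>\<^sup>+y. ennreal (CH * kern (R (t - s)) (x - y) * norm (F (s, y))) * indicator {0<..<t} s \<partial>lborel)" for s x
  have W: "(\<integral>\<^sup>+p. ennreal (CH * kern (R (t - fst p)) (x - snd p) * norm (F p)) * indicator {0<..<t} (fst p) \<partial>lborel)
      = (\<integral>\<^sup>+s. W s x \<partial>lborel)" for x
    using lborel.nn_integral_fst[OF Fm[of x]] unfolding lborel_pairs W_def by simp
  have [measurable]: "F \<in> borel_measurable (borel \<Otimes>\<^sub>M borel)" using F by (simp add: borel_prod)
  have Wm [measurable]: "(\<lambda>(s, x). W s x) \<in> borel_measurable (lborel \<Otimes>\<^sub>M borel)"
    unfolding W_def by measurable
  have lin1: "XB (CH * (C * l)) (\<lambda>x. \<integral>\<^sup>+y. ennreal (CH * kern (R \<tau>) (x - y) * norm (u y)) \<partial>lborel)"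
    if \<tau>: "0 < \<tau>" and l: "0 < l" "XB l (\<lambda>x. ennreal (norm (u x)))" and [measurable]: "u \<in> borel_measurable borel"
    for \<tau> l and u :: "real^3 \<Rightarrow> real^3"
  proof -
    have "XB (CH * (C * l)) (\<lambda>x. ennreal CH * (\<integral>\<^sup>+y. ennreal (kern (R \<tau>) (x - y) * norm (u y)) \<partial>lborel))"
      using slice[OF R_pos[OF \<tau>], of "\<lambda>y. norm (u y)" "\<lambda>y. norm (u y)" l l] l C CH by (intro XB_scale) auto
    moreover have "ennreal CH * (\<integral>\<^sup>+y. ennreal (kern (R \<tau>) (x - y) * norm (u y)) \<partial>lborel)
        = (\<integral>\<^sup>+y. ennreal (CH * kern (R \<tau>) (x - y) * norm (u y)) \<partial>lborel)" for x
      using CH R_pos[OF \<tau>]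
      by (subst nn_integral_cmult[symmetric]) (auto simp: ennreal_mult[symmetric] kern_nonneg mult.assoc)
    ultimately show ?thesis by simp
  qed
  have "XB (CH * (C * L)) (\<lambda>x. \<integral>\<^sup>+s. W s x \<partial>lborel)"
  proof (rule XB_Minkowski[where N = "\<lambda>s. CH * (C * n s) * indicator {0<..<t} s"])
    show "sigma_finite_measure (lborel :: real measure)" ..
    show "AE s in lborel. (\<forall>x. W s x = 0) \<or> 0 < CH * (C * n s) * indicator {0<..<t} s
      \<and> XB (CH * (C * n s) * indicator {0<..<t} s) (W s)"
      using AE
    proof eventually_elim
      case (elim s)
      show ?case
      proof (cases "s \<in> {0<..<t}")
        case True
        then have e: "0 < n s" "XB (n s) (nm F s)" using elim t by auto
        have "XB (CH * (C * n s)) (\<lambda>x. \<integral>\<^sup>+y. ennreal (CH * kern (R (t - s)) (x - y) * norm (F (s, y))) \<partial>lborel)"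
          using True e by (intro lin1) auto
        then show ?thesis using True e CH C by (simp add: W_def[abs_def])
      qed (simp add: W_def)
    qed
    have "(\<integral>\<^sup>+s. ennreal (CH * (C * n s) * indicator {0<..<t} s) \<partial>lborel)
        \<le> (\<integral>\<^sup>+s. ennreal (CH * C) * (ennreal (n s) * indicator {0<..<1} s) \<partial>lborel)"
      using t CH C by (intro nn_integral_mono)
        (auto split: split_indicator simp: ennreal_mult' mult.assoc)
    also have "\<dots> = ennreal (CH * C) * (\<integral>\<^sup>+s. ennreal (n s) * indicator {0<..<1} s \<partial>lborel)"
      by (rule nn_integral_cmult) measurable
    also have "\<dots> \<le> ennreal (CH * C) * ennreal L" by (intro mult_left_mono L) auto
    finally show "(\<integral>\<^sup>+s. ennreal (CH * (C * n s) * indicator {0<..<t} s) \<partial>lborel) \<le> ennreal (CH * (C * L))"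
      using CH C L by (simp add: ennreal_mult[symmetric] mult.assoc)
    show "0 < CH * (C * L)" using CH C L by simp
  qed measurable
  then have "XB (CH * (C * l0) + CH * (C * L)) (\<lambda>x. (\<integral>\<^sup>+y. ennreal (CH * kern (R t) (x - y) * norm (U0 y)) \<partial>lborel) + (\<integral>\<^sup>+s. W s x \<partial>lborel))"
    using lin1[OF t(1) l0 U0] CH C l0 L by (intro XB_add) auto
  then show ?thesis unfolding lmaj_def W by (simp add: algebra_simps)
qed

text \<open>KB C times the integral of s^(-\<gamma>) over (0,T), the bound of the bilinear term on
  functions bounded in time. It tends to 0 with T because \<gamma> < 1.\<close>

definition \<kappa> :: "real \<Rightarrow> real" where "\<kappa> T = KB * C * (T powr (1 - \<gamma>) / (1 - \<gamma>))"

lemma XB_bmaj_const: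
  assumes U [measurable]: "U \<in> borel_measurable borel" "V \<in> borel_measurable borel"
    and ab: "0 < a" "0 < b" and X: "\<And>s. 0 < s \<Longrightarrow> s < T \<Longrightarrow> XB a (nm U s)" "\<And>s. 0 < s \<Longrightarrow> s < T \<Longrightarrow> XB b (nm V s)"
    and t: "0 < t" "t < T"
  shows "XB (\<kappa> T * a * b) (bmaj U V t)"
proof (rule XB_bmaj[OF U, of "\<lambda>_. a" "\<lambda>_. b"])
  show "0 < \<kappa> T * a * b" using t ab KB C \<gamma> by (simp add: \<kappa>_def)
  have "(\<integral>\<^sup>+s. ennreal (KB * C * (t - s) powr (- \<gamma>) * a * b) * indicator {0<..<t} s \<partial>lborel)
      = (\<integral>\<^sup>+s. ennreal (KB * C * a * b) * (ennreal ((t - s) powr (- \<gamma>)) * indicator {0<..<t} s) \<partial>lborel)"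
  proof (intro nn_integral_cong)
    fix s
    have "KB * C * (t - s) powr (- \<gamma>) * a * b = KB * C * a * b * (t - s) powr (- \<gamma>)" by simp
    then show "ennreal (KB * C * (t - s) powr (- \<gamma>) * a * b) * indicator {0<..<t} s
      = ennreal (KB * C * a * b) * (ennreal ((t - s) powr (- \<gamma>)) * indicator {0<..<t} s)"
      using KB C ab by (simp only: ennreal_mult powr_ge_zero mult_nonneg_nonneg less_imp_le mult.assoc)
  qed
  also have "\<dots> = ennreal (KB * C * a * b) * (\<integral>\<^sup>+s. ennreal ((t - s) powr (- \<gamma>)) * indicator {0<..<t} s \<partial>lborel)"
    by (rule nn_integral_cmult) measurable
  also have "\<dots> \<le> ennreal (KB * C * a * b) * ennreal (t powr (- \<gamma> + 1) / (- \<gamma> + 1))"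
    using \<gamma> t by (intro mult_left_mono nn_integral_powr_0) auto
  also have "\<dots> = ennreal (KB * C * a * b * (t powr (1 - \<gamma>) / (1 - \<gamma>)))"
    using KB C ab \<gamma> by (subst ennreal_mult[symmetric]) (auto simp: add.commute)
  also have "\<dots> \<le> ennreal (\<kappa> T * a * b)"
  proof (rule ennreal_leI)
    have "t powr (1 - \<gamma>) / (1 - \<gamma>) \<le> T powr (1 - \<gamma>) / (1 - \<gamma>)"
      using t \<gamma> by (intro divide_right_mono powr_mono2) auto
    then have "KB * C * a * b * (t powr (1 - \<gamma>) / (1 - \<gamma>)) \<le> KB * C * a * b * (T powr (1 - \<gamma>) / (1 - \<gamma>))"
      using KB C ab by (intro mult_left_mono) auto
    then show "KB * C * a * b * (t powr (1 - \<gamma>) / (1 - \<gamma>)) \<le> \<kappa> T * a * b" by (simp add: \<kappa>_def mult_ac)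
  qed
  finally show "(\<integral>\<^sup>+s. ennreal (KB * C * (t - s) powr (- \<gamma>) * a * b) * indicator {0<..<t} s \<partial>lborel) \<le> ennreal (\<kappa> T * a * b)" .
qed (use ab X t in auto)

section \<open>Existence and uniqueness for the integral equation\<close>

lemma geometric_half_sums: "(\<lambda>k. a * (1 / 2) ^ (n + k)) sums (2 * a * (1 / 2) ^ n)" for a :: real
proof -
  have "(\<lambda>k. (a * (1 / 2) ^ n) * (1 / 2) ^ k) sums ((a * (1 / 2) ^ n) * 2)"
    using geometric_sums[of "1 / 2 :: real"] by (intro sums_mult) simp
  then show ?thesis by (simp add: power_add mult_ac)
qed

lemma bmaj_slice_measurable:
  assumes [measurable]: "U \<in> borel_measurable borel" "V \<in> borel_measurable borel"
  shows "bmaj U V t \<in> borel_measurable borel"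
  by measurable

text \<open>Picard iteration in the ball of radius 2 A0. With 8 \<kappa> A0 <= 1 the bilinear term
  on the ball is at most 4 \<kappa> A0^2 <= A0/2, and the difference of two images gains the factor
  4 \<kappa> A0 <= 1/2. The estimates hold for every t in (0,T), so exceptional null sets occur only
  in x.\<close>

lemma local_existence:
  assumes [measurable]: "U0 \<in> borel_measurable borel" and F [measurable]: "F \<in> borel_measurable borel"
    and A0: "0 < A0" "\<And>t. 0 < t \<Longrightarrow> t \<le> 1 \<Longrightarrow> XB A0 (lmaj U0 F t)"
    and T: "0 < T" "T \<le> 1" "8 * \<kappa> T * A0 \<le> 1"
  shows "\<exists>U \<in> borel_measurable borel. \<forall>t. 0 < t \<longrightarrow> t < T \<longrightarrow> XB (2 * A0) (nm U t) \<and>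
     (AE x in lborel. U (t, x) = lin U0 F (t, x) - bop U U (t, x))"
proof -
  have \<kappa>: "0 < \<kappa> T" using T KB C \<gamma> by (simp add: \<kappa>_def)
  define P where "P = rec_nat (\<lambda>_. 0) (\<lambda>_ U z. lin U0 F z - bop U U z)"
  have P0: "P 0 = (\<lambda>_. 0)" and PS: "P (Suc n) = (\<lambda>z. lin U0 F z - bop (P n) (P n) z)" for n
    by (simp_all add: P_def)
  have Pm [measurable]: "P n \<in> borel_measurable borel" for n
  proof (induction n)
    case 0 then show ?case by (simp add: P0)
  next
    case (Suc n)
    then show ?case unfolding PS by (intro borel_measurable_diff measurable_lin measurable_bop F) auto
  qed
  have bound: "XB (2 * A0) (nm (P n) t)" if t: "0 < t" "t < T" for n t
    using t
  proof (induction n arbitrary: t)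
    case 0 then show ?case by (simp add: P0 XB_0)
  next
    case (Suc n)
    have X: "XB (\<kappa> T * (2 * A0) * (2 * A0)) (bmaj (P n) (P n) t)"
      using Suc A0 by (intro XB_bmaj_const) auto
    have "XB (A0 + \<kappa> T * (2 * A0) * (2 * A0)) (\<lambda>x. lmaj U0 F t x + bmaj (P n) (P n) t x)"
      using Suc T A0 X \<kappa> by (intro XB_add) auto
    then show ?case
    proof (rule XB_mono)
      show "AE x in lborel. nm (P (Suc n)) t x \<le> lmaj U0 F t x + bmaj (P n) (P n) t x"
      proof (rule AE_I2)
        fix x
        have "nm (P (Suc n)) t x \<le> ennreal (norm (lin U0 F (t, x)) + norm (bop (P n) (P n) (t, x)))"
          unfolding PS by (intro ennreal_leI norm_triangle_ineq4)
        also have "\<dots> \<le> lmaj U0 F t x + bmaj (P n) (P n) t x"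
          using Suc norm_bop_le norm_lin_le by (simp add: add_mono)
        finally show "nm (P (Suc n)) t x \<le> lmaj U0 F t x + bmaj (P n) (P n) t x" .
      qed
      define m where "m = \<kappa> T * A0 * A0"
      have "8 * \<kappa> T * A0 * A0 \<le> 1 * A0" using T A0 by (intro mult_right_mono) auto
      then have "8 * m \<le> A0" by (simp add: m_def)
      moreover have "0 < m" using \<kappa> A0 by (simp add: m_def)
      moreover have "\<kappa> T * (2 * A0) * (2 * A0) = 4 * m" by (simp add: m_def)
      ultimately show "A0 + \<kappa> T * (2 * A0) * (2 * A0) \<le> 2 * A0" by linarith
      show "0 < A0 + \<kappa> T * (2 * A0) * (2 * A0)" using A0 \<kappa> by (simp add: add_pos_pos)
    qed
  qed
  have finP: "AE x in lborel. bmaj (P n) (P n) t x < \<infinity>" if t: "0 < t" "t < T" for n t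
    by (rule XB_finite[OF XB_bmaj_const[OF Pm Pm, of "2 * A0" "2 * A0" T] bmaj_slice_measurable[OF Pm Pm]])
       (use A0 t bound in auto)
  define D where "D n z = P (Suc n) z - P n z" for n z
  have Dm [measurable]: "D n \<in> borel_measurable borel" for n
    unfolding D_def[abs_def] by (intro borel_measurable_diff Pm)
  have Dbound: "XB (A0 * (1 / 2) ^ n) (nm (D n) t)" if t: "0 < t" "t < T" for n t
    using t
  proof (induction n arbitrary: t)
    case 0
    have "nm (D 0) t x \<le> lmaj U0 F t x" for x
    proof -
      have "K s z 0 0 = 0" for s z by (simp add: K_def vec_eq_iff)
      then have "D 0 (t, x) = lin U0 F (t, x)" by (simp add: D_def PS P0 bop_def)
      then show ?thesis using norm_lin_le[OF 0(1)] by simp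
    qed
    then show ?case using XB_mono[OF A0(2)[of t], of "nm (D 0) t" A0] 0 T A0 by auto
  next
    case (Suc n)
    let ?a = "A0 * (1 / 2) ^ n"
    have a: "0 < ?a" using A0 by simp
    have "XB (\<kappa> T * ?a * (2 * A0)) (bmaj (D n) (P (Suc n)) t)" "XB (\<kappa> T * (2 * A0) * ?a) (bmaj (P n) (D n) t)"
      using Suc A0 a bound by (auto intro!: XB_bmaj_const)
    then have "XB (\<kappa> T * ?a * (2 * A0) + \<kappa> T * (2 * A0) * ?a) (\<lambda>x. bmaj (D n) (P (Suc n)) t x + bmaj (P n) (D n) t x)"
      using \<kappa> A0 by (intro XB_add) auto
    then show ?case
    proof (rule XB_mono)
      show "AE x in lborel. nm (D (Suc n)) t x \<le> bmaj (D n) (P (Suc n)) t x + bmaj (P n) (D n) t x"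
        using finP[OF Suc(2,3), of n] finP[OF Suc(2,3), of "Suc n"]
      proof eventually_elim
        case (elim x)
        have "D (Suc n) (t, x) = bop (P n) (P n) (t, x) - bop (P (Suc n)) (P (Suc n)) (t, x)"
          by (simp add: D_def PS)
        then have "nm (D (Suc n)) t x = ennreal (norm (bop (P (Suc n)) (P (Suc n)) (t, x) - bop (P n) (P n) (t, x)))"
          by (simp only: norm_minus_commute)
        also have "\<dots> \<le> bmaj (\<lambda>p. P (Suc n) p - P n p) (P (Suc n)) t x + bmaj (P n) (\<lambda>p. P (Suc n) p - P n p) t x"
          by (rule norm_bop_diff[OF Pm Pm elim(2,1)])
        finally show ?case by (simp add: D_def[abs_def])
      qed
      have "8 * \<kappa> T * A0 * ?a \<le> 1 * ?a" using T a by (intro mult_right_mono) auto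
      then show "\<kappa> T * ?a * (2 * A0) + \<kappa> T * (2 * A0) * ?a \<le> A0 * (1 / 2) ^ Suc n" by (simp add: mult_ac)
      show "0 < \<kappa> T * ?a * (2 * A0) + \<kappa> T * (2 * A0) * ?a" using \<kappa> A0 by simp
    qed
  qed
  \<comment> \<open>Defined through \<open>lim\<close>, U is a Borel function of (t,x) everywhere;
    off the set of convergence its value does not matter.\<close>
  define U where "U z = lim (\<lambda>n. P n z)" for z
  have Um [measurable]: "U \<in> borel_measurable borel" unfolding U_def[abs_def] by measurable
  have tail: "XB (2 * A0 * (1 / 2) ^ n) (\<lambda>x. \<Sum>k. nm (D (n + k)) t x)" if t: "0 < t" "t < T" for n t
    using Dbound[OF t] A0 geometric_half_sums[of A0 n] by (intro XB_suminf[where a = "\<lambda>k. A0 * (1 / 2) ^ (n + k)"]) auto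
  have limit: "AE x in lborel. \<forall>n. ennreal (norm (U (t, x) - P n (t, x))) \<le> (\<Sum>k. nm (D (n + k)) t x)"
    if t: "0 < t" "t < T" for t
  proof -
    have "AE x in lborel. (\<Sum>k. nm (D (0 + k)) t x) < \<infinity>"
      by (rule XB_finite[OF tail[OF t, of 0]]) measurable
    then show ?thesis
    proof eventually_elim
      case (elim x)
      then have "summable (\<lambda>k. norm (D k (t, x)))"
        by (intro summable_suminf_not_top) auto
      then have "summable (\<lambda>k. D k (t, x))" by (rule summable_norm_cancel)
      then have "convergent (\<lambda>n. \<Sum>k<n. D k (t, x))" by (simp add: summable_iff_convergent)
      moreover have tele: "(\<Sum>k<m. D (n + k) (t, x)) = P (n + m) (t, x) - P n (t, x)" for n m
        unfolding D_def using sum_lessThan_telescope[of "\<lambda>k. P (n + k) (t, x)" m] by simp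
      ultimately have conv: "(\<lambda>n. P n (t, x)) \<longlonglongrightarrow> U (t, x)"
        using tele[of 0] by (simp add: U_def P0 convergent_LIMSEQ_iff)
      show ?case
      proof
        fix n
        have "(\<lambda>m. ennreal (norm (P (m + n) (t, x) - P n (t, x)))) \<longlonglongrightarrow> ennreal (norm (U (t, x) - P n (t, x)))"
          by (intro tendsto_intros LIMSEQ_ignore_initial_segment conv)
        then show "ennreal (norm (U (t, x) - P n (t, x))) \<le> (\<Sum>k. nm (D (n + k)) t x)"
        proof (rule LIMSEQ_le_const2, intro exI allI impI)
          fix m
          have "ennreal (norm (P (m + n) (t, x) - P n (t, x))) \<le> ennreal (\<Sum>k<m. norm (D (n + k) (t, x)))"
            using tele[where n = n and m = m] norm_sum[of "\<lambda>k. D (n + k) (t, x)" "{..<m}"]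
            by (intro ennreal_leI) (simp add: add.commute)
          also have "\<dots> = (\<Sum>k<m. nm (D (n + k)) t x)" by (simp add: sum_ennreal)
          also have "\<dots> \<le> (\<Sum>k. nm (D (n + k)) t x)" by (rule sum_le_suminf) auto
          finally show "ennreal (norm (P (m + n) (t, x) - P n (t, x))) \<le> (\<Sum>k. nm (D (n + k)) t x)" .
        qed
      qed
    qed
  qed
  define E where "E n z = U z - P n z" for n z
  have Em [measurable]: "E n \<in> borel_measurable borel" for n
    unfolding E_def[abs_def] using Um Pm by (rule borel_measurable_diff)
  have Ebound: "XB (2 * A0 * (1 / 2) ^ n) (nm (E n) t)" if t: "0 < t" "t < T" for n t
    using limit[OF t] A0 by (intro XB_mono[OF tail[OF t, of n]]) (auto simp: E_def elim: eventually_mono)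
  have Ubound: "XB (2 * A0) (nm U t)" if t: "0 < t" "t < T" for t
    using Ebound[OF t, of 0] by (simp add: E_def P0)
  show ?thesis
  proof (intro bexI[OF _ Um] allI impI conjI Ubound)
    fix t assume t: "0 < t" "t < T"
    \<comment> \<open>The residual of the equation. Subtracting the equation that defines iterate n
      + 1 from iterate n bounds it in X by a multiple of 2^(-n) for every n, so it vanishes by
      \<open>XB_zero\<close>.\<close>
    define e where "e x = ennreal (norm (U (t, x) - (lin U0 F (t, x) - bop U U (t, x))))" for x
    have finU: "AE x in lborel. bmaj U U t x < \<infinity>"
      by (rule XB_finite[OF XB_bmaj_const[OF Um Um, of "2 * A0" "2 * A0" T] bmaj_slice_measurable[OF Um Um]])
         (use A0 t Ubound in auto)
    have lm: "lin U0 F \<in> borel_measurable borel" "bop U U \<in> borel_measurable borel"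
      by (rule measurable_lin[OF _ F], simp, rule measurable_bop[OF Um Um])
    have "(\<lambda>z. U z - (lin U0 F z - bop U U z)) \<in> borel_measurable borel"
      by (intro borel_measurable_diff Um lm)
    from slice_measurable[OF this, of t] have em: "e \<in> borel_measurable borel"
      unfolding e_def by measurable
    have "AE x in lborel. e x = 0"
    proof (rule XB_zero[where \<epsilon> = "\<lambda>n. 4 * A0 * (1 / 2) ^ n"])
      fix n
      let ?a = "2 * A0 * (1 / 2) ^ n"
      have "XB (\<kappa> T * ?a * (2 * A0)) (bmaj (E n) U t)"
        by (rule XB_bmaj_const[OF Em Um _ _ Ebound Ubound t]) (use A0 in auto)
      moreover have "XB (\<kappa> T * (2 * A0) * ?a) (bmaj (P n) (E n) t)"
        by (rule XB_bmaj_const[OF Pm Em _ _ bound Ebound t]) (use A0 in auto)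
      ultimately have X: "XB (\<kappa> T * ?a * (2 * A0) + \<kappa> T * (2 * A0) * ?a) (\<lambda>x. bmaj (E n) U t x + bmaj (P n) (E n) t x)"
        using \<kappa> A0 by (intro XB_add) auto
      have "XB (2 * A0 * (1 / 2) ^ Suc n + (\<kappa> T * ?a * (2 * A0) + \<kappa> T * (2 * A0) * ?a))
          (\<lambda>x. nm (E (Suc n)) t x + (bmaj (E n) U t x + bmaj (P n) (E n) t x))"
        by (rule XB_add[OF _ _ Ebound[OF t, of "Suc n"] _ X]) (use \<kappa> A0 in \<open>auto intro!: add_pos_pos\<close>)
      then show "XB (4 * A0 * (1 / 2) ^ n) e"
      proof (rule XB_mono)
        show "AE x in lborel. e x \<le> nm (E (Suc n)) t x + (bmaj (E n) U t x + bmaj (P n) (E n) t x)"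
          using finU finP[OF t, of n]
        proof eventually_elim
          case (elim x)
          have "U (t, x) - (lin U0 F (t, x) - bop U U (t, x))
            = E (Suc n) (t, x) + (bop U U (t, x) - bop (P n) (P n) (t, x))"
            by (simp add: E_def PS)
          then have "e x = ennreal (norm (E (Suc n) (t, x) + (bop U U (t, x) - bop (P n) (P n) (t, x))))"
            by (simp only: e_def)
          also have "\<dots> \<le> ennreal (norm (E (Suc n) (t, x)) + norm (bop U U (t, x) - bop (P n) (P n) (t, x)))"
            by (intro ennreal_leI norm_triangle_ineq)
          also have "\<dots> = nm (E (Suc n)) t x + ennreal (norm (bop U U (t, x) - bop (P n) (P n) (t, x)))" by simp
          also have "\<dots> \<le> nm (E (Suc n)) t x + (bmaj (\<lambda>p. U p - P n p) U t x + bmaj (P n) (\<lambda>p. U p - P n p) t x)"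
            by (intro add_left_mono norm_bop_diff[OF Um Pm elim])
          finally show ?case by (simp add: E_def[abs_def])
        qed
        have "8 * \<kappa> T * A0 * ?a \<le> 1 * ?a" using T A0 by (intro mult_right_mono) auto
        then show "2 * A0 * (1 / 2) ^ Suc n + (\<kappa> T * ?a * (2 * A0) + \<kappa> T * (2 * A0) * ?a) \<le> 4 * A0 * (1 / 2) ^ n"
          using A0 by (simp add: mult_ac)
        show "0 < 2 * A0 * (1 / 2) ^ Suc n + (\<kappa> T * ?a * (2 * A0) + \<kappa> T * (2 * A0) * ?a)"
          using \<kappa> A0 by (intro add_pos_pos) auto
      qed
    next
      have "(\<lambda>n. 4 * A0 * (1 / 2) ^ n) \<longlonglongrightarrow> 4 * A0 * 0"
        by (intro tendsto_mult tendsto_const LIMSEQ_realpow_zero) auto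
      then show "(\<lambda>n. 4 * A0 * (1 / 2) ^ n) \<longlonglongrightarrow> 0" by simp
    qed (use A0 em in auto)
    then show "AE x in lborel. U (t, x) = lin U0 F (t, x) - bop U U (t, x)"
      by eventually_elim (simp add: e_def)
  qed
qed

text \<open>By Young's inequality and \<open>\<gamma> < 1 - 2/r\<close>, the bilinear term maps \<open>L\<^sup>r\<close> in time to bounded functions of
  time, so that every solution is bounded and uniqueness may be proved in the bounded class.\<close>

lemma solution_bounded:
  assumes V [measurable]: "V \<in> borel_measurable borel" and a [measurable]: "a \<in> borel_measurable borel"
    and A0: "0 < A0" "\<And>t. 0 < t \<Longrightarrow> t \<le> 1 \<Longrightarrow> XB A0 (lmaj U0 F t)"
    and U0F [measurable]: "U0 \<in> borel_measurable borel" "F \<in> borel_measurable borel"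
    and T: "T \<le> 1"
    and XV: "AE t in lborel. 0 < t \<longrightarrow> t < T \<longrightarrow> 0 < a t \<and> XB (a t) (nm V t)"
    and ar: "(\<integral>\<^sup>+t. ennreal (a t powr r) * indicator {0<..<T} t \<partial>lborel) < \<infinity>"
  shows "\<exists>L>0. \<forall>t. 0 < t \<longrightarrow> t < T \<longrightarrow> XB L (bmaj V V t)"
proof -
  \<comment> \<open>The exponent of t - s after Young's inequality; \<gamma> < 1 - 2/r says exactly
    that it exceeds -1. The factor a(s)^2 is paid by the integrable power a(s)^r.\<close>
  define e where "e = - \<gamma> / (1 - 2 / r)"
  have r0: "0 < 1 - 2 / r" using r by simp
  have e: "-1 < e" using \<gamma> r0 by (simp add: e_def)
  obtain I where I: "(\<integral>\<^sup>+t. ennreal (a t powr r) * indicator {0<..<T} t \<partial>lborel) = ennreal I" "0 \<le> I"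
    using ar by (cases "\<integral>\<^sup>+t. ennreal (a t powr r) * indicator {0<..<T} t \<partial>lborel") auto
  define L where "L = KB * C * (1 / (e + 1) + I)"
  have L: "0 < L" using KB C I e by (auto simp: L_def intro!: mult_pos_pos add_pos_nonneg)
  show ?thesis
  proof (intro exI[of _ L] conjI allI impI L)
    fix t assume t: "0 < t" "t < T"
    show "XB L (bmaj V V t)"
    proof (rule XB_bmaj[OF V V a a _ _ L])
      show "AE s in lborel. 0 < s \<longrightarrow> s < t \<longrightarrow> 0 < a s \<and> XB (a s) (nm V s) \<and> 0 < a s \<and> XB (a s) (nm V s)"
        using XV by eventually_elim (use t in auto)
      have "(\<integral>\<^sup>+s. ennreal (KB * C * (t - s) powr (- \<gamma>) * a s * a s) * indicator {0<..<t} s \<partial>lborel)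
        \<le> (\<integral>\<^sup>+s. ennreal (KB * C) * (ennreal ((t - s) powr e) * indicator {0<..<t} s + ennreal (a s powr r) * indicator {0<..<T} s) \<partial>lborel)"
        using XV
      proof (intro nn_integral_mono_AE, eventually_elim)
        case (elim s)
        show ?case
        proof (cases "s \<in> {0<..<t}")
          case True
          then have as: "0 < a s" using elim t by auto
          have "(t - s) powr (- \<gamma>) * (a s)\<^sup>2 \<le> ((t - s) powr (- \<gamma>)) powr (1 / (1 - 2 / r)) + a s powr r"
            using as r by (intro mult_le_powr_add) auto
          also have "((t - s) powr (- \<gamma>)) powr (1 / (1 - 2 / r)) = (t - s) powr e"
            by (simp add: powr_powr e_def)
          finally have "KB * C * ((t - s) powr (- \<gamma>) * (a s)\<^sup>2) \<le> KB * C * ((t - s) powr e + a s powr r)"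
            using KB C by (intro mult_left_mono) auto
          moreover have "KB * C * (t - s) powr (- \<gamma>) * a s * a s = KB * C * ((t - s) powr (- \<gamma>) * (a s)\<^sup>2)"
            by (simp add: power2_eq_square)
          ultimately have "ennreal (KB * C * (t - s) powr (- \<gamma>) * a s * a s) \<le> ennreal (KB * C * ((t - s) powr e + a s powr r))"
            by (intro ennreal_leI) linarith
          also have "\<dots> = ennreal (KB * C) * (ennreal ((t - s) powr e) + ennreal (a s powr r))"
            using KB C by (subst ennreal_mult) auto
          finally show ?thesis using True t by simp
        qed simp
      qed
      also have "\<dots> = ennreal (KB * C) * ((\<integral>\<^sup>+s. ennreal ((t - s) powr e) * indicator {0<..<t} s \<partial>lborel)
         + (\<integral>\<^sup>+s. ennreal (a s powr r) * indicator {0<..<T} s \<partial>lborel))"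
        by (simp add: nn_integral_cmult nn_integral_add)
      also have "\<dots> \<le> ennreal (KB * C) * (ennreal (t powr (e + 1) / (e + 1)) + ennreal I)"
        using e t I by (intro mult_left_mono add_mono nn_integral_powr_0) auto
      also have "\<dots> \<le> ennreal (KB * C) * (ennreal (1 / (e + 1)) + ennreal I)"
      proof (intro mult_left_mono add_right_mono ennreal_leI divide_right_mono)
        have "t powr (e + 1) \<le> 1 powr (e + 1)" using t T e by (intro powr_mono2) auto
        then show "t powr (e + 1) \<le> 1" by simp
      qed (use e in auto)
      also have "\<dots> = ennreal L"
        using KB C I e by (simp add: L_def ennreal_mult ennreal_plus[symmetric] del: ennreal_plus)
      finally show "(\<integral>\<^sup>+s. ennreal (KB * C * (t - s) powr (- \<gamma>) * a s * a s) * indicator {0<..<t} s \<partial>lborel) \<le> ennreal L" .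
    qed
  qed
qed

text \<open>The bound \<open>2 A e\<^bsup>\<mu> t\<^esup> / 2\<^sup>n\<close> for the difference improves by a factor 2 in each application of the equation when \<open>\<mu>\<close> is large,
  so no smallness of \<open>T\<close> is needed.\<close>

lemma solution_unique:
  assumes UV [measurable]: "U \<in> borel_measurable borel" "V \<in> borel_measurable borel"
    and T: "0 < T" "T \<le> 1" and A: "0 < A"
    and XU: "AE t in lborel. 0 < t \<longrightarrow> t < T \<longrightarrow> XB A (nm U t) \<and> XB A (nm V t)"
    and eqU: "AE t in lborel. 0 < t \<longrightarrow> t < T \<longrightarrow> (AE x in lborel. U (t, x) = lin U0 F (t, x) - bop U U (t, x))"
    and eqV: "AE t in lborel. 0 < t \<longrightarrow> t < T \<longrightarrow> (AE x in lborel. V (t, x) = lin U0 F (t, x) - bop V V (t, x))"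
  shows "AE t in lborel. 0 < t \<longrightarrow> t < T \<longrightarrow> (AE x in lborel. V (t, x) = U (t, x))"
proof -
  \<comment> \<open>Half of the spare exponent 1 - \<gamma>. The singularity is worsened by (t -
    s)^(-k) in exchange for the small factor 1/q, and -\<gamma> - k is still above -1.\<close>
  define k where "k = (1 - \<gamma>) / 2"
  have k: "0 < k" "1 - \<gamma> - k = k" using \<gamma> by (auto simp: k_def field_simps)
  \<comment> \<open>Chosen so that the time integral against b n is at most b n t / 4; the two terms
    of the difference estimate then add up to half of b n t, which is b (Suc n) t.\<close>
  define q where "q = 4 * KB * C * A / k"
  have q: "0 < q" using KB C A k by (simp add: q_def)
  define mu where "mu = q powr (1 / k)"
  have mu: "0 < mu" "mu powr k = q" using q k by (auto simp: mu_def powr_powr)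
  define D where "D p = V p - U p" for p
  have Dm [measurable]: "D \<in> borel_measurable borel"
    unfolding D_def[abs_def] using UV(2,1) by (rule borel_measurable_diff)
  define b where "b n t = 2 * A * (1 / 2) ^ n * exp (mu * t)" for n :: nat and t
  have b0: "0 < b n t" for n t using A by (simp add: b_def)
  have [measurable]: "b n \<in> borel_measurable borel" for n unfolding b_def[abs_def] by measurable
  have int: "(\<integral>\<^sup>+s. ennreal (KB * C * (t - s) powr (- \<gamma>) * b n s * A) * indicator {0<..<t} s \<partial>lborel) \<le> ennreal (b n t / 4)"
    if t: "0 < t" "t < T" for n t
  proof -
    have pt: "KB * C * (t - s) powr (- \<gamma>) * b n s * A \<le> (KB * C * A * b n t / q) * (t - s) powr (- \<gamma> - k)" if s: "0 < s" "s < t" for s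
    proof -
      \<comment> \<open>From ln x <= x and k <= 1 follows k ln x <= x for x > 0, that is exp(-x) <=
        x^(-k).\<close>
      have "exp (- (mu * (t - s))) \<le> (mu * (t - s)) powr (- k)"
      proof -
        have x: "0 < mu * (t - s)" using mu s by simp
        have "ln (mu * (t - s)) \<le> mu * (t - s)" using x by (rule ln_bound)
        moreover have "k \<le> 1" using \<gamma> by (simp add: k_def)
        ultimately have "k * ln (mu * (t - s)) \<le> mu * (t - s)"
          using k x mult_left_mono[of "ln (mu * (t - s))" "mu * (t - s)" k] mult_right_mono[of k 1 "mu * (t - s)"] by linarith
        then show ?thesis using x mu s by (simp add: powr_def)
      qed
      also have "\<dots> = (t - s) powr (- k) / q"
        using mu s by (simp add: powr_mult powr_minus divide_inverse)
      finally have "b n t * exp (- (mu * (t - s))) \<le> b n t * ((t - s) powr (- k) / q)"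
        using b0[of n t] by (intro mult_left_mono) auto
      moreover have "b n s = b n t * exp (- (mu * (t - s)))"
        by (simp add: b_def mult.assoc exp_add[symmetric] algebra_simps)
      ultimately have "b n s \<le> b n t * ((t - s) powr (- k) / q)" by simp
      then have "(KB * C * (t - s) powr (- \<gamma>) * A) * b n s \<le> (KB * C * (t - s) powr (- \<gamma>) * A) * (b n t * ((t - s) powr (- k) / q))"
        using KB C A by (intro mult_left_mono) auto
      also have "\<dots> = (KB * C * A * b n t / q) * ((t - s) powr (- \<gamma>) * (t - s) powr (- k))" by simp
      also have "(t - s) powr (- \<gamma>) * (t - s) powr (- k) = (t - s) powr (- \<gamma> - k)"
        by (simp add: powr_add[symmetric])
      finally show ?thesis by (simp add: mult_ac)
    qed
    have c: "0 \<le> KB * C * A * b n t / q" using KB C A b0[of n t] q by simp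
    have "(\<integral>\<^sup>+s. ennreal (KB * C * (t - s) powr (- \<gamma>) * b n s * A) * indicator {0<..<t} s \<partial>lborel)
      \<le> (\<integral>\<^sup>+s. ennreal (KB * C * A * b n t / q) * (ennreal ((t - s) powr (- \<gamma> - k)) * indicator {0<..<t} s) \<partial>lborel)"
    proof (intro nn_integral_mono)
      fix s
      show "ennreal (KB * C * (t - s) powr (- \<gamma>) * b n s * A) * indicator {0<..<t} s
        \<le> ennreal (KB * C * A * b n t / q) * (ennreal ((t - s) powr (- \<gamma> - k)) * indicator {0<..<t} s)"
      proof (cases "s \<in> {0<..<t}")
        case True
        then show ?thesis using ennreal_leI[OF pt[of s]] ennreal_mult[OF c powr_ge_zero[of "t - s" "- \<gamma> - k"]] by simp
      qed simp
    qed
    also have "\<dots> = ennreal (KB * C * A * b n t / q) * (\<integral>\<^sup>+s. ennreal ((t - s) powr (- \<gamma> - k)) * indicator {0<..<t} s \<partial>lborel)"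
      by (rule nn_integral_cmult) measurable
    also have "\<dots> \<le> ennreal (KB * C * A * b n t / q) * ennreal (t powr (- \<gamma> - k + 1) / (- \<gamma> - k + 1))"
      using k t by (intro mult_left_mono nn_integral_powr_0) auto
    also have "\<dots> = ennreal (KB * C * A * b n t / q * (t powr k / k))"
    proof -
      have "- \<gamma> - k + 1 = k" using k by simp
      then show ?thesis using c k ennreal_mult[of "KB * C * A * b n t / q" "t powr k / k"] by (simp only:) simp
    qed
    also have "\<dots> \<le> ennreal (b n t / 4)"
    proof (rule ennreal_leI)
      have "t powr k \<le> 1 powr k" using t T k by (intro powr_mono2) auto
      then have "KB * C * A * b n t / q * (t powr k / k) \<le> KB * C * A * b n t / q * (1 / k)"
        using c k by (intro mult_left_mono divide_right_mono) auto
      also have "\<dots> = b n t / 4" using KB C A k by (simp add: q_def)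
      finally show "KB * C * A * b n t / q * (t powr k / k) \<le> b n t / 4" .
    qed
    finally show ?thesis .
  qed
  have L1: "(\<integral>\<^sup>+s. ennreal (KB * C * (t - s) powr (- \<gamma>) * A * b n s) * indicator {0<..<t} s \<partial>lborel) \<le> ennreal (b n t / 4)"
    if "0 < t" "t < T" for n t using int[OF that, of n] by (simp add: mult_ac)
  \<comment> \<open>The constant A is dominated by b 0, so the weighted integral already estimated
    gives finiteness here.\<close>
  have finite: "AE x in lborel. bmaj Z Z t x < \<infinity>"
    if t: "0 < t" "t < T" and Z [measurable]: "Z \<in> borel_measurable borel" and XZ: "AE t in lborel. 0 < t \<longrightarrow> t < T \<longrightarrow> XB A (nm Z t)" for Z t
  proof (rule XB_finite)
    have "(\<integral>\<^sup>+s. ennreal (KB * C * (t - s) powr (- \<gamma>) * A * A) * indicator {0<..<t} s \<partial>lborel)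
      \<le> (\<integral>\<^sup>+s. ennreal (KB * C * (t - s) powr (- \<gamma>) * b 0 s * A) * indicator {0<..<t} s \<partial>lborel)"
    proof (intro nn_integral_mono)
      fix s
      show "ennreal (KB * C * (t - s) powr (- \<gamma>) * A * A) * indicator {0<..<t} s
        \<le> ennreal (KB * C * (t - s) powr (- \<gamma>) * b 0 s * A) * indicator {0<..<t} s"
      proof (cases "s \<in> {0<..<t}")
        case True
        then have "1 \<le> exp (mu * s)" using mu by simp
        then have "A * 1 \<le> A * (2 * exp (mu * s))" using A by (intro mult_left_mono) linarith+
        then have "A \<le> b 0 s" by (simp add: b_def)
        then show ?thesis using KB C A by (intro mult_right_mono ennreal_leI mult_left_mono) auto
      qed simp
    qed
    also have "\<dots> \<le> ennreal (b 0 t / 4)" by (rule int[OF t])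
    finally show "XB (b 0 t / 4) (bmaj Z Z t)"
      using XZ A t b0[of 0 t] by (intro XB_bmaj[OF Z Z, of "\<lambda>_. A" "\<lambda>_. A"]) (auto elim: eventually_mono)
  qed measurable
  have step: "AE t in lborel. 0 < t \<longrightarrow> t < T \<longrightarrow> XB (b n t) (nm D t)" for n
  proof (induction n)
    case 0
    show ?case using XU
    proof eventually_elim
      case (elim t)
      show ?case
      proof (intro impI)
        assume t: "0 < t" "t < T"
        have "XB (A + A) (\<lambda>x. nm V t x + nm U t x)" using elim t A by (intro XB_add) auto
        then show "XB (b 0 t) (nm D t)"
        proof (rule XB_mono)
          show "AE x in lborel. nm D t x \<le> nm V t x + nm U t x"
            by (rule AE_I2) (simp add: D_def ennreal_plus[symmetric] ennreal_leI norm_triangle_ineq4 del: ennreal_plus)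
          have "1 \<le> exp (mu * t)" using mu t by simp
          then show "A + A \<le> b 0 t" using A mult_left_mono[of 1 "exp (mu * t)" "2 * A"] by (simp add: b_def)
        qed (use A in auto)
      qed
    qed
  next
    case (Suc n)
    show ?case using eqU eqV
    proof eventually_elim
      case (elim t)
      show ?case
      proof (intro impI)
        assume t: "0 < t" "t < T"
        have 1: "XB (b n t / 4) (bmaj D V t)"
          using Suc XU A b0 t by (intro XB_bmaj[OF Dm UV(2) _ _ _ int[OF t]]) auto
        have 2: "XB (b n t / 4) (bmaj U D t)"
          using Suc XU A b0 t by (intro XB_bmaj[OF UV(1) Dm _ _ _ L1[OF t]]) auto
        have "XB (b n t / 4 + b n t / 4) (\<lambda>x. bmaj D V t x + bmaj U D t x)"
          using 1 2 b0[of n t] by (intro XB_add) auto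
        then show "XB (b (Suc n) t) (nm D t)"
        proof (rule XB_mono)
          have "AE x in lborel. U (t, x) = lin U0 F (t, x) - bop U U (t, x)"
            "AE x in lborel. V (t, x) = lin U0 F (t, x) - bop V V (t, x)" using elim t by auto
          moreover have "AE x in lborel. bmaj U U t x < \<infinity>"
            by (rule finite[OF t UV(1)]) (use XU in \<open>auto elim: eventually_mono\<close>)
          moreover have "AE x in lborel. bmaj V V t x < \<infinity>"
            by (rule finite[OF t UV(2)]) (use XU in \<open>auto elim: eventually_mono\<close>)
          ultimately show "AE x in lborel. nm D t x \<le> bmaj D V t x + bmaj U D t x"
          proof eventually_elim
            case (elim x)
            have "D (t, x) = bop U U (t, x) - bop V V (t, x)" using elim(1,2) by (simp add: D_def)
            then have "nm D t x = ennreal (norm (bop V V (t, x) - bop U U (t, x)))"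
              by (simp only: norm_minus_commute)
            also have "\<dots> \<le> bmaj (\<lambda>p. V p - U p) V t x + bmaj U (\<lambda>p. V p - U p) t x"
              by (rule norm_bop_diff[OF UV(2,1) elim(4,3)])
            finally show ?case by (simp add: D_def[abs_def])
          qed
          show "0 < b n t / 4 + b n t / 4" using b0[of n t] by simp
          show "b n t / 4 + b n t / 4 \<le> b (Suc n) t" by (simp add: b_def)
        qed
      qed
    qed
  qed
  have "AE t in lborel. \<forall>n. 0 < t \<longrightarrow> t < T \<longrightarrow> XB (b n t) (nm D t)"
    unfolding AE_all_countable using step by blast
  then show ?thesis
  proof eventually_elim
    case (elim t)
    show ?case
    proof (intro impI)
      assume t: "0 < t" "t < T"
      have "AE x in lborel. nm D t x = 0"
      proof (rule XB_zero[where \<epsilon> = "\<lambda>n. b n t"])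
        have "(\<lambda>n. 2 * A * (1 / 2) ^ n * exp (mu * t)) \<longlonglongrightarrow> 2 * A * 0 * exp (mu * t)"
          by (intro tendsto_mult tendsto_const LIMSEQ_realpow_zero) auto
        then show "(\<lambda>n. b n t) \<longlonglongrightarrow> 0" by (simp add: b_def)
      qed (use elim t b0 in auto)
      then show "AE x in lborel. V (t, x) = U (t, x)" by eventually_elim (simp add: D_def)
    qed
  qed
qed

end

section \<open>From the function spaces to the integral operators\<close>

text \<open>Slices of Lebesgue measurable functions may fail to be measurable, whereas the integral
  operators above act on Borel functions. Real functions have a Borel representative by completion;
  this is applied to the components in the basis.\<close>

lemma lebesgue_on_borel_representative:
  fixes f :: "'a::euclidean_space \<Rightarrow> 'b::euclidean_space"
  assumes f: "f \<in> borel_measurable (lebesgue_on S)" and S: "S \<in> sets lebesgue"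
  shows "\<exists>h \<in> borel_measurable borel. AE x in lborel. x \<in> S \<longrightarrow> f x = h x"
proof -
  define f0 where "f0 x = (if x \<in> S then f x else 0)" for x
  have f0: "f0 \<in> borel_measurable (completion lborel)"
    unfolding f0_def[abs_def] by (rule borel_measurable_if_I[OF f S])
  have "\<forall>b\<in>Basis. \<exists>g\<in>borel_measurable lborel. AE x in lborel. f0 x \<bullet> b = g x"
    by (intro ballI completion_ex_borel_measurable_real borel_measurable_inner f0 borel_measurable_const)
  then obtain g where g: "\<And>b. b \<in> Basis \<Longrightarrow> g b \<in> borel_measurable lborel"
    "\<And>b. b \<in> Basis \<Longrightarrow> AE x in lborel. f0 x \<bullet> b = g b x" by metis
  have "AE x in lborel. \<forall>b\<in>Basis. f0 x \<bullet> b = g b x"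
    using g(2) by (intro AE_finite_allI) auto
  then have "AE x in lborel. f0 x = (\<Sum>b\<in>Basis. g b x *\<^sub>R b)"
    by eventually_elim (metis (no_types, lifting) euclidean_representation sum.cong)
  then have ae: "AE x in lborel. x \<in> S \<longrightarrow> f x = (\<Sum>b\<in>Basis. g b x *\<^sub>R b)"
    by eventually_elim (auto simp: f0_def)
  have m: "(\<lambda>x. \<Sum>b\<in>Basis. g b x *\<^sub>R b) \<in> borel_measurable borel"
    using g(1) by (intro borel_measurable_sum borel_measurable_scaleR) auto
  show ?thesis using ae m by (intro bexI[of _ "\<lambda>x. \<Sum>b\<in>Basis. g b x *\<^sub>R b"])
qed

lemma lebesgue_integral_AE_eq:
  fixes f h :: "'a::euclidean_space \<Rightarrow> 'b::euclidean_space"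
  assumes h: "h \<in> borel_measurable borel" and eq: "AE x in lborel. f x = h x"
  shows "integral\<^sup>L lebesgue f = integral\<^sup>L lborel h" "integrable lborel h \<Longrightarrow> integrable lebesgue f"
proof -
  have hl: "h \<in> borel_measurable lebesgue" using h by (simp add: measurable_completion)
  have ae: "AE x in lebesgue. h x = f x" using eq by (intro AE_completion) (auto elim: eventually_mono)
  have fl: "f \<in> borel_measurable lebesgue" by (rule borel_measurable_AE[OF hl ae])
  have ae': "AE x in lebesgue. f x = h x" using ae by (auto elim: eventually_mono)
  show "integral\<^sup>L lebesgue f = integral\<^sup>L lborel h"
    using integral_cong_AE[OF fl hl ae'] integral_completion[of h lborel] h by simp
  show "integrable lborel h \<Longrightarrow> integrable lebesgue f"
    using integrable_cong_AE[OF fl hl ae'] integrable_completion[of h lborel] h by simp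
qed

lemma AE_lebesgue_on_iff:
  assumes "S \<in> sets lebesgue"
  shows "(AE x in lebesgue_on S. P x) \<longleftrightarrow> (AE x in lborel. x \<in> S \<longrightarrow> P x)"
  by (subst AE_restrict_space_iff) (use assms in \<open>auto simp: AE_completion_iff\<close>)

text \<open>A Liminf along the almost-everywhere filter yields strict bounds only; the countably
  many bounds r - 1/(n+1) hold simultaneously almost everywhere.\<close>

lemma le_Liminf_AE:
  assumes "ereal r \<le> Liminf (ae_filter M) p"
  shows "AE x in M. ereal r \<le> p x"
proof -
  have "AE x in M. ereal (r - 1 / real (Suc n)) < p x" for n
    using assms unfolding le_Liminf_iff by simp
  then have "AE x in M. \<forall>n. ereal (r - 1 / real (Suc n)) < p x" by (simp add: AE_all_countable)
  then show ?thesis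
  proof eventually_elim
    case (elim x)
    have "(\<lambda>n. ereal (r - 1 / real (Suc n))) \<longlonglongrightarrow> ereal (r - 0)"
      by (intro tendsto_intros LIMSEQ_Suc[OF lim_1_over_n])
    then have "(\<lambda>n. ereal (r - 1 / real (Suc n))) \<longlonglongrightarrow> ereal r" by simp
    then show ?case by (rule LIMSEQ_le_const2) (use elim in \<open>auto intro: less_imp_le\<close>)
  qed
qed

section \<open>Modulars and norms in terms of the reciprocal exponent\<close>

lemma omega_eq_vpow:
  assumes "1 \<le> p" "0 \<le> s"
  shows "omega p s = vpow (real_of_ereal (1 / p)) (ennreal s)"
proof (cases p)
  case (real r)
  then have r: "1 \<le> r" using assms by simp
  have "real_of_ereal (1 / p) = 1 / r" using real r by (simp add: one_ereal_def)
  then show ?thesis using real r assms by (simp add: omega_def vpow_ennreal)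
next
  case PInf
  then show ?thesis using assms by (simp add: omega_def vpow_def ennreal_le_1)
qed (use assms in simp)

lemma omega_le_1: "1 \<le> p \<Longrightarrow> 0 \<le> s \<Longrightarrow> s \<le> 1 \<Longrightarrow> omega p s \<le> 1"
  by (cases p) (auto simp: omega_def powr_le1)

text \<open>The summand 1 covers s <= 1, where the larger exponent gives the smaller power; on a
  bounded interval it costs a finite amount.\<close>

lemma powr_le_omega:
  assumes "ereal r \<le> p" "0 \<le> s" "0 \<le> r"
  shows "ennreal (s powr r) \<le> 1 + omega p s"
proof (cases "s \<le> 1")
  case True
  then have "s powr r \<le> 1" using assms by (simp add: powr_le1)
  then have "ennreal (s powr r) \<le> 1" by simp
  then show ?thesis by (rule order_trans) simp
next
  case False
  show ?thesis
  proof (cases p)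
    case (real p')
    then have "s powr r \<le> s powr p'" using False assms by (intro powr_mono) auto
    then have "ennreal (s powr r) \<le> omega p s" using real by (simp add: omega_def ennreal_leI)
    then show ?thesis by (rule order_trans) simp
  qed (use assms False in \<open>auto simp: omega_def\<close>)
qed

text \<open>The relation between G and p is asked almost everywhere only, so that G can be Borel and
  bounded by 1 at every point.\<close>

definition exponent_rep :: "(real^3 \<Rightarrow> ereal) \<Rightarrow> (real^3 \<Rightarrow> real) \<Rightarrow> bool" where
  "exponent_rep p G \<longleftrightarrow> (AE x in lborel. 1 \<le> p x \<and> G x = real_of_ereal (1 / p x)) \<and>
     G \<in> borel_measurable borel \<and> (\<forall>x. 0 \<le> G x \<and> G x \<le> 1)"

lemma exponent_rep_AE:
  assumes "exponent_rep p G"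
  shows "AE x in lborel. \<forall>s\<ge>0. omega (p x) s = vpow (G x) (ennreal s)"
proof -
  have "AE x in lborel. 1 \<le> p x \<and> G x = real_of_ereal (1 / p x)"
    using assms unfolding exponent_rep_def by blast
  then show ?thesis by eventually_elim (simp add: omega_eq_vpow)
qed

lemma modular_eq:
  assumes "exponent_rep p G"
  shows "modular p UNIV f = (\<integral>\<^sup>+x. vpow (G x) (ennreal (norm (f x))) \<partial>lborel)"
proof -
  have "modular p UNIV f = (\<integral>\<^sup>+x. omega (p x) (norm (f x)) \<partial>lborel)"
    unfolding modular_def by (simp only: lebesgue_on_UNIV_eq nn_integral_completion)
  also have "\<dots> = (\<integral>\<^sup>+x. vpow (G x) (ennreal (norm (f x))) \<partial>lborel)"
    using exponent_rep_AE[OF assms] by (intro nn_integral_cong_AE) (auto elim!: eventually_mono)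
  finally show ?thesis .
qed

lemma modular_le_1_iff:
  assumes "exponent_rep p G" "0 < l"
  shows "modular p UNIV (\<lambda>x. f x /\<^sub>R l) \<le> 1 \<longleftrightarrow> ebnd G l (\<lambda>x. ennreal (norm (f x)))"
proof -
  have "ennreal (norm (f x /\<^sub>R l)) = ennreal (norm (f x)) / ennreal l" for x
    using assms(2) by (simp add: divide_ennreal divide_inverse_commute)
  then show ?thesis unfolding modular_eq[OF assms(1)] ebnd_def by simp
qed

text \<open>The infimum that defines the norm runs over a nonempty set: a finite modular m becomes
  at most 1 after division by M = m + 1, by \<open>vpow_shrink\<close>. The inequality for the norm
  is strict so that an element of that set below l exists.\<close>

lemma var_norm_less:
  fixes f :: "real^3 \<Rightarrow> 'b::euclidean_space"
  assumes p: "exponent_rep p G" and f: "f \<in> var_Lebesgue p UNIV" and l: "var_norm p UNIV f < l"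
  shows "ebnd G l (\<lambda>x. ennreal (norm (f x)))" "0 < l"
proof -
  have G: "0 \<le> G x" "G x \<le> 1" for x using p by (auto simp: exponent_rep_def)
  define S where "S = {l. 0 < l \<and> modular p UNIV (\<lambda>x. f x /\<^sub>R l) \<le> 1}"
  obtain k where k: "0 < k" "modular p UNIV (\<lambda>x. k *\<^sub>R f x) < \<infinity>"
    using f by (auto simp: var_Lebesgue_def)
  then obtain m where m: "modular p UNIV (\<lambda>x. k *\<^sub>R f x) = ennreal m" "0 \<le> m"
    by (cases "modular p UNIV (\<lambda>x. k *\<^sub>R f x)") auto
  define M where "M = m + 1"
  have M: "1 \<le> M" using m by (simp add: M_def)
  have "modular p UNIV (\<lambda>x. f x /\<^sub>R (M / k)) \<le> (\<integral>\<^sup>+x. ennreal (1 / M) * omega (p x) (norm (k *\<^sub>R f x)) \<partial>lebesgue)"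
  proof -
    have "modular p UNIV (\<lambda>x. f x /\<^sub>R (M / k)) = (\<integral>\<^sup>+x. omega (p x) (norm (f x /\<^sub>R (M / k))) \<partial>lborel)"
      unfolding modular_def by (simp only: lebesgue_on_UNIV_eq nn_integral_completion)
    also have "\<dots> \<le> (\<integral>\<^sup>+x. ennreal (1 / M) * omega (p x) (norm (k *\<^sub>R f x)) \<partial>lborel)"
    proof (intro nn_integral_mono_AE)
      show "AE x in lborel. omega (p x) (norm (f x /\<^sub>R (M / k))) \<le> ennreal (1 / M) * omega (p x) (norm (k *\<^sub>R f x))"
        using exponent_rep_AE[OF p]
      proof eventually_elim
        case (elim x)
        have "norm (f x /\<^sub>R (M / k)) = 1 / M * norm (k *\<^sub>R f x)" using k M by simp
        then have e: "ennreal (norm (f x /\<^sub>R (M / k))) = ennreal (1 / M) * ennreal (norm (k *\<^sub>R f x))"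
          using M by (simp only: ennreal_mult zero_le_divide_1_iff norm_ge_zero)
        have o: "omega (p x) (norm v) = vpow (G x) (ennreal (norm v))" for v :: 'b
          using elim by simp
        show ?case unfolding o e using vpow_shrink[OF G, of "1 / M" x] M by simp
      qed
    qed
    finally show ?thesis by (simp add: nn_integral_completion)
  qed
  also have "\<dots> \<le> ennreal (1 / M) * ennreal m"
  proof -
    have "(\<integral>\<^sup>+x. ennreal (1 / M) * omega (p x) (norm (k *\<^sub>R f x)) \<partial>lebesgue)
      = (\<integral>\<^sup>+x. ennreal (1 / M) * vpow (G x) (ennreal (norm (k *\<^sub>R f x))) \<partial>lborel)"
      unfolding nn_integral_completion using exponent_rep_AE[OF p]
      by (intro nn_integral_cong_AE) (auto elim!: eventually_mono)
    also have "\<dots> \<le> ennreal (1 / M) * (\<integral>\<^sup>+x. vpow (G x) (ennreal (norm (k *\<^sub>R f x))) \<partial>lborel)"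
    proof -
      have "f \<in> borel_measurable lebesgue" using f by (simp add: var_Lebesgue_def lebesgue_on_UNIV_eq)
      then obtain h where h: "h \<in> borel_measurable borel" "AE x in lborel. f x = h x"
        using lebesgue_on_borel_representative[of f UNIV] by (auto simp: lebesgue_on_UNIV_eq)
      note [measurable] = h(1)
      have [measurable]: "G \<in> borel_measurable borel" using p by (simp add: exponent_rep_def)
      have 1: "(\<integral>\<^sup>+x. vpow (G x) (ennreal (norm (k *\<^sub>R f x))) \<partial>lborel) = (\<integral>\<^sup>+x. vpow (G x) (ennreal (norm (k *\<^sub>R h x))) \<partial>lborel)"
        using h(2) by (intro nn_integral_cong_AE) (auto elim!: eventually_mono)
      have 2: "(\<integral>\<^sup>+x. ennreal (1 / M) * vpow (G x) (ennreal (norm (k *\<^sub>R f x))) \<partial>lborel) = (\<integral>\<^sup>+x. ennreal (1 / M) * vpow (G x) (ennreal (norm (k *\<^sub>R h x))) \<partial>lborel)"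
        using h(2) by (intro nn_integral_cong_AE) (auto elim!: eventually_mono)
      show ?thesis unfolding 1 2 by (subst nn_integral_cmult) auto
    qed
    finally show ?thesis using m(1) unfolding modular_eq[OF p] by simp
  qed
  also have "\<dots> \<le> 1" using M m by (simp add: ennreal_mult[symmetric] M_def)
  finally have "M / k \<in> S" using M k by (simp add: S_def)
  then have S: "S \<noteq> {}" by auto
  have "Inf S < l" using l by (simp add: var_norm_def S_def)
  then obtain l' where l': "l' \<in> S" "l' < l" using cInf_lessD[OF S] by blast
  then show "0 < l" by (simp add: S_def)
  have "ebnd G l' (\<lambda>x. ennreal (norm (f x)))"
    using l' modular_le_1_iff[OF p, of l' f] by (simp add: S_def)
  then show "ebnd G l (\<lambda>x. ennreal (norm (f x)))"
    using l' G by (auto intro: ebnd_mono simp: S_def)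
qed

lemma var_norm_nonneg: "{l. 0 < l \<and> modular p S (\<lambda>x. f x /\<^sub>R l) \<le> 1} \<noteq> {} \<Longrightarrow> 0 \<le> var_norm p S f"
  unfolding var_norm_def by (rule cInf_greatest) auto

lemma ebnd_var_norm:
  assumes p: "exponent_rep p G" and b: "ebnd G l (\<lambda>x. ennreal (norm (f x)))" "0 < l"
  shows "var_norm p UNIV f \<le> l" "0 \<le> var_norm p UNIV f"
    "f \<in> borel_measurable lebesgue \<Longrightarrow> f \<in> var_Lebesgue p UNIV"
proof -
  have m: "modular p UNIV (\<lambda>x. f x /\<^sub>R l) \<le> 1" using b modular_le_1_iff[OF p] by blast
  show "var_norm p UNIV f \<le> l"
    unfolding var_norm_def by (rule cInf_lower) (use m b in \<open>auto intro!: bdd_belowI[of _ 0]\<close>)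
  show "0 \<le> var_norm p UNIV f" using m b by (intro var_norm_nonneg) auto
  show "f \<in> var_Lebesgue p UNIV" if "f \<in> borel_measurable lebesgue"
    using that b le_less_trans[OF m] unfolding var_Lebesgue_def
    by (auto simp: lebesgue_on_UNIV_eq intro!: exI[of _ "inverse l"])
qed

text \<open>Needed because \<open>Inf\<close> of an empty set of reals is an unspecified value, taken at times where the slice is outside the
  space.\<close>

lemma borel_measurable_Inf_upset:
  fixes S :: "'a \<Rightarrow> real set"
  assumes m: "\<And>l. 0 < l \<Longrightarrow> {t \<in> space M. l \<in> S t} \<in> sets M"
    and up: "\<And>t l l'. l \<in> S t \<Longrightarrow> l < l' \<Longrightarrow> l' \<in> S t" and pos: "\<And>t l. l \<in> S t \<Longrightarrow> 0 < l"
  shows "(\<lambda>t. Inf (S t)) \<in> borel_measurable M"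
  unfolding borel_measurable_iff_less
proof
  fix a :: real
  have dense: "l < l' \<Longrightarrow> \<exists>q\<in>\<rat>. l < q \<and> q < l'" for l l' :: real by (rule Rats_dense_in_real)
  have iff: "(\<exists>l\<in>S t. l < b) \<longleftrightarrow> (\<exists>q\<in>\<rat> \<inter> {0<..<b}. q \<in> S t)" for t b
  proof
    assume "\<exists>l\<in>S t. l < b"
    then obtain l where l: "l \<in> S t" "l < b" by blast
    from dense[OF l(2)] obtain q where q: "q \<in> \<rat>" "l < q" "q < b" by blast
    then have "q \<in> S t" by (intro up[OF l(1)])
    with q pos[OF this] show "\<exists>q\<in>\<rat> \<inter> {0<..<b}. q \<in> S t" by (intro bexI[of _ q]) auto
  qed auto
  have ne: "S t \<noteq> {} \<longleftrightarrow> (\<exists>q\<in>\<rat> \<inter> {0<..}. q \<in> S t)" for t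
  proof
    assume "S t \<noteq> {}"
    then obtain l where l: "l \<in> S t" by blast
    from dense[of l "l + 1"] obtain q where q: "q \<in> \<rat>" "l < q" by auto
    then have "q \<in> S t" by (intro up[OF l])
    with q pos[OF this] show "\<exists>q\<in>\<rat> \<inter> {0<..}. q \<in> S t" by (intro bexI[of _ q]) auto
  qed auto
  have bdd: "bdd_below (S t)" for t using pos by (intro bdd_belowI[of _ 0]) (auto intro: less_imp_le)
  have eq: "{t \<in> space M. Inf (S t) < a} = {t \<in> space M. \<exists>q\<in>\<rat> \<inter> {0<..<a}. q \<in> S t}
      \<union> (if Inf {} < a then space M - {t \<in> space M. \<exists>q\<in>\<rat> \<inter> {0<..}. q \<in> S t} else {})"
  proof (intro set_eqI)
    fix t
    show "t \<in> {t \<in> space M. Inf (S t) < a} \<longleftrightarrow> t \<in> {t \<in> space M. \<exists>q\<in>\<rat> \<inter> {0<..<a}. q \<in> S t}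
      \<union> (if Inf {} < a then space M - {t \<in> space M. \<exists>q\<in>\<rat> \<inter> {0<..}. q \<in> S t} else {})"
    proof (cases "S t = {}")
      case True
      then show ?thesis by auto
    next
      case False
      then have "Inf (S t) < a \<longleftrightarrow> (\<exists>q\<in>\<rat> \<inter> {0<..<a}. q \<in> S t)"
        using cInf_less_iff[OF False bdd] iff[of t a] by blast
      then show ?thesis using False ne[of t] by auto
    qed
  qed
  have countable: "countable (\<rat> \<inter> A :: real set)" for A by (rule countable_subset[OF _ countable_rat]) auto
  have "{t \<in> space M. \<exists>q\<in>\<rat> \<inter> A. q \<in> S t} \<in> sets M" if A: "A \<subseteq> {0<..}" for A
  proof -
    have "{t \<in> space M. \<exists>q\<in>\<rat> \<inter> A. q \<in> S t} = (\<Union>q\<in>\<rat> \<inter> A. {t \<in> space M. q \<in> S t})" by auto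
    also have "\<dots> \<in> sets M" using A by (intro sets.countable_UN'' countable m) auto
    finally show ?thesis .
  qed
  note this[of "{0<..<a}"] this[of "{0<..}"]
  moreover have "{0<..<a} \<subseteq> {0<..}" by auto
  ultimately show "{t \<in> space M. Inf (S t) < a} \<in> sets M"
    unfolding eq by (auto intro!: sets.Un sets.Diff)
qed

text \<open>The admissible l form an upward closed set, and for fixed l admissibility is a
  measurable condition on t, being a bound on an integral over x.\<close>

lemma measurable_var_norm_slice:
  fixes U :: "real \<times> (real^3) \<Rightarrow> real^3"
  assumes p: "exponent_rep p G" and U: "U \<in> borel_measurable borel"
  shows "(\<lambda>t. var_norm p UNIV (\<lambda>x. U (t, x))) \<in> borel_measurable borel"
  unfolding var_norm_def
proof (rule borel_measurable_Inf_upset)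
  have G [measurable]: "G \<in> borel_measurable borel" and G0: "\<And>x. 0 \<le> G x" using p by (auto simp: exponent_rep_def)
  have [measurable]: "U \<in> borel_measurable (borel \<Otimes>\<^sub>M borel)" using U by (simp add: borel_prod)
  fix l :: real assume l: "0 < l"
  have "{t \<in> space borel. l \<in> {l. 0 < l \<and> modular p UNIV (\<lambda>x. U (t, x) /\<^sub>R l) \<le> 1}}
    = {t \<in> space borel. (\<integral>\<^sup>+x. vpow (G x) (ennreal (norm (U (t, x) /\<^sub>R l))) \<partial>lborel) \<le> 1}"
    unfolding modular_eq[OF p] using l by auto
  also have "\<dots> \<in> sets borel" by measurable
  finally show "{t \<in> space borel. l \<in> {l. 0 < l \<and> modular p UNIV (\<lambda>x. U (t, x) /\<^sub>R l) \<le> 1}} \<in> sets borel" .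
next
  fix t l l'
  have G0: "\<And>x. 0 \<le> G x" using p by (auto simp: exponent_rep_def)
  assume "l \<in> {l. 0 < l \<and> modular p UNIV (\<lambda>x. U (t, x) /\<^sub>R l) \<le> 1}" "l < l'"
  then show "l' \<in> {l. 0 < l \<and> modular p UNIV (\<lambda>x. U (t, x) /\<^sub>R l) \<le> 1}"
    using modular_le_1_iff[OF p, of l "\<lambda>x. U (t, x)"] modular_le_1_iff[OF p, of l' "\<lambda>x. U (t, x)"] G0
    by (auto intro: ebnd_mono)
qed auto

text \<open>q >= 2 holds only almost everywhere, so 1/q is truncated at 1/2. Truncation is
  1-Lipschitz and keeps both log-Hoelder conditions with the same c, it changes 1/q on a null set
  only, and the continuity it inherits gives Borel measurability.\<close>

lemma log_Hoelder_rep: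
  assumes q: "q \<in> log_Hoelder_exponents" and q2: "2 \<le> exponent_inf UNIV q"
  shows "\<exists>g c gi. exponent_rep q g \<and> g \<in> borel_measurable borel \<and> (\<forall>x. 0 \<le> g x) \<and> (\<forall>x. g x \<le> 1 / 2) \<and> 0 < c \<and>
     (\<forall>x y. \<bar>g x - g y\<bar> \<le> c / ln (exp 1 + 1 / norm (x - y))) \<and> (\<forall>x. \<bar>g x - gi\<bar> \<le> c / ln (exp 1 + norm x))"
proof -
  obtain c gi where c: "0 < c" and
    lh: "\<And>x y. \<bar>real_of_ereal (1 / q x) - real_of_ereal (1 / q y)\<bar> \<le> c / ln (exp 1 + 1 / norm (x - y))"
      "\<And>x. \<bar>real_of_ereal (1 / q x) - gi\<bar> \<le> c / ln (exp 1 + norm x)"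
    using q by (auto simp: log_Hoelder_exponents_def Let_def)
  have q1: "1 \<le> q x" for x using q by (auto simp: log_Hoelder_exponents_def var_exponents_def)
  define g where "g x = min (real_of_ereal (1 / q x)) (1 / 2)" for x
  have mm: "\<bar>min a k - min b k\<bar> \<le> \<bar>a - b\<bar>" for a b k :: real by (auto simp: min_def)
  have lhg: "\<bar>g x - g y\<bar> \<le> c / ln (exp 1 + 1 / norm (x - y))" for x y
    unfolding g_def by (rule order_trans[OF mm lh(1)])
  have "\<bar>g x - min gi (1 / 2)\<bar> \<le> c / ln (exp 1 + norm x)" for x
    unfolding g_def by (rule order_trans[OF mm lh(2)])
  moreover have "isCont g x" for x
    unfolding continuous_at_eps_delta dist_real_def
  proof (intro allI impI)
    fix e :: real assume e: "0 < e"
    \<comment> \<open>Solves c / ln(1/d) = e, the modulus of continuity contained in the log-Hoelder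
      condition.\<close>
    define d where "d = exp (- (c / e))"
    have "\<bar>g y - g x\<bar> < e" if y: "dist y x < d" for y
    proof (cases "y = x")
      case False
      then have n: "0 < norm (y - x)" by simp
      have "exp (c / e) = 1 / d" by (simp add: d_def exp_minus inverse_eq_divide)
      also have "\<dots> < 1 / norm (y - x)" using y n by (intro divide_strict_left_mono) (auto simp: dist_norm d_def)
      also have "\<dots> \<le> exp 1 + 1 / norm (y - x)" by simp
      finally have gt: "exp (c / e) < exp 1 + 1 / norm (y - x)" .
      then have "ln (exp (c / e)) < ln (exp 1 + 1 / norm (y - x))"
        by (subst ln_less_cancel_iff) (auto intro: less_trans[OF exp_gt_zero])
      then have l: "c / e < ln (exp 1 + 1 / norm (y - x))" by simp
      moreover have "0 < c / e" using c e by simp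
      ultimately have "c / ln (exp 1 + 1 / norm (y - x)) < c / (c / e)"
        using c by (intro divide_strict_left_mono mult_pos_pos) auto
      also have "\<dots> = e" using c e by simp
      finally show ?thesis using lhg[of y x] by simp
    qed (use e in simp)
    then show "\<exists>d>0. \<forall>x'. dist x' x < d \<longrightarrow> \<bar>g x' - g x\<bar> < e"
      by (intro exI[of _ d]) (auto simp: d_def)
  qed
  then have gm: "g \<in> borel_measurable borel"
    by (intro borel_measurable_continuous_onI continuous_at_imp_continuous_on) auto
  have g0: "0 \<le> g x" for x
    using q1[of x] by (cases "q x") (auto simp: g_def one_ereal_def)
  have "AE x in lebesgue_on UNIV. ereal 2 \<le> q x"
    using q2 unfolding exponent_inf_def by (intro le_Liminf_AE) simp
  then have "AE x in lborel. ereal 2 \<le> q x"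
    by (simp add: AE_lebesgue_on_iff)
  then have "AE x in lborel. 1 \<le> q x \<and> g x = real_of_ereal (1 / q x)"
  proof eventually_elim
    case (elim x)
    then have "real_of_ereal (1 / q x) \<le> 1 / 2"
      by (cases "q x") (auto simp: one_ereal_def frac_le)
    then show ?case using q1[of x] by (simp add: g_def)
  qed
  moreover have "g x \<le> 1 / 2" for x by (simp add: g_def)
  moreover have "g x \<le> 1" for x by (simp add: g_def min.coboundedI2)
  ultimately show ?thesis
    using gm g0 c lhg unfolding exponent_rep_def by blast
qed

lemma exponent_rep_const:
  assumes "1 \<le> \<nu>"
  shows "exponent_rep (\<lambda>_. ereal \<nu>) (\<lambda>_. 1 / \<nu>)"
  using assms by (auto simp: exponent_rep_def one_ereal_def)

lemma slices_AE:
  fixes u :: "real \<Rightarrow> real^3 \<Rightarrow> 'b"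
  assumes "AE z in lborel. z \<in> {0<..<T} \<times> UNIV \<longrightarrow> (case z of (t, x) \<Rightarrow> u t x) = U z"
  shows "AE t in lborel. 0 < t \<longrightarrow> t < T \<longrightarrow> (AE x in lborel. u t x = U (t, x))"
proof -
  have "AE z in lborel \<Otimes>\<^sub>M lborel. z \<in> {0<..<T} \<times> UNIV \<longrightarrow> (case z of (t, x) \<Rightarrow> u t x) = U z"
    using assms unfolding lborel_prod .
  from lborel_pair.AE_pair[OF this] show ?thesis by eventually_elim auto
qed

lemma strip_in_lebesgue [simp]: "{0<..<T::real} \<times> (UNIV :: (real^3) set) \<in> sets lebesgue"
proof -
  have "open ({0<..<T::real} \<times> (UNIV :: (real^3) set))" by (intro open_Times) auto
  then show ?thesis by (simp add: borel_open)
qed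

lemma nn_integral_lebesgue_on:
  assumes "S \<in> sets lebesgue"
  shows "(\<integral>\<^sup>+x. f x \<partial>lebesgue_on S) = (\<integral>\<^sup>+x. f x * indicator S x \<partial>lborel)"
  using assms by (subst nn_integral_restrict_space) (auto simp: nn_integral_completion)

context variable_exponent
begin

lemma X_space_XB:
  assumes q: "exponent_rep q g" and v: "v \<in> X_space q \<nu>" and l: "X_norm q \<nu> v < l"
  shows "XB l (\<lambda>x. ennreal (norm (v x)))" "0 < l"
  using var_norm_less[OF q, of v l] var_norm_less[OF exponent_rep_const, of \<nu> v l] v l \<nu>
  by (auto simp: X_space_def X_norm_def XB_def)

lemma XB_X_space:
  assumes q: "exponent_rep q g" and v: "v \<in> borel_measurable borel" and b: "XB l (\<lambda>x. ennreal (norm (v x)))" "0 < l"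
  shows "v \<in> X_space q \<nu>" "X_norm q \<nu> v \<le> l" "0 \<le> X_norm q \<nu> v"
proof -
  have vl: "v \<in> borel_measurable lebesgue" using v by (simp add: measurable_completion)
  note 1 = ebnd_var_norm[OF q, of l v]
  have "1 \<le> \<nu>" using \<nu> by simp
  note 2 = ebnd_var_norm[OF exponent_rep_const[OF this], of l v]
  show "v \<in> X_space q \<nu>" "X_norm q \<nu> v \<le> l" "0 \<le> X_norm q \<nu> v"
    using 1 2 b vl by (auto simp: X_space_def X_norm_def XB_def)
qed

text \<open>The slice bound a is in L^r(0,T) because r is a lower bound of the exponent and values
  below 1 are harmless on a bounded interval.\<close>

lemma time_X_space_rep:
  assumes q: "exponent_rep q g" and u: "u \<in> time_X_space p T q \<nu>"
    and pr: "AE t in lebesgue_on {0<..<T}. ereal r \<le> p t" "1 \<le> r"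
    and p [measurable]: "p \<in> borel_measurable (lebesgue_on {0<..<T})"
  shows "\<exists>U a. U \<in> borel_measurable borel \<and> a \<in> borel_measurable borel \<and>
     (AE z in lborel. z \<in> {0<..<T} \<times> UNIV \<longrightarrow> (case z of (t, x) \<Rightarrow> u t x) = U z) \<and>
     (AE t in lborel. 0 < t \<longrightarrow> t < T \<longrightarrow> 0 < a t \<and> XB (a t) (\<lambda>x. ennreal (norm (U (t, x))))) \<and>
     (\<integral>\<^sup>+t. ennreal (a t powr r) * indicator {0<..<T} t \<partial>lborel) < \<infinity>"
proof -
  obtain U where U: "U \<in> borel_measurable borel"
    "AE z in lborel. z \<in> {0<..<T} \<times> UNIV \<longrightarrow> (case z of (t, x) \<Rightarrow> u t x) = U z"
    using u lebesgue_on_borel_representative[of "\<lambda>(t, x). u t x" "{0<..<T} \<times> UNIV"] strip_in_lebesgue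
    by (auto simp: time_X_space_def)
  have N: "(\<lambda>t. X_norm q \<nu> (u t)) \<in> borel_measurable (lebesgue_on {0<..<T})"
    using u by (auto simp: time_X_space_def var_Lebesgue_def)
  obtain n where n [measurable]: "n \<in> borel_measurable borel" and nu: "AE t in lborel. t \<in> {0<..<T} \<longrightarrow> X_norm q \<nu> (u t) = n t"
    using lebesgue_on_borel_representative[OF N] by auto
  \<comment> \<open>Adding 1 makes the bound positive and strictly larger than the norm, as
    \<open>X_space_XB\<close> demands; the absolute value covers times at which the representative n
    is negative.\<close>
  define a where "a t = \<bar>n t\<bar> + 1" for t
  have [measurable]: "a \<in> borel_measurable borel" unfolding a_def[abs_def] by measurable
  have X: "AE t in lborel. t \<in> {0<..<T} \<longrightarrow> u t \<in> X_space q \<nu>"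
    using u by (simp add: time_X_space_def AE_lebesgue_on_iff)
  have XBa: "AE t in lborel. 0 < t \<longrightarrow> t < T \<longrightarrow> 0 < a t \<and> XB (a t) (\<lambda>x. ennreal (norm (U (t, x))))"
    using X nu slices_AE[OF U(2)]
  proof eventually_elim
    case (elim t)
    show ?case
    proof (intro impI conjI)
      assume t: "0 < t" "t < T"
      show a: "0 < a t" by (simp add: a_def add_nonneg_pos)
      have "X_norm q \<nu> (u t) < a t" using elim t by (simp add: a_def)
      then have "XB (a t) (\<lambda>x. ennreal (norm (u t x)))" using X_space_XB[OF q, of "u t" "a t"] elim t by simp
      then show "XB (a t) (\<lambda>x. ennreal (norm (U (t, x))))"
        by (rule XB_mono) (use elim t a in \<open>auto elim: eventually_mono\<close>)
    qed
  qed
  obtain l where l: "0 < l" "modular p {0<..<T} (\<lambda>t. l *\<^sub>R X_norm q \<nu> (u t)) < \<infinity>"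
    using u by (auto simp: time_X_space_def var_Lebesgue_def)
  define w where "w t = omega (p t) (norm (l *\<^sub>R X_norm q \<nu> (u t)))" for t
  note [measurable] = N
  have [measurable]: "w \<in> borel_measurable (lebesgue_on {0<..<T})" unfolding w_def omega_def by measurable
  have "(\<integral>\<^sup>+t. ennreal (a t powr r) * indicator {0<..<T} t \<partial>lborel) = (\<integral>\<^sup>+t. ennreal (a t powr r) \<partial>lebesgue_on {0<..<T})"
    by (simp add: nn_integral_lebesgue_on)
  also have "\<dots> \<le> (\<integral>\<^sup>+t. ennreal (2 powr r) * (1 + ennreal ((1 / l) powr r) * (1 + w t)) \<partial>lebesgue_on {0<..<T})"
  proof (rule nn_integral_mono_AE)
    have "AE t in lebesgue_on {0<..<T}. X_norm q \<nu> (u t) = n t"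
      using nu by (simp add: AE_lebesgue_on_iff)
    with pr(1) show "AE t in lebesgue_on {0<..<T}. ennreal (a t powr r) \<le> ennreal (2 powr r) * (1 + ennreal ((1 / l) powr r) * (1 + w t))"
    proof eventually_elim
      case (elim t)
      define s where "s = norm (l *\<^sub>R n t)"
      have ns: "\<bar>n t\<bar> = 1 / l * s" using l by (simp add: s_def abs_mult)
      have s: "0 \<le> s" by (simp add: s_def)
      have "a t powr r \<le> (2 * max 1 \<bar>n t\<bar>) powr r" using pr(2) by (intro powr_mono2) (auto simp: a_def)
      also have "\<dots> = 2 powr r * max 1 \<bar>n t\<bar> powr r" by (rule powr_mult)
      also have "\<dots> \<le> 2 powr r * (1 + \<bar>n t\<bar> powr r)" by (intro mult_left_mono) (auto simp: max_def)
      also have "\<bar>n t\<bar> powr r = (1 / l) powr r * s powr r" unfolding ns by (rule powr_mult)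
      finally have "ennreal (a t powr r) \<le> ennreal (2 powr r * (1 + (1 / l) powr r * s powr r))" by (rule ennreal_leI)
      also have "\<dots> = ennreal (2 powr r) * (1 + ennreal ((1 / l) powr r) * ennreal (s powr r))"
      proof -
        have "0 \<le> (1 / l) powr r * s powr r" by simp
        then show ?thesis
          by (simp only: ennreal_mult powr_ge_zero add_nonneg_nonneg zero_le_one ennreal_plus ennreal_1)
      qed
      also have "\<dots> \<le> ennreal (2 powr r) * (1 + ennreal ((1 / l) powr r) * (1 + omega (p t) s))"
        using pr(2) elim s by (intro mult_left_mono add_left_mono powr_le_omega) auto
      finally show ?case using elim by (simp add: s_def w_def)
    qed
  qed
  also have "\<dots> = ennreal (2 powr r) * (emeasure (lebesgue_on {0<..<T}) {0<..<T} + ennreal ((1 / l) powr r) *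
      (emeasure (lebesgue_on {0<..<T}) {0<..<T} + (\<integral>\<^sup>+t. w t \<partial>lebesgue_on {0<..<T})))"
    by (simp add: nn_integral_cmult nn_integral_add)
  also have "\<dots> < \<infinity>"
  proof -
    have "{0<..<T} \<in> lmeasurable" by (intro bounded_set_imp_lmeasurable) auto
    then have "emeasure (lebesgue_on {0<..<T}) {0<..<T} < \<infinity>"
      by (subst emeasure_restrict_space) (auto simp: fmeasurable_def)
    moreover have "(\<integral>\<^sup>+t. w t \<partial>lebesgue_on {0<..<T}) < \<infinity>" using l(2) by (simp add: modular_def w_def)
    ultimately show ?thesis by (simp add: ennreal_mult_less_top)
  qed
  finally have fin: "(\<integral>\<^sup>+t. ennreal (a t powr r) * indicator {0<..<T} t \<partial>lborel) < \<infinity>" .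
  show ?thesis
    by (intro exI[of _ U] exI[of _ a] conjI U XBa fin) measurable
qed

end

context mild
begin

section \<open>The integral equation in space-time form\<close>

lemma iterated_integral:
  fixes \<Psi> :: "real \<times> (real^3) \<Rightarrow> real^3"
  assumes \<Psi>: "\<Psi> \<in> borel_measurable borel"
    and int: "integrable lborel (\<lambda>p. indicator {0<..<t} (fst p) *\<^sub>R \<Psi> p)"
    and \<psi>: "AE s in lborel. 0 < s \<longrightarrow> s < t \<longrightarrow> \<psi> s = (LINT y|lborel. \<Psi> (s, y))"
  shows "(LINT s:{0<..<t}|lebesgue. \<psi> s) = (LINT p|lborel. indicator {0<..<t} (fst p) *\<^sub>R \<Psi> p)"
proof -
  have [measurable]: "\<Psi> \<in> borel_measurable (borel \<Otimes>\<^sub>M borel)" using \<Psi> by (simp add: borel_prod)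
  have "(LINT s:{0<..<t}|lebesgue. \<psi> s) = (LINT s|lborel. (LINT y|lborel. indicator {0<..<t} s *\<^sub>R \<Psi> (s, y)))"
    unfolding set_lebesgue_integral_def
  proof (rule lebesgue_integral_AE_eq)
    show "(\<lambda>s. LINT y|lborel. indicator {0<..<t} s *\<^sub>R \<Psi> (s, y)) \<in> borel_measurable borel" by measurable
    show "AE s in lborel. indicator {0<..<t} s *\<^sub>R \<psi> s = (LINT y|lborel. indicator {0<..<t} s *\<^sub>R \<Psi> (s, y))"
      using \<psi> by eventually_elim (auto split: split_indicator)
  qed
  also have "\<dots> = (LINT p|(lborel \<Otimes>\<^sub>M lborel). indicator {0<..<t} (fst p) *\<^sub>R \<Psi> p)"
    using lborel_pair.integral_fst'[of "\<lambda>p. indicator {0<..<t} (fst p) *\<^sub>R \<Psi> p"] int unfolding lborel_pairs by simp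
  finally show ?thesis by (simp only: lborel_pairs)
qed

text \<open>The finite majorants dominate every integrand, so the absolute convergence demanded by
  \<open>mild_solution\<close> is automatic at such a point, and Fubini identifies the iterated
  integrals with \<open>lin\<close> and \<open>bop\<close> of the Borel representatives.\<close>

lemma mild_point:
  assumes Um: "U \<in> borel_measurable borel" and U0m: "U0 \<in> borel_measurable borel" and Fm: "F \<in> borel_measurable borel"
    and u: "AE z in lborel. z \<in> {0<..<T} \<times> UNIV \<longrightarrow> (case z of (t, x) \<Rightarrow> u t x) = U z"
    and f: "AE z in lborel. z \<in> {0<..<1} \<times> UNIV \<longrightarrow> (case z of (t, x) \<Rightarrow> f t x) = F z"
    and u0: "AE x in lborel. u0 x = U0 x"
    and t: "0 < t" "t < T" "T \<le> 1" and fin: "lmaj U0 F t x < \<infinity>" "bmaj U U t x < \<infinity>"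
  shows "integrable lebesgue (\<lambda>y. heat_kernel \<alpha> t (x - y) *\<^sub>R u0 y)"
    and "set_integrable lebesgue ({0<..<t} \<times> UNIV) (\<lambda>(s, y). heat_kernel \<alpha> (t - s) (x - y) *\<^sub>R f s y)"
    and "set_integrable lebesgue ({0<..<t} \<times> UNIV)
       (\<lambda>(s, y). oseen_kernel \<alpha> (t - s) j h k (x - y) * (u s y $ h * u s y $ k))"
    and "convol (heat_kernel \<alpha> t) u0 x
           + (LINT s:{0<..<t}|lebesgue. convol (heat_kernel \<alpha> (t - s)) (f s) x)
           - (LINT s:{0<..<t}|lebesgue. oseen_convol \<alpha> (t - s) (u s) x) = lin U0 F (t, x) - bop U U (t, x)"
proof -
  note [measurable] = U0m
  have [measurable]: "U \<in> borel_measurable (borel \<Otimes>\<^sub>M borel)" "F \<in> borel_measurable (borel \<Otimes>\<^sub>M borel)"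
    using Um Fm by (simp_all add: borel_prod)
  have us: "AE s in lborel. 0 < s \<longrightarrow> s < T \<longrightarrow> (AE y in lborel. u s y = U (s, y))" by (rule slices_AE[OF u])
  have fs: "AE s in lborel. 0 < s \<longrightarrow> s < 1 \<longrightarrow> (AE y in lborel. f s y = F (s, y))" by (rule slices_AE[OF f])
  have i1: "integrable lborel (\<lambda>y. heat_kernel \<alpha> t (x - y) *\<^sub>R U0 y)"
  proof (rule integrableI_bounded)
    have "(\<integral>\<^sup>+y. ennreal (norm (heat_kernel \<alpha> t (x - y) *\<^sub>R U0 y)) \<partial>lborel) \<le> lmaj U0 F t x"
      unfolding lmaj_def using heat t
      by (intro add_increasing2 nn_integral_mono) (auto simp: R_def intro!: ennreal_leI mult_right_mono)
    then show "(\<integral>\<^sup>+y. ennreal (norm (heat_kernel \<alpha> t (x - y) *\<^sub>R U0 y)) \<partial>lborel) < \<infinity>"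
      using fin(1) by (rule le_less_trans)
  qed measurable
  show "integrable lebesgue (\<lambda>y. heat_kernel \<alpha> t (x - y) *\<^sub>R u0 y)"
    by (rule lebesgue_integral_AE_eq(2)[OF _ _ i1]) (use u0 in \<open>auto elim: eventually_mono\<close>)
  have c1: "convol (heat_kernel \<alpha> t) u0 x = (LINT y|lborel. heat_kernel \<alpha> t (x - y) *\<^sub>R U0 y)"
    unfolding convol_def by (rule lebesgue_integral_AE_eq(1)) (use u0 in \<open>auto elim: eventually_mono\<close>)
  define \<Psi> where "\<Psi> p = heat_kernel \<alpha> (t - fst p) (x - snd p) *\<^sub>R F p" for p
  have \<Psi>m: "\<Psi> \<in> borel_measurable borel" unfolding \<Psi>_def[abs_def] borel_pair_measurable by measurable
  have i2: "integrable lborel (\<lambda>p. indicator {0<..<t} (fst p) *\<^sub>R \<Psi> p)"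
  proof (rule integrableI_bounded)
    show "(\<lambda>p. indicator {0<..<t} (fst p) *\<^sub>R \<Psi> p) \<in> borel_measurable lborel"
      unfolding \<Psi>_def lborel_pairs by measurable
    have "(\<integral>\<^sup>+p. ennreal (norm (indicator {0<..<t} (fst p) *\<^sub>R \<Psi> p)) \<partial>lborel) \<le> lmaj U0 F t x"
      unfolding lmaj_def \<Psi>_def using heat
      by (intro add_increasing nn_integral_mono) (auto simp: R_def split: split_indicator intro!: ennreal_leI mult_right_mono)
    then show "(\<integral>\<^sup>+p. ennreal (norm (indicator {0<..<t} (fst p) *\<^sub>R \<Psi> p)) \<partial>lborel) < \<infinity>"
      using fin(1) by (rule le_less_trans)
  qed
  have im: "(\<lambda>p. indicator {0<..<t} (fst p) *\<^sub>R G p) \<in> borel_measurable borel"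
    if "G \<in> borel_measurable borel" for G :: "real \<times> (real^3) \<Rightarrow> 'z::euclidean_space"
  proof -
    have [measurable]: "G \<in> borel_measurable (borel \<Otimes>\<^sub>M borel)" using that by (simp add: borel_prod)
    show ?thesis unfolding borel_pair_measurable by measurable
  qed
  show "set_integrable lebesgue ({0<..<t} \<times> UNIV) (\<lambda>(s, y). heat_kernel \<alpha> (t - s) (x - y) *\<^sub>R f s y)"
    unfolding set_integrable_def
  proof (rule lebesgue_integral_AE_eq(2)[OF im[OF \<Psi>m] _ i2])
    show "AE p in lborel. indicator ({0<..<t} \<times> UNIV) p *\<^sub>R (case p of (s, y) \<Rightarrow> heat_kernel \<alpha> (t - s) (x - y) *\<^sub>R f s y)
       = indicator {0<..<t} (fst p) *\<^sub>R \<Psi> p"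
      using f by eventually_elim (use t in \<open>auto simp: \<Psi>_def indicator_def\<close>)
  qed
  have c2: "(LINT s:{0<..<t}|lebesgue. convol (heat_kernel \<alpha> (t - s)) (f s) x) = (LINT p|lborel. indicator {0<..<t} (fst p) *\<^sub>R \<Psi> p)"
  proof (rule iterated_integral[OF \<Psi>m i2])
    show "AE s in lborel. 0 < s \<longrightarrow> s < t \<longrightarrow> convol (heat_kernel \<alpha> (t - s)) (f s) x = (LINT y|lborel. \<Psi> (s, y))"
      using fs
    proof eventually_elim
      case (elim s)
      show ?case
      proof (intro impI)
        assume s: "0 < s" "s < t"
        show "convol (heat_kernel \<alpha> (t - s)) (f s) x = (LINT y|lborel. \<Psi> (s, y))"
          unfolding convol_def
        proof (rule lebesgue_integral_AE_eq(1))
          show "(\<lambda>y. \<Psi> (s, y)) \<in> borel_measurable borel" by (rule slice_measurable[OF \<Psi>m])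
          show "AE y in lborel. heat_kernel \<alpha> (t - s) (x - y) *\<^sub>R f s y = \<Psi> (s, y)"
            using elim s t by (auto simp: \<Psi>_def elim: eventually_mono)
        qed
      qed
    qed
  qed
  define \<Theta> where "\<Theta> j h k p = oseen_kernel \<alpha> (t - fst p) j h k (x - snd p) * (U p $ h * U p $ k)" for j h k p
  have \<Theta>m: "\<Theta> j h k \<in> borel_measurable borel" for j h k unfolding \<Theta>_def[abs_def] borel_pair_measurable by measurable
  have i3: "integrable lborel (\<lambda>p. indicator {0<..<t} (fst p) *\<^sub>R \<Theta> j h k p)" for j h k
  proof (rule integrableI_bounded)
    show "(\<lambda>p. indicator {0<..<t} (fst p) *\<^sub>R \<Theta> j h k p) \<in> borel_measurable lborel"
      unfolding \<Theta>_def lborel_pairs by measurable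
    have "(\<integral>\<^sup>+p. ennreal (norm (indicator {0<..<t} (fst p) *\<^sub>R \<Theta> j h k p)) \<partial>lborel) \<le> bmaj U U t x"
      unfolding bmaj_def
    proof (intro nn_integral_mono)
      fix p
      show "ennreal (norm (indicator {0<..<t} (fst p) *\<^sub>R \<Theta> j h k p))
        \<le> ennreal (KB * (kern (R (t - fst p)) (x - snd p) / R (t - fst p)) * (norm (U p) * norm (U p))) * indicator {0<..<t} (fst p)"
      proof (cases "fst p \<in> {0<..<t}")
        case True
        define e where "e = kern (R (t - fst p)) (x - snd p) / R (t - fst p)"
        have e: "0 \<le> e" using R_nonneg by (simp add: e_def kern_nonneg)
        have "\<bar>oseen_kernel \<alpha> (t - fst p) j h k (x - snd p)\<bar> \<le> CO * e"
          using oseen[of "t - fst p"] True by (simp add: e_def R_def)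
        also have "\<dots> \<le> KB * e" using CO e by (simp add: KB_def mult_right_mono)
        finally have "\<bar>\<Theta> j h k p\<bar> \<le> KB * e * (norm (U p) * norm (U p))"
          unfolding \<Theta>_def abs_mult using KB e by (intro mult_mono component_le_norm_cart) auto
        from ennreal_leI[OF this] show ?thesis using True by (simp add: e_def)
      qed simp
    qed
    then show "(\<integral>\<^sup>+p. ennreal (norm (indicator {0<..<t} (fst p) *\<^sub>R \<Theta> j h k p)) \<partial>lborel) < \<infinity>"
      using fin(2) by (rule le_less_trans)
  qed
  show "set_integrable lebesgue ({0<..<t} \<times> UNIV)
       (\<lambda>(s, y). oseen_kernel \<alpha> (t - s) j h k (x - y) * (u s y $ h * u s y $ k))"
    unfolding set_integrable_def
  proof (rule lebesgue_integral_AE_eq(2)[OF im[OF \<Theta>m[of j h k]] _ i3])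
    show "AE p in lborel. indicator ({0<..<t} \<times> UNIV) p *\<^sub>R (case p of (s, y) \<Rightarrow> oseen_kernel \<alpha> (t - s) j h k (x - y) * (u s y $ h * u s y $ k))
       = indicator {0<..<t} (fst p) *\<^sub>R \<Theta> j h k p"
      using u by eventually_elim (use t in \<open>auto simp: \<Theta>_def indicator_def\<close>)
  qed
  define \<Xi> where "\<Xi> p = K (t - fst p) (x - snd p) (U p) (U p)" for p
  have \<Xi>m: "\<Xi> \<in> borel_measurable borel" unfolding \<Xi>_def[abs_def] borel_pair_measurable by measurable
  have i4: "integrable lborel (\<lambda>p. indicator {0<..<t} (fst p) *\<^sub>R \<Xi> p)"
    unfolding \<Xi>_def by (rule integrable_bop[OF Um Um fin(2)])
  have slice_int: "AE s in lborel. integrable lborel (\<lambda>y. indicator {0<..<t} s *\<^sub>R G (s, y))"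
    if "integrable lborel (\<lambda>p. indicator {0<..<t} (fst p) *\<^sub>R G p)" for G :: "real \<times> (real^3) \<Rightarrow> 'z::euclidean_space"
    using lborel_pair.AE_integrable_fst'[of "\<lambda>p. indicator {0<..<t} (fst p) *\<^sub>R G p"] that unfolding lborel_pairs by simp
  \<comment> \<open>Sums over indices may be exchanged with the spatial integral only where each
    slice is integrable; there are finitely many triples, so this holds for almost every s.\<close>
  have "AE s in lborel. \<forall>j\<in>UNIV. \<forall>h\<in>UNIV. \<forall>k\<in>UNIV. integrable lborel (\<lambda>y. indicator {0<..<t} s *\<^sub>R \<Theta> j h k (s, y))"
    by (intro AE_finite_allI slice_int i3) auto
  then have c3: "(LINT s:{0<..<t}|lebesgue. oseen_convol \<alpha> (t - s) (u s) x) = (LINT p|lborel. indicator {0<..<t} (fst p) *\<^sub>R \<Xi> p)"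
  proof (intro iterated_integral[OF \<Xi>m i4])
    assume "AE s in lborel. \<forall>j\<in>UNIV. \<forall>h\<in>UNIV. \<forall>k\<in>UNIV. integrable lborel (\<lambda>y. indicator {0<..<t} s *\<^sub>R \<Theta> j h k (s, y))"
    then show "AE s in lborel. 0 < s \<longrightarrow> s < t \<longrightarrow> oseen_convol \<alpha> (t - s) (u s) x = (LINT y|lborel. \<Xi> (s, y))"
      using us slice_int[OF i4]
    proof eventually_elim
      case (elim s)
      show ?case
      proof (intro impI)
        assume s: "0 < s" "s < t"
        have e1: "integrable lborel (\<lambda>y. \<Theta> j h k (s, y))" for j h k using elim(1) s by simp
        have e2: "integrable lborel (\<lambda>y. \<Xi> (s, y))" using elim(3) s by simp
        have c: "convol (oseen_kernel \<alpha> (t - s) j h k) (\<lambda>y. u s y $ h * u s y $ k) x = (LINT y|lborel. \<Theta> j h k (s, y))" for j h k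
          unfolding convol_def
        proof (rule lebesgue_integral_AE_eq(1))
          show "(\<lambda>y. \<Theta> j h k (s, y)) \<in> borel_measurable borel" by (rule slice_measurable[OF \<Theta>m])
          show "AE y in lborel. oseen_kernel \<alpha> (t - s) j h k (x - y) *\<^sub>R (u s y $ h * u s y $ k) = \<Theta> j h k (s, y)"
            using elim(2) s t by (auto simp: \<Theta>_def elim: eventually_mono)
        qed
        have "(LINT y|lborel. \<Xi> (s, y)) $ j = (\<Sum>h\<in>UNIV. \<Sum>k\<in>UNIV. LINT y|lborel. \<Theta> j h k (s, y))" for j
        proof -
          have "(LINT y|lborel. \<Xi> (s, y)) $ j = (LINT y|lborel. \<Xi> (s, y) $ j)"
            by (rule integral_bounded_linear[OF bounded_linear_vec_nth e2, symmetric])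
          also have "\<dots> = (LINT y|lborel. (\<Sum>h\<in>UNIV. \<Sum>k\<in>UNIV. \<Theta> j h k (s, y)))"
            by (simp add: \<Xi>_def \<Theta>_def K_def)
          also have "\<dots> = (\<Sum>h\<in>UNIV. \<Sum>k\<in>UNIV. LINT y|lborel. \<Theta> j h k (s, y))"
            using e1 by (simp add: Bochner_Integration.integral_sum)
          finally show ?thesis .
        qed
        then show "oseen_convol \<alpha> (t - s) (u s) x = (LINT y|lborel. \<Xi> (s, y))"
          by (simp add: oseen_convol_def c vec_eq_iff)
      qed
    qed
  qed
  show "convol (heat_kernel \<alpha> t) u0 x
           + (LINT s:{0<..<t}|lebesgue. convol (heat_kernel \<alpha> (t - s)) (f s) x)
           - (LINT s:{0<..<t}|lebesgue. oseen_convol \<alpha> (t - s) (u s) x) = lin U0 F (t, x) - bop U U (t, x)"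
    unfolding c1 c2 c3 by (simp add: lin_def bop_def \<Psi>_def \<Xi>_def)
qed

text \<open>The majorants are finite almost everywhere in the strip, so only the equation remains,
  and the joint almost-everywhere statement is split into t and x. Used in one direction for the
  constructed solution and in the other for a competitor.\<close>

lemma mild_solution_iff:
  assumes Um [measurable]: "U \<in> borel_measurable borel" and U0m [measurable]: "U0 \<in> borel_measurable borel" and Fm: "F \<in> borel_measurable borel"
    and u: "AE z in lborel. z \<in> {0<..<T} \<times> UNIV \<longrightarrow> (case z of (t, x) \<Rightarrow> u t x) = U z"
    and f: "AE z in lborel. z \<in> {0<..<1} \<times> UNIV \<longrightarrow> (case z of (t, x) \<Rightarrow> f t x) = F z"
    and u0: "AE x in lborel. u0 x = U0 x" and T: "T \<le> 1"
    and fin: "\<And>t. 0 < t \<Longrightarrow> t < T \<Longrightarrow> AE x in lborel. lmaj U0 F t x < \<infinity> \<and> bmaj U U t x < \<infinity>"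
  shows "mild_solution \<alpha> T u0 f u \<longleftrightarrow>
    (AE t in lborel. 0 < t \<longrightarrow> t < T \<longrightarrow> (AE x in lborel. U (t, x) = lin U0 F (t, x) - bop U U (t, x)))"
proof -
  have [measurable]: "U \<in> borel_measurable (borel \<Otimes>\<^sub>M borel)" "lin U0 F \<in> borel_measurable (borel \<Otimes>\<^sub>M borel)"
    "bop U U \<in> borel_measurable (borel \<Otimes>\<^sub>M borel)" "F \<in> borel_measurable borel"
    using Um measurable_lin[OF U0m Fm] measurable_bop[OF Um Um] Fm by (simp_all add: borel_prod)
  have bm [measurable]: "(\<lambda>z. bmaj U U (fst z) (snd z)) \<in> borel_measurable (lborel \<Otimes>\<^sub>M lborel)"
    "(\<lambda>z. lmaj U0 F (fst z) (snd z)) \<in> borel_measurable (lborel \<Otimes>\<^sub>M lborel)"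
    by measurable
  have "AE z in lborel \<Otimes>\<^sub>M lborel. 0 < fst z \<longrightarrow> fst z < T \<longrightarrow> lmaj U0 F (fst z) (snd z) < \<infinity> \<and> bmaj U U (fst z) (snd z) < \<infinity>"
  proof (rule lborel_pair.AE_pair_measure)
    show "{z \<in> space (lborel \<Otimes>\<^sub>M lborel). 0 < fst z \<longrightarrow> fst z < T \<longrightarrow> lmaj U0 F (fst z) (snd z) < \<infinity> \<and> bmaj U U (fst z) (snd z) < \<infinity>}
      \<in> sets (lborel \<Otimes>\<^sub>M lborel)" by measurable
    show "AE x in lborel. AE y in lborel. 0 < fst (x, y) \<longrightarrow> fst (x, y) < T \<longrightarrow>
      lmaj U0 F (fst (x, y)) (snd (x, y)) < \<infinity> \<and> bmaj U U (fst (x, y)) (snd (x, y)) < \<infinity>"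
    proof (rule AE_I2)
      fix t :: real
      show "AE y in lborel. 0 < fst (t, y) \<longrightarrow> fst (t, y) < T \<longrightarrow> lmaj U0 F (fst (t, y)) (snd (t, y)) < \<infinity> \<and> bmaj U U (fst (t, y)) (snd (t, y)) < \<infinity>"
        using fin[of t] by (cases "0 < t \<and> t < T") (auto elim: eventually_mono)
    qed
  qed
  then have finz: "AE z in lborel. 0 < fst z \<longrightarrow> fst z < T \<longrightarrow> lmaj U0 F (fst z) (snd z) < \<infinity> \<and> bmaj U U (fst z) (snd z) < \<infinity>"
    unfolding lborel_prod .
  have "mild_solution \<alpha> T u0 f u \<longleftrightarrow> (AE z in lborel. z \<in> {0<..<T} \<times> UNIV \<longrightarrow> U z = lin U0 F z - bop U U z)"
    unfolding mild_solution_def AE_lebesgue_on_iff[OF strip_in_lebesgue]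
  proof (rule eventually_cong)
    show "AE z in lborel. (0 < fst z \<longrightarrow> fst z < T \<longrightarrow> lmaj U0 F (fst z) (snd z) < \<infinity> \<and> bmaj U U (fst z) (snd z) < \<infinity>)
      \<and> (z \<in> {0<..<T} \<times> UNIV \<longrightarrow> (case z of (t, x) \<Rightarrow> u t x) = U z)"
      using finz u by eventually_elim auto
    fix z :: "real \<times> (real^3)"
    assume A: "(0 < fst z \<longrightarrow> fst z < T \<longrightarrow> lmaj U0 F (fst z) (snd z) < \<infinity> \<and> bmaj U U (fst z) (snd z) < \<infinity>)
      \<and> (z \<in> {0<..<T} \<times> UNIV \<longrightarrow> (case z of (t, x) \<Rightarrow> u t x) = U z)"
    obtain t x where z: "z = (t, x)" by (cases z)
    show "(z \<in> {0<..<T} \<times> UNIV \<longrightarrow> (case z of (t, x) \<Rightarrow>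
      integrable lebesgue (\<lambda>y. heat_kernel \<alpha> t (x - y) *\<^sub>R u0 y) \<and>
     set_integrable lebesgue ({0<..<t} \<times> UNIV)
       (\<lambda>(s, y). heat_kernel \<alpha> (t - s) (x - y) *\<^sub>R f s y) \<and>
     (\<forall>j h k. set_integrable lebesgue ({0<..<t} \<times> UNIV)
       (\<lambda>(s, y). oseen_kernel \<alpha> (t - s) j h k (x - y) * (u s y $ h * u s y $ k))) \<and>
     u t x = convol (heat_kernel \<alpha> t) u0 x
           + (LINT s:{0<..<t}|lebesgue. convol (heat_kernel \<alpha> (t - s)) (f s) x)
           - (LINT s:{0<..<t}|lebesgue. oseen_convol \<alpha> (t - s) (u s) x)))
      \<longleftrightarrow> (z \<in> {0<..<T} \<times> UNIV \<longrightarrow> U z = lin U0 F z - bop U U z)"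
    proof (cases "0 < t \<and> t < T")
      case True
      then have t: "0 < t" "t < T" and fin: "lmaj U0 F t x < \<infinity>" "bmaj U U t x < \<infinity>" and uU: "u t x = U (t, x)"
        using A by (auto simp: z)
      note M = mild_point[OF Um U0m Fm u f u0 t T fin]
      show ?thesis unfolding z prod.case M(4) uU using t M(1-3) by auto
    qed (auto simp: z)
  qed
  also have "\<dots> \<longleftrightarrow> (AE z in lborel \<Otimes>\<^sub>M lborel. 0 < fst z \<longrightarrow> fst z < T \<longrightarrow> U (fst z, snd z) = lin U0 F (fst z, snd z) - bop U U (fst z, snd z))"
    unfolding lborel_prod by (intro eventually_cong[OF always_eventually]) (auto simp: mem_Times_iff)
  also have "\<dots> \<longleftrightarrow> (AE t in lborel. AE x in lborel. 0 < t \<longrightarrow> t < T \<longrightarrow> U (t, x) = lin U0 F (t, x) - bop U U (t, x))"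
    by (rule lborel_pair.AE_pair_iff[symmetric, where P = "\<lambda>t x. 0 < t \<longrightarrow> t < T \<longrightarrow> U (t, x) = lin U0 F (t, x) - bop U U (t, x)"]) measurable
  also have "\<dots> \<longleftrightarrow> (AE t in lborel. 0 < t \<longrightarrow> t < T \<longrightarrow> (AE x in lborel. U (t, x) = lin U0 F (t, x) - bop U U (t, x)))"
    by (intro eventually_cong[OF always_eventually]) auto
  finally show ?thesis .
qed

end

section \<open>The main theorem\<close>

text \<open>P may be infinite, while Young's inequality needs a finite r; then r is taken so large
  that 2 \<alpha>/r uses at most half of the gap d. The last inequality is 2 \<alpha>/r + 3/(2
  \<nu>) < \<alpha> - 1/2 multiplied by 2 and rearranged.\<close>

lemma exponent_choice:
  fixes P M :: ereal
  assumes \<alpha>: "1 / 2 < \<alpha>" and \<nu>: "3 < \<nu>" and P: "2 < P" and M: "ereal (3 / \<nu>) \<le> M"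
    and less: "ereal (2 * \<alpha>) / P + 1 / 2 * M < ereal (\<alpha> - 1 / 2)"
  shows "\<exists>r>2. ereal r \<le> P \<and> (1 + 3 / \<nu>) / (2 * \<alpha>) < 1 - 2 / r"
proof -
  have "1 / 2 * ereal (3 / \<nu>) \<le> 1 / 2 * M"
    using M by (rule ereal_mult_left_mono) simp
  then have "ereal (2 * \<alpha>) / P + 1 / 2 * ereal (3 / \<nu>) < ereal (\<alpha> - 1 / 2)"
    using less by (meson add_left_mono le_less_trans)
  moreover have "1 / 2 * ereal (3 / \<nu>) = ereal (3 / (2 * \<nu>))"
    by (simp add: one_ereal_def numeral_eq_ereal mult.commute)
  ultimately have *: "ereal (2 * \<alpha>) / P + ereal (3 / (2 * \<nu>)) < ereal (\<alpha> - 1 / 2)" by metis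
  have "\<exists>r>2. ereal r \<le> P \<and> 2 * \<alpha> / r + 3 / (2 * \<nu>) < \<alpha> - 1 / 2"
  proof (cases P)
    case (real r)
    then have "2 < r" using P by (simp add: numeral_eq_ereal)
    then show ?thesis using * real by (intro exI[of _ r]) simp
  next
    case PInf
    define d where "d = \<alpha> - 1 / 2 - 3 / (2 * \<nu>)"
    have d: "0 < d" using * PInf by (simp add: d_def)
    define r where "r = max 3 (4 * \<alpha> / d)"
    have r: "2 < r" "4 * \<alpha> / d \<le> r" by (auto simp: r_def)
    have "4 * \<alpha> \<le> r * d" using r(2) d by (simp add: divide_le_eq)
    then have "2 * \<alpha> / r \<le> d / 2" using r(1) by (simp add: field_simps)
    then have "2 * \<alpha> / r + 3 / (2 * \<nu>) < \<alpha> - 1 / 2" using d by (simp add: d_def)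
    then show ?thesis using r PInf by (intro exI[of _ r]) simp
  qed (use P in simp)
  then obtain r where r: "2 < r" "ereal r \<le> P" "2 * \<alpha> / r + 3 / (2 * \<nu>) < \<alpha> - 1 / 2" by blast
  have "1 + 3 / \<nu> < 2 * \<alpha> * (1 - 2 / r)"
  proof -
    have "3 / \<nu> = 2 * (3 / (2 * \<nu>))" "2 * \<alpha> * (1 - 2 / r) = 2 * \<alpha> - 2 * (2 * \<alpha> / r)"
      by (simp_all add: algebra_simps)
    then show ?thesis using r(3) by linarith
  qed
  then have "(1 + 3 / \<nu>) / (2 * \<alpha>) < 1 - 2 / r"
    using \<alpha> by (simp add: divide_less_eq mult.commute)
  then show ?thesis using r by blast
qed

context mild
begin

lemma small_time:
  assumes "0 < A0"
  shows "\<exists>T>0. T \<le> 1 \<and> 8 * \<kappa> T * A0 \<le> 1"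
proof -
  \<comment> \<open>The value of T^(1 - \<gamma>) at which 8 \<kappa> T A0 equals 1.\<close>
  define w where "w = (1 - \<gamma>) / (8 * KB * C * A0)"
  have w: "0 < w" using \<gamma> KB C assms by (simp add: w_def)
  define T where "T = min 1 (w powr (1 / (1 - \<gamma>)))"
  have T: "0 < T" "T \<le> 1" using w by (auto simp: T_def)
  have "T powr (1 - \<gamma>) \<le> (w powr (1 / (1 - \<gamma>))) powr (1 - \<gamma>)"
    using T \<gamma> by (intro powr_mono2) (auto simp: T_def)
  also have "\<dots> = w" using w \<gamma> by (simp add: powr_powr)
  finally have Tw: "T powr (1 - \<gamma>) \<le> w" .
  have "8 * \<kappa> T * A0 = (8 * KB * C * A0 / (1 - \<gamma>)) * T powr (1 - \<gamma>)" by (simp add: \<kappa>_def)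
  also have "\<dots> \<le> (8 * KB * C * A0 / (1 - \<gamma>)) * w"
    using Tw \<gamma> KB C assms by (intro mult_left_mono) auto
  also have "\<dots> = 1" using \<gamma> KB C assms by (simp add: w_def)
  finally show ?thesis using T by blast
qed

text \<open>After division by A the norm is at most 1, where \<open>omega\<close> is at most 1 for
  every exponent including infinity; the interval has finite measure, so the modular is
  finite.\<close>

lemma bounded_in_time_X_space:
  assumes q: "exponent_rep q g" and U [measurable]: "U \<in> borel_measurable borel" and A: "0 < A"
    and X: "\<And>t. 0 < t \<Longrightarrow> t < T \<Longrightarrow> XB A (nm U t)" and p: "\<And>t. 0 < t \<Longrightarrow> t < T \<Longrightarrow> 1 \<le> p t"
  shows "(\<lambda>t x. U (t, x)) \<in> time_X_space p T q \<nu>"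
proof -
  note XU = XB_X_space[OF q slice_measurable[OF U] X A]
  have "(\<lambda>t. X_norm q \<nu> (\<lambda>x. U (t, x))) \<in> borel_measurable borel"
    unfolding X_norm_def using \<nu>
    by (intro borel_measurable_max measurable_var_norm_slice[OF q U] measurable_var_norm_slice[OF exponent_rep_const U]) auto
  then have m: "(\<lambda>t. X_norm q \<nu> (\<lambda>x. U (t, x))) \<in> borel_measurable (lebesgue_on {0<..<T})"
    by (intro measurable_restrict_space1) (simp add: measurable_completion)
  have "modular p {0<..<T} (\<lambda>t. (1 / A) *\<^sub>R X_norm q \<nu> (\<lambda>x. U (t, x))) \<le> (\<integral>\<^sup>+t. 1 \<partial>lebesgue_on {0<..<T})"
    unfolding modular_def
  proof (rule nn_integral_mono)
    fix t assume "t \<in> space (lebesgue_on {0<..<T})"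
    then have t: "0 < t" "t < T" by (auto simp: space_restrict_space)
    show "omega (p t) (norm ((1 / A) *\<^sub>R X_norm q \<nu> (\<lambda>x. U (t, x)))) \<le> 1"
      using XU[OF t] A p[OF t] by (intro omega_le_1) auto
  qed
  also have "\<dots> < \<infinity>"
  proof -
    have "{0<..<T} \<in> lmeasurable" by (intro bounded_set_imp_lmeasurable) auto
    then show ?thesis by (simp add: emeasure_restrict_space fmeasurable_def)
  qed
  finally have "(\<lambda>t. X_norm q \<nu> (\<lambda>x. U (t, x))) \<in> var_Lebesgue p {0<..<T}"
    using m A unfolding var_Lebesgue_def by (auto intro!: exI[of _ "1 / A"])
  moreover have "(\<lambda>(t, x). U (t, x)) \<in> borel_measurable (lebesgue_on ({0<..<T} \<times> UNIV))"
    by (intro measurable_restrict_space1) (use U in \<open>simp add: measurable_completion\<close>)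
  moreover have "AE t in lebesgue_on {0<..<T}. (\<lambda>x. U (t, x)) \<in> X_space q \<nu>"
    by (rule AE_I2) (use XU in \<open>auto simp: space_restrict_space\<close>)
  ultimately show ?thesis by (simp add: time_X_space_def)
qed

end

theorem theorem4p12:
  fixes \<alpha> \<nu> :: real
    and q :: "real^3 \<Rightarrow> ereal"
    and p :: "real \<Rightarrow> ereal"
    and u0 :: "real^3 \<Rightarrow> real^3"
    and f :: "real \<Rightarrow> real^3 \<Rightarrow> real^3"
  assumes "1/2 < \<alpha>" and "\<alpha> \<le> 1"
    and "q \<in> log_Hoelder_exponents"
    and "2 \<le> exponent_inf UNIV q"
    and "3 < \<nu>" and "ereal \<nu> \<le> 2 * exponent_inf UNIV q"
    and "p \<in> var_exponents {0<..<1}"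
    and "2 < exponent_inf {0<..<1} p"
    and "ereal (2 * \<alpha>) / exponent_inf {0<..<1} p
         + 1/2 * max (6 / exponent_inf UNIV q * (1 - ereal \<nu> / (2 * exponent_sup UNIV q)))
                     (3 / ereal \<nu>)
         < ereal (\<alpha> - 1/2)"
    and "f \<in> time_X_space (\<lambda>_. 1) 1 q \<nu>"
    and "AE t in lebesgue_on {0<..<1}. divergence_free (f t)"
    and "u0 \<in> X_space q \<nu>"
    and "divergence_free u0"
  shows "\<exists>T. 0 < T \<and> T \<le> 1 \<and>
    (\<exists>u \<in> time_X_space p T q \<nu>. mild_solution \<alpha> T u0 f u \<and>
      (\<forall>v \<in> time_X_space p T q \<nu>. mild_solution \<alpha> T u0 f v \<longrightarrow>
        (AE (t, x) in lebesgue_on ({0<..<T} \<times> UNIV). v t x = u t x)))"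
proof -
  obtain g c gi where gq: "exponent_rep q g" "g \<in> borel_measurable borel" "\<And>x. 0 \<le> g x" "\<And>x. g x \<le> 1 / 2" "0 < c"
    "\<And>x y. \<bar>g x - g y\<bar> \<le> c / ln (exp 1 + 1 / norm (x - y))" "\<And>x. \<bar>g x - gi\<bar> \<le> c / ln (exp 1 + norm x)"
    using log_Hoelder_rep[OF assms(3,4)] by blast
  interpret variable_exponent g c gi \<nu>
    by standard (use gq assms(5) in auto)
  have "ereal (3 / \<nu>) \<le> max (6 / exponent_inf UNIV q * (1 - ereal \<nu> / (2 * exponent_sup UNIV q))) (3 / ereal \<nu>)"
    using assms(5) by (simp add: le_max_iff_disj numeral_eq_ereal)
  from exponent_choice[OF assms(1,5,8) this assms(9)]
  obtain r where rr: "2 < r" "ereal r \<le> exponent_inf {0<..<1} p" "(1 + 3 / \<nu>) / (2 * \<alpha>) < 1 - 2 / r" by blast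
  obtain C where C: "1 \<le> C" and slice: "\<And>R u v a b. 0 < R \<Longrightarrow> u \<in> borel_measurable borel \<Longrightarrow> v \<in> borel_measurable borel \<Longrightarrow>
      (\<And>y. 0 \<le> u y) \<Longrightarrow> (\<And>y. 0 \<le> v y) \<Longrightarrow> 0 < a \<Longrightarrow> 0 < b \<Longrightarrow> XB a (\<lambda>y. ennreal (u y)) \<Longrightarrow> XB b (\<lambda>y. ennreal (v y)) \<Longrightarrow>
       XB (C * a) (\<lambda>x. \<integral>\<^sup>+y. ennreal (kern R (x - y) * u y) \<partial>lborel) \<and>
       XB (C * a * b * R powr (- 3 / \<nu>)) (\<lambda>x. \<integral>\<^sup>+y. ennreal (kern R (x - y) * u y * v y) \<partial>lborel)"
    using slice_bounds by blast
  obtain CH where CH: "0 < CH" "\<And>t z. 0 < t \<Longrightarrow> \<bar>heat_kernel \<alpha> t z\<bar> \<le> CH * kern (t powr (1 / (2 * \<alpha>))) z"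
    using heat_kernel_bound[OF assms(1,2)] unfolding kern_def by blast
  obtain CO where CO: "0 < CO" "\<And>t z j h k. 0 < t \<Longrightarrow> \<bar>oseen_kernel \<alpha> t j h k z\<bar> \<le> CO / (t powr (1 / (2 * \<alpha>)) + norm z) ^ 4"
    using oseen_kernel_bound[OF assms(1,2)] by blast
  interpret mild g c gi \<nu> \<alpha> r C CH CO
  proof
    show "\<bar>oseen_kernel \<alpha> t j h k z\<bar> \<le> CO * (kern (t powr (1 / (2 * \<alpha>))) z / t powr (1 / (2 * \<alpha>)))" if "0 < t" for t z j h k
      using CO(2)[OF that, of j h k z] that by (simp add: kern_def)
  qed (use assms rr C CH CO slice in auto)
  have "u0 \<in> borel_measurable (lebesgue_on UNIV)" using assms(12) by (simp add: X_space_def var_Lebesgue_def)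
  from lebesgue_on_borel_representative[OF this]
  obtain U0 where U0: "U0 \<in> borel_measurable borel" "AE x in lborel. u0 x = U0 x" by auto
  \<comment> \<open>The added 1 gives the strict inequality that \<open>X_space_XB\<close>
    requires.\<close>
  define l0 where "l0 = X_norm q \<nu> u0 + 1"
  have X0: "XB l0 (\<lambda>x. ennreal (norm (u0 x)))" "0 < l0"
    using X_space_XB[OF gq(1) assms(12), of l0] by (auto simp: l0_def)
  have XU0: "XB l0 (\<lambda>x. ennreal (norm (U0 x)))"
    by (rule XB_mono[OF X0(1)]) (use U0(2) X0(2) in \<open>auto elim: eventually_mono\<close>)
  obtain F n where F: "F \<in> borel_measurable borel" and n [measurable]: "n \<in> borel_measurable borel"
    and fF: "AE z in lborel. z \<in> {0<..<1} \<times> UNIV \<longrightarrow> (case z of (t, x) \<Rightarrow> f t x) = F z"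
    and XF: "AE t in lborel. 0 < t \<longrightarrow> t < 1 \<longrightarrow> 0 < n t \<and> XB (n t) (nm F t)"
    and nfin: "(\<integral>\<^sup>+t. ennreal (n t powr 1) * indicator {0<..<1} t \<partial>lborel) < \<infinity>"
    using time_X_space_rep[OF gq(1) assms(10), of 1] by (auto simp: one_ereal_def)
  have "(\<integral>\<^sup>+t. ennreal (n t) * indicator {0<..<1} t \<partial>lborel) \<le> (\<integral>\<^sup>+t. ennreal (n t powr 1) * indicator {0<..<1} t \<partial>lborel)"
  proof (intro nn_integral_mono mult_right_mono)
    show "ennreal (n t) \<le> ennreal (n t powr 1)" for t
      by (cases "0 \<le> n t") (auto simp: ennreal_neg)
  qed simp
  then have "(\<integral>\<^sup>+t. ennreal (n t) * indicator {0<..<1} t \<partial>lborel) < \<infinity>" using nfin by (rule le_less_trans)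
  then obtain I where I: "(\<integral>\<^sup>+t. ennreal (n t) * indicator {0<..<1} t \<partial>lborel) = ennreal I" "0 \<le> I"
    by (cases "\<integral>\<^sup>+t. ennreal (n t) * indicator {0<..<1} t \<partial>lborel") auto
  \<comment> \<open>I + 1 instead of I, because \<open>XB_lmaj\<close> asks for a positive bound on
    the time integral of the force.\<close>
  define A0 where "A0 = CH * C * (l0 + (I + 1))"
  have A0: "0 < A0" using CH C X0 I by (simp add: A0_def)
  have XL: "XB A0 (lmaj U0 F t)" if "0 < t" "t \<le> 1" for t
    unfolding A0_def
    by (rule XB_lmaj[OF U0(1) F n X0(2) XU0 XF _ _ that]) (use I in \<open>auto intro: ennreal_leI\<close>)
  have mL: "lmaj U0 F t \<in> borel_measurable borel" for t
    using measurable_lmaj[OF U0(1) F measurable_const measurable_ident_sets[OF refl]] by simp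
  obtain T where T: "0 < T" "T \<le> 1" "8 * \<kappa> T * A0 \<le> 1" using small_time[OF A0] by blast
  obtain U where U: "U \<in> borel_measurable borel" and XU: "\<And>t. 0 < t \<Longrightarrow> t < T \<Longrightarrow> XB (2 * A0) (nm U t)"
    and eqU: "\<And>t. 0 < t \<Longrightarrow> t < T \<Longrightarrow> AE x in lborel. U (t, x) = lin U0 F (t, x) - bop U U (t, x)"
    using local_existence[OF U0(1) F A0 XL T] by blast
  have lfin: "AE x in lborel. lmaj U0 F t x < \<infinity>" if "0 < t" "t < T" for t
    by (rule XB_finite[OF XL]) (use that T mL in auto)
  have mild_u: "mild_solution \<alpha> T u0 f (\<lambda>t x. U (t, x))"
  proof (subst mild_solution_iff[OF U U0(1) F _ fF U0(2) T(2)])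
    show "AE x in lborel. lmaj U0 F t x < \<infinity> \<and> bmaj U U t x < \<infinity>" if t: "0 < t" "t < T" for t
    proof -
      have "AE x in lborel. bmaj U U t x < \<infinity>"
        by (rule XB_finite[OF XB_bmaj_const[OF U U _ _ XU XU t] bmaj_slice_measurable[OF U U]]) (use A0 in auto)
      with lfin[OF t] show ?thesis by eventually_elim auto
    qed
  qed (use eqU in auto)
  have p1: "1 \<le> p t" if "0 < t" "t < 1" for t using assms(7) that by (auto simp: var_exponents_def)
  have "p \<in> borel_measurable (lebesgue_on {0<..<1})" using assms(7) by (simp add: var_exponents_def)
  then have pT: "p \<in> borel_measurable (lebesgue_on {0<..<T})"
    by (rule measurable_restrict_mono) (use T in auto)
  have "AE t in lebesgue_on {0<..<1}. ereal r \<le> p t"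
    using rr(2) unfolding exponent_inf_def by (rule le_Liminf_AE)
  then have "AE t in lborel. t \<in> {0<..<1} \<longrightarrow> ereal r \<le> p t" by (simp add: AE_lebesgue_on_iff)
  then have pr: "AE t in lebesgue_on {0<..<T}. ereal r \<le> p t"
    using T by (subst AE_lebesgue_on_iff) (auto elim: eventually_mono)
  show ?thesis
  proof (intro exI[of _ T] conjI T bexI[of _ "\<lambda>t x. U (t, x)"] mild_u ballI impI)
    show "(\<lambda>t x. U (t, x)) \<in> time_X_space p T q \<nu>"
      by (rule bounded_in_time_X_space[OF gq(1) U _ XU]) (use A0 T p1 in auto)
    fix v assume v: "v \<in> time_X_space p T q \<nu>" "mild_solution \<alpha> T u0 f v"
    obtain V a where V: "V \<in> borel_measurable borel" and a: "a \<in> borel_measurable borel"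
      and vV: "AE z in lborel. z \<in> {0<..<T} \<times> UNIV \<longrightarrow> (case z of (t, x) \<Rightarrow> v t x) = V z"
      and XV: "AE t in lborel. 0 < t \<longrightarrow> t < T \<longrightarrow> 0 < a t \<and> XB (a t) (nm V t)"
      and ar: "(\<integral>\<^sup>+t. ennreal (a t powr r) * indicator {0<..<T} t \<partial>lborel) < \<infinity>"
      using time_X_space_rep[OF gq(1) v(1) pr _ pT] rr by auto
    \<comment> \<open>The competitor v is only known to have slice norms in L^r of time. The
      equation improves this to the bound A0 + L, the two terms coming from its linear and bilinear
      parts, and A below is a common bound for both solutions.\<close>
    obtain L where L: "0 < L" "\<And>t. 0 < t \<Longrightarrow> t < T \<Longrightarrow> XB L (bmaj V V t)"
      using solution_bounded[OF V a A0 XL U0(1) F T(2) XV ar] by blast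
    have "AE x in lborel. lmaj U0 F t x < \<infinity> \<and> bmaj V V t x < \<infinity>" if t: "0 < t" "t < T" for t
      using lfin[OF t] XB_finite[OF L(2)[OF t] bmaj_slice_measurable[OF V V]] by eventually_elim auto
    with v(2) have eqV: "AE t in lborel. 0 < t \<longrightarrow> t < T \<longrightarrow> (AE x in lborel. V (t, x) = lin U0 F (t, x) - bop V V (t, x))"
      using mild_solution_iff[OF V U0(1) F vV fF U0(2) T(2)] by blast
    define A where "A = max (2 * A0) (A0 + L)"
    have A: "0 < A" "2 * A0 \<le> A" "A0 + L \<le> A" using A0 by (auto simp: A_def)
    have "AE t in lborel. 0 < t \<longrightarrow> t < T \<longrightarrow> XB A (nm U t) \<and> XB A (nm V t)"
      using eqV
    proof eventually_elim
      case (elim t)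
      show ?case
      proof (intro impI conjI)
        assume t: "0 < t" "t < T"
        show "XB A (nm U t)" by (rule XB_mono[OF XU[OF t]]) (use A A0 in auto)
        have "XB (A0 + L) (\<lambda>x. lmaj U0 F t x + bmaj V V t x)"
          using t T A0 L XL mL bmaj_slice_measurable[OF V V] by (intro XB_add) auto
        then show "XB A (nm V t)"
        proof (rule XB_mono)
          have "AE x in lborel. V (t, x) = lin U0 F (t, x) - bop V V (t, x)" using elim t by blast
          then show "AE x in lborel. nm V t x \<le> lmaj U0 F t x + bmaj V V t x"
          proof eventually_elim
            case (elim x)
            have "nm V t x \<le> ennreal (norm (lin U0 F (t, x)) + norm (bop V V (t, x)))"
              unfolding elim by (intro ennreal_leI norm_triangle_ineq4)
            also have "\<dots> \<le> lmaj U0 F t x + bmaj V V t x"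
              using norm_bop_le norm_lin_le[OF t(1)] by (simp add: add_mono)
            finally show ?case .
          qed
        qed (use A A0 L in auto)
      qed
    qed
    then have eq: "AE t in lborel. 0 < t \<longrightarrow> t < T \<longrightarrow> (AE x in lborel. V (t, x) = U (t, x))"
      using eqU by (intro solution_unique[OF U V T(1,2) A(1) _ _ eqV]) auto
    have "AE z in lborel \<Otimes>\<^sub>M lborel. 0 < fst z \<longrightarrow> fst z < T \<longrightarrow> V z = U z"
    proof (rule lborel_pair.AE_pair_measure)
      have [measurable]: "V \<in> borel_measurable (borel \<Otimes>\<^sub>M borel)" "U \<in> borel_measurable (borel \<Otimes>\<^sub>M borel)"
        using U V by (simp_all add: borel_prod)
      show "{z \<in> space (lborel \<Otimes>\<^sub>M lborel). 0 < fst z \<longrightarrow> fst z < T \<longrightarrow> V z = U z} \<in> sets (lborel \<Otimes>\<^sub>M lborel)"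
        by measurable
      show "AE t in lborel. AE x in lborel. 0 < fst (t, x) \<longrightarrow> fst (t, x) < T \<longrightarrow> V (t, x) = U (t, x)"
        using eq by eventually_elim (auto elim: eventually_mono)
    qed
    then have "AE z in lborel. 0 < fst z \<longrightarrow> fst z < T \<longrightarrow> V z = U z" unfolding lborel_prod .
    with vV show "AE (t, x) in lebesgue_on ({0<..<T} \<times> UNIV). v t x = U (t, x)"
      unfolding AE_lebesgue_on_iff[OF strip_in_lebesgue] by eventually_elim auto
  qed
qed

end
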